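(* Let $\mathbb{K}\in\{\mathbb{R},\mathbb{C}\}$, let $A,E\in\mathbb{K}^{m\times n}$, put $\widetilde{A}=A+E$, and let $A$ have rank $k\ge1$ and compact SVD $A=W_k\Sigma_kV_k^*$. Let $I\subset\{1,\dots,m\}$ and $J\subset\{1,\dots,n\}$, and put $C=A(:,J)$, $R=A(I,:)$, $U=A(I,J)$, $\widetilde{C}=\widetilde{A}(:,J)$, $\widetilde{R}=\widetilde{A}(I,:)$, $\widetilde{U}=\widetilde{A}(I,J)$. Assume $\operatorname{rank}(C)=\operatorname{rank}(U)=\operatorname{rank}(R)=k$. Let $\|\cdot\|$ be a normalized, uniformly generated, unitarily invariant, submultiplicative norm with pseudoinverse perturbation constant $\mu\in[1,3]$ (see context). Suppose that $W_{k,I}=W_k(I,:)$ has maximal volume among all $|I|\times k$ submatrices of $W_k$ and $V_{k,J}=V_k(J,:)$ has maximal volume among all $|J|\times k$ submatrices of $V_k$. Write \[ t(k,m,|I|)=\sqrt{1+\frac{k(m-|I|)}{|I|-k+1}},\qquad t(k,n,|J|)=\sqrt{1+\frac{k(n-|J|)}{|J|-k+1}}. \] Then \[\|A-\widetilde{C}_k\widetilde{C}_k^\dagger\widetilde{A}\widetilde{R}_k^\dagger\widetilde{R}_k\|\leq \left(2t(k,m,|I|)+2t(k,n,|J|)+3\right)\|E\|.\] If additionally $\sigma_k(A)\geq 4\mu\, t(k,m,|I|)\,t(k,n,|J|)\,\|E\|$, then \[ \|A-\widetilde{C}\widetilde{U}_k^\dagger\widetilde{R}\|\leq \left[\frac{1}{2\mu}+\left(1+\frac{1}{2\mu}\right)\left(t(k,m,|I|)+t(k,n,|J|)\right)+\left(4+\frac{1}{2\mu}\right)t(k,m,|I|)\,t(k,n,|J|)\right]\|E\|.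 \]
   Context: For a matrix $B$ and index sets $I,J$, $B(I,J)$ is the submatrix with rows in $I$ and columns in $J$; $B(I,:)$ keeps all columns and $B(:,J)$ keeps all rows. $B^\dagger$ is the Moore--Penrose pseudoinverse; $\|B\|_2$ is the spectral norm; $\sigma_i(B)$ is the $i$-th singular value in descending order. $B_k$ denotes the truncated SVD of order $k$ of $B$ (best rank-$k$ approximation), and $B_k^\dagger=(B_k)^\dagger$. The volume of $B\in\mathbb{K}^{p\times q}$ is $\prod_{i=1}^{\min\{p,q\}}\sigma_i(B)$. The compact SVD of a rank-$k$ matrix $A\in\mathbb{K}^{m\times n}$ is $A=W_k\Sigma_kV_k^*$ with $W_k\in\mathbb{K}^{m\times k}$, $V_k\in\mathbb{K}^{n\times k}$ having orthonormal columns and $\Sigma_k$ the $k\times k$ diagonal matrix of the positive singular values in descending order. A "normalized, uniformly generated, unitarily invariant, submultiplicative norm" is a family of norms $\|\cdot\|:\bigcup_{p,q\ge 1}\mathbb{K}^{p\times q}\to\mathbb{R}$ (a norm on each $\mathbb{K}^{p\times q}$) such that: $\|x\|=\|x\|_2$ (Euclidean norm) for every vector $x$ viewed as a matrix (normalized); there is a single symmetric function $\phi$ with $\|B\|=\phi(\sigma_1(B),\dots,\sigma_r(B))$, $r=\operatorname{rank}(B)$, for matrices $B$ of every size (uniformly generated); $\|\cdot\|$ is invariant under left and right multiplication by unitary matrices; and $\|BD\|\le\|B\|\|D\|$ whenever $BD$ is defined. All Schatten $p$-norms, $1\le p\le\infty$, are examples. Pseudoinverse perturbation constant (Stewart): $\mu\in[1,3]$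 is a constant depending only on the norm $\|\cdot\|$ such that for all matrices $B,\widetilde{B}$ of the same size, $\|B^\dagger-\widetilde{B}^\dagger\|\le\mu\|\widetilde{B}^\dagger\|_2\|B^\dagger\|_2\|\widetilde{B}-B\|$ if $\operatorname{rank}(B)=\operatorname{rank}(\widetilde{B})$, and $\|B^\dagger-\widetilde{B}^\dagger\|\le\mu\max\{\|\widetilde{B}^\dagger\|_2^2,\|B^\dagger\|_2^2\}\|\widetilde{B}-B\|$ otherwise. ($\mu=3$ works for every such norm; $\mu=\sqrt2$ for the Frobenius norm, $\mu=\frac{1+\sqrt5}{2}$ for the spectral norm.) *)

theory Defs
  imports
    "Jordan_Normal_Form.Schur_Decomposition"
    "Jordan_Normal_Form.DL_Rank"
    "Jordan_Normal_Form.DL_Submatrix"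
begin

text \<open>
  The scalar field \<open>K\<close> is a subset of the complex numbers, either \<open>\<real>\<close> or \<open>UNIV\<close>. Matrices over
  \<open>K\<close> are complex matrices whose entries lie in \<open>K\<close>; for \<open>K = \<real>\<close> the adjoint is the transpose and
  unitary means orthogonal. Rank, singular values and pseudoinverse of a real matrix do not depend
  on whether it is regarded as real or as complex, so these notions do not mention \<open>K\<close>.
\<close>

definition mats_over :: "complex set \<Rightarrow> nat \<Rightarrow> nat \<Rightarrow> complex mat set" where
  "mats_over K p q = {B \<in> carrier_mat p q. elements_mat B \<subseteq> K}"

definition unitaries_over :: "complex set \<Rightarrow> nat \<Rightarrow> complex mat set" where
  "unitaries_over K p =
     {Q \<in> mats_over K p p. mat_adjoint Q * Q = 1\<^sub>m p \<and> Q * mat_adjoint Q = 1\<^sub>m p}"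

definition mat_rank :: "complex mat \<Rightarrow> nat" where
  "mat_rank B = vec_space.rank (dim_row B) B"

text \<open>
  Singular values are the square roots of the eigenvalues of \<open>B\<^sup>* B\<close>, taken with algebraic
  multiplicity and in descending order. The index of \<open>singular_value\<close> starts at 1, and the value
  beyond \<open>min p q\<close> is 0.
\<close>

definition singular_value_list :: "complex mat \<Rightarrow> real list" where
  "singular_value_list B =
     rev (sorted_list_of_multiset
       (image_mset (\<lambda>z. sqrt (Re z)) (proots (char_poly (mat_adjoint B * B)))))"

definition singular_value :: "complex mat \<Rightarrow> nat \<Rightarrow> real" where
  "singular_value B i =
     (if 1 \<le> i \<and> i \<le> min (dim_row B) (dim_col B) then singular_value_list B ! (i - 1) else 0)"

definition spectral_norm :: "complex mat \<Rightarrow> real" where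
  "spectral_norm B = singular_value B 1"

definition volume :: "complex mat \<Rightarrow> real" where
  "volume B = (\<Prod>i = 1..min (dim_row B) (dim_col B). singular_value B i)"

text \<open>The Moore--Penrose pseudoinverse, by the four Penrose conditions.\<close>

definition pinv :: "complex mat \<Rightarrow> complex mat" where
  "pinv B = (THE X. X \<in> carrier_mat (dim_col B) (dim_row B) \<and>
     B * X * B = B \<and> X * B * X = X \<and>
     mat_adjoint (B * X) = B * X \<and> mat_adjoint (X * B) = X * B)"

definition compact_svd ::
    "complex set \<Rightarrow> nat \<Rightarrow> complex mat \<Rightarrow> complex mat \<Rightarrow> complex mat \<Rightarrow> complex mat \<Rightarrow> bool" where
  "compact_svd K k A W S V \<longleftrightarrow>
     mat_rank A = k \<and>
     W \<in> mats_over K (dim_row A) k \<and> mat_adjoint W * W = 1\<^sub>m k \<and>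
     V \<in> mats_over K (dim_col A) k \<and> mat_adjoint V * V = 1\<^sub>m k \<and>
     S = mat_diag k (\<lambda>i. of_real (singular_value A (Suc i))) \<and>
     A = W * S * mat_adjoint V"

text \<open>
  \<open>X\<close> is obtained from some singular value decomposition of \<open>B\<close> over \<open>K\<close> by discarding all but the
  \<open>k\<close> largest singular values. This is a relation, because \<open>X\<close> is not unique when the singular
  values number \<open>k\<close> and \<open>k + 1\<close> of \<open>B\<close> coincide and are nonzero. If the rank of \<open>B\<close> is at most
  \<open>k\<close> then \<open>X = B\<close>.
\<close>

definition truncated_svd :: "complex set \<Rightarrow> nat \<Rightarrow> complex mat \<Rightarrow> complex mat \<Rightarrow> bool" where
  "truncated_svd K k B X \<longleftrightarrow>
     (\<exists>W \<in> unitaries_over K (dim_row B). \<exists>V \<in> unitaries_over K (dim_col B).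
        B = W * mat (dim_row B) (dim_col B)
                  (\<lambda>(i, j). if i = j then of_real (singular_value B (Suc i)) else 0)
              * mat_adjoint V \<and>
        X = W * mat (dim_row B) (dim_col B)
                  (\<lambda>(i, j). if i = j \<and> i < k then of_real (singular_value B (Suc i)) else 0)
              * mat_adjoint V)"

definition norm_family :: "complex set \<Rightarrow> (complex mat \<Rightarrow> real) \<Rightarrow> bool" where
  "norm_family K N \<longleftrightarrow>
     (\<forall>p > 0. \<forall>q > 0.
        (\<forall>B \<in> mats_over K p q. 0 \<le> N B \<and> (N B = 0 \<longleftrightarrow> B = 0\<^sub>m p q)) \<and>
        (\<forall>c \<in> K. \<forall>B \<in> mats_over K p q. N (c \<cdot>\<^sub>m B) = cmod c * N B) \<and>
        (\<forall>B \<in> mats_over K p q. \<forall>D \<in> mats_over K p q. N (B + D) \<le> N B + N D))"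

definition normalized :: "complex set \<Rightarrow> (complex mat \<Rightarrow> real) \<Rightarrow> bool" where
  "normalized K N \<longleftrightarrow>
     (\<forall>p > 0. \<forall>x \<in> mats_over K p 1. N x = sqrt (\<Sum>i<p. (cmod (x $$ (i, 0)))\<^sup>2))"

text \<open>
  A symmetric function of a variable number of arguments is a function on lists that is invariant
  under permutation.
\<close>

definition uniformly_generated :: "complex set \<Rightarrow> (complex mat \<Rightarrow> real) \<Rightarrow> bool" where
  "uniformly_generated K N \<longleftrightarrow>
     (\<exists>\<phi> :: real list \<Rightarrow> real.
        (\<forall>xs ys. mset xs = mset ys \<longrightarrow> \<phi> xs = \<phi> ys) \<and>
        (\<forall>p > 0. \<forall>q > 0. \<forall>B \<in> mats_over K p q.
           N B = \<phi> (map (singular_value B) [1..<Suc (mat_rank B)])))"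

definition unitarily_invariant :: "complex set \<Rightarrow> (complex mat \<Rightarrow> real) \<Rightarrow> bool" where
  "unitarily_invariant K N \<longleftrightarrow>
     (\<forall>p > 0. \<forall>q > 0. \<forall>B \<in> mats_over K p q.
        \<forall>P \<in> unitaries_over K p. \<forall>Q \<in> unitaries_over K q. N (P * B * Q) = N B)"

definition submultiplicative :: "complex set \<Rightarrow> (complex mat \<Rightarrow> real) \<Rightarrow> bool" where
  "submultiplicative K N \<longleftrightarrow>
     (\<forall>p > 0. \<forall>q > 0. \<forall>r > 0. \<forall>B \<in> mats_over K p q. \<forall>D \<in> mats_over K q r.
        N (B * D) \<le> N B * N D)"

definition pinv_perturbation_constant ::
    "complex set \<Rightarrow> (complex mat \<Rightarrow> real) \<Rightarrow> real \<Rightarrow> bool" where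
  "pinv_perturbation_constant K N \<mu> \<longleftrightarrow>
     1 \<le> \<mu> \<and> \<mu> \<le> 3 \<and>
     (\<forall>p > 0. \<forall>q > 0. \<forall>B \<in> mats_over K p q. \<forall>D \<in> mats_over K p q.
        (mat_rank B = mat_rank D \<longrightarrow>
           N (pinv B - pinv D) \<le> \<mu> * spectral_norm (pinv D) * spectral_norm (pinv B) * N (D - B)) \<and>
        (mat_rank B \<noteq> mat_rank D \<longrightarrow>
           N (pinv B - pinv D) \<le>
             \<mu> * max ((spectral_norm (pinv D))\<^sup>2) ((spectral_norm (pinv B))\<^sup>2) * N (D - B)))"

text \<open>
  Row and column indices start at 0, so index sets are subsets of \<open>{..<m}\<close>; the argument \<open>UNIV\<close> of
  \<open>submatrix\<close> keeps all rows or all columns.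
\<close>

definition max_volume_rows :: "complex mat \<Rightarrow> nat set \<Rightarrow> bool" where
  "max_volume_rows W I \<longleftrightarrow>
     (\<forall>I' \<subseteq> {..<dim_row W}. card I' = card I \<longrightarrow>
        volume (submatrix W I' UNIV) \<le> volume (submatrix W I UNIV))"

definition t_const :: "nat \<Rightarrow> nat \<Rightarrow> nat \<Rightarrow> real" where
  "t_const k m l = sqrt (1 + real k * (real m - real l) / (real l - real k + 1))"

end

theory Submission
  imports Defs "HOL-Analysis.L2_Norm"
begin

text \<open>
  A uniformly generated, unitarily invariant norm depends only on the singular values and, by sign
  flips of diagonal entries and convexity, is monotone in them. All norm estimates therefore reduce
  to inequalities between singular values, which follow from the Courant--Fischer principle: the
  effect of multiplication by bounded matrices, Weyl's inequality, and Mirsky's theorem that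
  truncation is a best rank-\<open>k\<close> approximation. Only the matrices inside the norm need entries in
  \<open>K\<close>, so the spectral theorem is used over the complex numbers only.

  Maximality of the volume under exchange of one row gives \<open>\<bar>x\<bar> \<le> t \<bar>W\<^sub>I x\<bar>\<close> for all \<open>x\<close>, hence
  matrices \<open>L\<close> and \<open>M\<close> of spectral norm at most \<open>t(k,m,|I|)\<close> and \<open>t(k,n,|J|)\<close> with
  \<open>A = L U M\<close>, \<open>C = L U\<close> and \<open>R = U M\<close>. The projection estimate comes from
  \<open>A - P A' Q = (1 - P) C M + P L R (1 - Q) - P E Q\<close>. For the second one \<open>L\<close> and \<open>M\<close> are factored
  out of \<open>A - C X R\<close>, where \<open>X\<close> is the pseudoinverse of the truncation of the perturbed \<open>U\<close>, and
  the gap assumption bounds \<open>\<bar>X\<bar> \<bar>E\<bar>\<close> by \<open>1 / (2 \<mu>)\<close>.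
\<close>

section \<open>Adjoints and the Euclidean norm\<close>

lemma dim_mat_adjoint [simp]:
  "dim_row (mat_adjoint A) = dim_col A" "dim_col (mat_adjoint A) = dim_row A"
  by (simp_all add: mat_adjoint_def)

lemma mat_adjoint_carrier [simp, intro]:
  "A \<in> carrier_mat p q \<Longrightarrow> mat_adjoint A \<in> carrier_mat q p"
  by (rule carrier_matI) auto

lemma index_mat_adjoint [simp]:
  fixes A :: "complex mat"
  assumes "i < dim_col A" "j < dim_row A"
  shows "mat_adjoint A $$ (i, j) = cnj (A $$ (j, i))"
  using assms by (simp add: mat_adjoint_def mat_of_rows_def)

lemma mat_adjoint_adjoint [simp]: "mat_adjoint (mat_adjoint A) = (A :: complex mat)"
  by (rule eq_matI) auto

lemma mat_adjoint_mult:
  fixes A B :: "complex mat"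
  assumes "dim_col A = dim_row B"
  shows "mat_adjoint (A * B) = mat_adjoint B * mat_adjoint A"
  by (rule eq_matI) (use assms in \<open>auto simp: scalar_prod_def ac_simps intro!: sum.cong\<close>)

lemma mat_adjoint_one [simp]: "mat_adjoint (1\<^sub>m n) = (1\<^sub>m n :: complex mat)"
  by (rule eq_matI) auto

lemma mat_adjoint_minus:
  fixes A B :: "complex mat"
  assumes "A \<in> carrier_mat p q" "B \<in> carrier_mat p q"
  shows "mat_adjoint (A - B) = mat_adjoint A - mat_adjoint B"
  by (rule eq_matI) (use assms in auto)

lemma mat_mult_assoc:
  fixes A B C :: "complex mat"
  assumes "dim_col A = dim_row B" "dim_col B = dim_row C"
  shows "A * B * C = A * (B * C)"
  by (rule assoc_mult_mat[of _ "dim_row A" "dim_col A" _ "dim_col B" _ "dim_col C"])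
    (use assms in auto)

lemma mat_mult_vec_assoc:
  fixes A B :: "complex mat"
  assumes "dim_col A = dim_row B" "dim_vec v = dim_col B"
  shows "A * B *\<^sub>v v = A *\<^sub>v (B *\<^sub>v v)"
  by (rule assoc_mult_mat_vec[of _ "dim_row A" "dim_col A" _ "dim_col B"])
    (use assms in \<open>auto intro: carrier_vecI\<close>)

lemma mat_mult_vec_smult:
  fixes A :: "complex mat"
  assumes "dim_vec v = dim_col A"
  shows "A *\<^sub>v (c \<cdot>\<^sub>v v) = c \<cdot>\<^sub>v (A *\<^sub>v v)"
  by (rule mult_mat_vec[of _ "dim_row A" "dim_col A"]) (use assms in \<open>auto intro: carrier_vecI\<close>)

lemma mat_mult_distribs:
  fixes A B C :: "complex mat"
  shows "dim_row A = dim_row B \<Longrightarrow> dim_col A = dim_col B \<Longrightarrow> dim_col A = dim_row C \<Longrightarrow>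
      (A + B) * C = A * C + B * C"
    and "dim_row B = dim_row C \<Longrightarrow> dim_col B = dim_col C \<Longrightarrow> dim_col A = dim_row B \<Longrightarrow>
      A * (B + C) = A * B + A * C"
    and "dim_row A = dim_row B \<Longrightarrow> dim_col A = dim_col B \<Longrightarrow> dim_col A = dim_row C \<Longrightarrow>
      (A - B) * C = A * C - B * C"
    and "dim_row B = dim_row C \<Longrightarrow> dim_col B = dim_col C \<Longrightarrow> dim_col A = dim_row B \<Longrightarrow>
      A * (B - C) = A * B - A * C"
  by (auto intro!: eq_matI simp: scalar_prod_def algebra_simps sum.distrib sum_subtractf)

definition vnorm :: "complex vec \<Rightarrow> real" where
  "vnorm v = L2_set (\<lambda>i. cmod (v $ i)) {..<dim_vec v}"

lemma vnorm_nonneg [simp]: "0 \<le> vnorm v"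
  by (simp add: vnorm_def)

lemma vnorm_sq: "(vnorm v)\<^sup>2 = (\<Sum>i<dim_vec v. (cmod (v $ i))\<^sup>2)"
  by (simp add: vnorm_def L2_set_def sum_nonneg)

lemma vnorm_eq_0: "v \<in> carrier_vec n \<Longrightarrow> vnorm v = 0 \<longleftrightarrow> v = 0\<^sub>v n"
  by (auto simp: vnorm_def L2_set_eq_0_iff intro!: eq_vecI)

lemma vnorm_zero [simp]: "vnorm (0\<^sub>v n) = 0"
  by (simp add: vnorm_eq_0[of _ n])

lemma vnorm_pos: "v \<in> carrier_vec n \<Longrightarrow> v \<noteq> 0\<^sub>v n \<Longrightarrow> 0 < vnorm v"
  using vnorm_eq_0[of v n] vnorm_nonneg[of v] by linarith

lemma vnorm_triangle:
  assumes "v \<in> carrier_vec n" "w \<in> carrier_vec n"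
  shows "vnorm (v + w) \<le> vnorm v + vnorm w"
proof -
  have "vnorm (v + w) \<le> L2_set (\<lambda>i. cmod (v $ i) + cmod (w $ i)) {..<n}"
    unfolding vnorm_def using assms by (auto intro!: L2_set_mono norm_triangle_ineq)
  also have "\<dots> \<le> vnorm v + vnorm w"
    using L2_set_triangle_ineq assms by (auto simp: vnorm_def)
  finally show ?thesis .
qed

lemma cscalar_prod_self: "v \<bullet>c v = of_real ((vnorm v)\<^sup>2)"
proof -
  have "v \<bullet>c v = (\<Sum>i<dim_vec v. of_real ((cmod (v $ i))\<^sup>2))"
    by (auto simp: scalar_prod_def atLeast0LessThan complex_norm_square simp del: of_real_power
        intro!: sum.cong)
  then show ?thesis by (simp add: vnorm_sq)
qed

lemma cscalar_prod_le:
  assumes "v \<in> carrier_vec n" "w \<in> carrier_vec n"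
  shows "cmod (v \<bullet>c w) \<le> vnorm v * vnorm w"
proof -
  have "cmod (v \<bullet>c w) \<le> (\<Sum>i<n. \<bar>cmod (v $ i)\<bar> * \<bar>cmod (w $ i)\<bar>)"
    unfolding scalar_prod_def using assms
    by (auto simp: atLeast0LessThan norm_mult intro!: sum_norm_le)
  also have "\<dots> \<le> vnorm v * vnorm w"
    using assms L2_set_mult_ineq[of "\<lambda>i. cmod (v $ i)" "\<lambda>i. cmod (w $ i)" "{..<n}"]
    by (auto simp: vnorm_def)
  finally show ?thesis .
qed

lemma cscalar_prod_mult_left:
  fixes A :: "complex mat"
  assumes "A \<in> carrier_mat p q" "v \<in> carrier_vec q" "w \<in> carrier_vec p"
  shows "(A *\<^sub>v v) \<bullet>c w = v \<bullet>c (mat_adjoint A *\<^sub>v w)"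
proof -
  have "(A *\<^sub>v v) \<bullet>c w = (\<Sum>i<p. \<Sum>j<q. A $$ (i, j) * v $ j * cnj (w $ i))"
    using assms by (auto simp: scalar_prod_def atLeast0LessThan sum_distrib_right intro!: sum.cong)
  also have "\<dots> = (\<Sum>j<q. \<Sum>i<p. A $$ (i, j) * v $ j * cnj (w $ i))"
    by (rule sum.swap)
  also have "\<dots> = v \<bullet>c (mat_adjoint A *\<^sub>v w)"
    using assms
    by (auto simp: scalar_prod_def atLeast0LessThan sum_distrib_left ac_simps intro!: sum.cong)
  finally show ?thesis .
qed

lemma vnorm_mult_sq:
  assumes "A \<in> carrier_mat p q" "v \<in> carrier_vec q"
  shows "of_real ((vnorm (A *\<^sub>v v))\<^sup>2) = v \<bullet>c ((mat_adjoint A * A) *\<^sub>v v)"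
proof -
  have "of_real ((vnorm (A *\<^sub>v v))\<^sup>2) = (A *\<^sub>v v) \<bullet>c (A *\<^sub>v v)"
    by (simp add: cscalar_prod_self)
  also have "\<dots> = v \<bullet>c (mat_adjoint A *\<^sub>v (A *\<^sub>v v))"
    by (rule cscalar_prod_mult_left) (use assms in auto)
  finally show ?thesis
    using assms by (simp add: assoc_mult_mat_vec[of _ q p _ q])
qed

lemma isometry_vnorm:
  assumes "Q \<in> carrier_mat p q" "mat_adjoint Q * Q = 1\<^sub>m q" "v \<in> carrier_vec q"
  shows "vnorm (Q *\<^sub>v v) = vnorm v"
proof -
  have "(of_real ((vnorm (Q *\<^sub>v v))\<^sup>2) :: complex) = of_real ((vnorm v)\<^sup>2)"
    using vnorm_mult_sq[OF assms(1,3)] assms by (simp add: cscalar_prod_self)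
  then show ?thesis
    by (metis of_real_eq_iff power2_eq_iff_nonneg vnorm_nonneg)
qed

definition op_bounded :: "complex mat \<Rightarrow> real \<Rightarrow> bool" where
  "op_bounded B c \<longleftrightarrow> (\<forall>x \<in> carrier_vec (dim_col B). vnorm (B *\<^sub>v x) \<le> c * vnorm x)"

lemma op_boundedI:
  assumes "B \<in> carrier_mat p q" "\<And>x. x \<in> carrier_vec q \<Longrightarrow> vnorm (B *\<^sub>v x) \<le> c * vnorm x"
  shows "op_bounded B c"
  using assms by (auto simp: op_bounded_def)

lemma op_boundedD:
  assumes "op_bounded B c" "B \<in> carrier_mat p q" "x \<in> carrier_vec q"
  shows "vnorm (B *\<^sub>v x) \<le> c * vnorm x"
  using assms by (auto simp: op_bounded_def)

lemma op_bounded_mono: "op_bounded B c \<Longrightarrow> c \<le> d \<Longrightarrow> op_bounded B d"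
  unfolding op_bounded_def by (meson mult_right_mono order_trans vnorm_nonneg)

lemma op_bounded_isometry:
  "Q \<in> carrier_mat p q \<Longrightarrow> mat_adjoint Q * Q = 1\<^sub>m q \<Longrightarrow> op_bounded Q 1"
  by (rule op_boundedI) (auto simp: isometry_vnorm)

lemma op_bounded_mult:
  assumes "op_bounded A c" "op_bounded B d" "A \<in> carrier_mat p q" "B \<in> carrier_mat q r" "0 \<le> c"
  shows "op_bounded (A * B) (c * d)"
proof (rule op_boundedI)
  show "A * B \<in> carrier_mat p r" using assms by auto
  fix x :: "complex vec" assume x: "x \<in> carrier_vec r"
  have "vnorm (A * B *\<^sub>v x) = vnorm (A *\<^sub>v (B *\<^sub>v x))"
    using assms x by (simp add: assoc_mult_mat_vec[of _ p q _ r])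
  also have "\<dots> \<le> c * vnorm (B *\<^sub>v x)"
    using assms x by (intro op_boundedD) auto
  also have "\<dots> \<le> c * (d * vnorm x)"
    using assms x by (intro mult_left_mono op_boundedD) auto
  finally show "vnorm (A * B *\<^sub>v x) \<le> c * d * vnorm x" by simp
qed

lemma op_bounded_add:
  assumes "op_bounded A c" "op_bounded B d" "A \<in> carrier_mat p q" "B \<in> carrier_mat p q"
  shows "op_bounded (A + B) (c + d)"
proof (rule op_boundedI)
  show "A + B \<in> carrier_mat p q" using assms by auto
  fix x :: "complex vec" assume x: "x \<in> carrier_vec q"
  have "vnorm ((A + B) *\<^sub>v x) \<le> vnorm (A *\<^sub>v x) + vnorm (B *\<^sub>v x)"
    using assms x by (subst add_mult_distrib_mat_vec[of _ p q]) (auto intro!: vnorm_triangle[of _ p])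
  also have "\<dots> \<le> c * vnorm x + d * vnorm x"
    using assms x by (intro add_mono op_boundedD) auto
  finally show "vnorm ((A + B) *\<^sub>v x) \<le> (c + d) * vnorm x" by (simp add: algebra_simps)
qed

lemma op_bounded_adjoint:
  assumes "op_bounded B c" "B \<in> carrier_mat p q" "0 \<le> c"
  shows "op_bounded (mat_adjoint B) c"
proof (rule op_boundedI)
  show "mat_adjoint B \<in> carrier_mat q p" using assms by auto
  fix y :: "complex vec" assume y: "y \<in> carrier_vec p"
  let ?z = "mat_adjoint B *\<^sub>v y"
  have z: "?z \<in> carrier_vec q"
    using assms y by (intro mult_mat_vec_carrier[of _ q p]) auto
  have "(vnorm ?z)\<^sup>2 = cmod (?z \<bullet>c ?z)"
    by (simp add: cscalar_prod_self norm_power)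
  also have "?z \<bullet>c ?z = y \<bullet>c (mat_adjoint (mat_adjoint B) *\<^sub>v ?z)"
    using assms y z by (intro cscalar_prod_mult_left) auto
  also have "cmod \<dots> \<le> vnorm y * vnorm (B *\<^sub>v ?z)"
    unfolding mat_adjoint_adjoint
    using assms y z by (intro cscalar_prod_le[of _ p] mult_mat_vec_carrier[of _ p q]) auto
  also have "\<dots> \<le> vnorm y * (c * vnorm ?z)"
    using assms y z by (intro mult_left_mono op_boundedD) auto
  finally have "vnorm ?z * vnorm ?z \<le> (c * vnorm y) * vnorm ?z"
    by (simp add: power2_eq_square ac_simps)
  then show "vnorm ?z \<le> c * vnorm y"
    by (metis assms(3) mult_le_cancel_right mult_nonneg_nonneg order_le_less vnorm_nonneg)
qed

lemma unitary_right_inverse: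
  fixes Q :: "complex mat"
  assumes "Q \<in> carrier_mat n n" "mat_adjoint Q * Q = 1\<^sub>m n"
  shows "Q * mat_adjoint Q = 1\<^sub>m n"
  using mat_mult_left_right_inverse[of "mat_adjoint Q" n Q] assms by auto

lemma nontrivial_kernel:
  fixes F :: "complex mat"
  assumes F: "F \<in> carrier_mat i q" and "i < q"
  obtains x where "x \<in> carrier_vec q" "x \<noteq> 0\<^sub>v q" "F *\<^sub>v x = 0\<^sub>v i"
proof -
  define H where "H = mat q q (\<lambda>(a, b). if a < i then F $$ (a, b) else 0)"
  have H: "H \<in> carrier_mat q q" by (simp add: H_def)
  have "H\<^sup>T *\<^sub>v unit_vec q i = 0\<^sub>v q"
    using assms by (intro eq_vecI) (auto simp: H_def)
  moreover have "unit_vec q i \<noteq> (0\<^sub>v q :: complex vec)"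
    using assms(2) by (metis index_unit_vec(2) index_zero_vec(1) zero_neq_one)
  ultimately have "det H\<^sup>T = 0"
    using det_0_iff_vec_prod_zero_field[of "H\<^sup>T" q] H unit_vec_carrier[of q i]
    by (metis transpose_carrier_mat)
  then have "det H = 0" by (simp add: det_transpose[OF H])
  then obtain x where x: "x \<in> carrier_vec q" "x \<noteq> 0\<^sub>v q" "H *\<^sub>v x = 0\<^sub>v q"
    using det_0_iff_vec_prod_zero_field[OF H] by auto
  have "F *\<^sub>v x = 0\<^sub>v i"
  proof (rule eq_vecI)
    fix a assume "a < dim_vec (0\<^sub>v i)"
    then have a: "a < i" by simp
    have "row F a = row H a" using assms a by (intro eq_vecI) (auto simp: H_def)
    then have "(F *\<^sub>v x) $ a = (H *\<^sub>v x) $ a" using a assms H by auto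
    then show "(F *\<^sub>v x) $ a = 0\<^sub>v i $ a" using x a assms by simp
  qed (use F in auto)
  with x that show ?thesis by blast
qed

section \<open>Diagonalization of Gram matrices\<close>

lemma unitary_completion:
  fixes v :: "complex vec"
  assumes v: "v \<in> carrier_vec n" "v \<noteq> 0\<^sub>v n"
  obtains W c where "W \<in> carrier_mat n n" "mat_adjoint W * W = 1\<^sub>m n" "col W 0 = c \<cdot>\<^sub>v v"
proof -
  interpret cof_vec_space n "TYPE(complex)" .
  have n: "n \<noteq> 0" using v by auto
  define ws where "ws = gram_schmidt n (basis_completion v)"
  from basis_completion[OF v] have b: "distinct (basis_completion v)"
    "\<not> lin_dep (set (basis_completion v))" "set (basis_completion v) \<subseteq> carrier_vec n"
    "hd (basis_completion v) = v" "length (basis_completion v) = n" by auto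
  then obtain vs where bv: "basis_completion v = v # vs" using n
    by (cases "basis_completion v") auto
  from gram_schmidt_result[OF b(3,1,2) ws_def] have ws: "corthogonal ws"
    "set ws \<subseteq> carrier_vec n" "length ws = n" using b by auto
  have hd: "ws ! 0 = v"
    using gram_schmidt_hd[OF v(1), of vs] ws n unfolding ws_def bv
    by (metis hd_conv_nth list.size(3))
  have wsc: "ws ! i \<in> carrier_vec n" if "i < n" for i
    using ws that by auto
  have nz: "vnorm (ws ! i) \<noteq> 0" if "i < n" for i
  proof -
    have "ws ! i \<bullet>c ws ! i \<noteq> 0" using ws that corthogonalD[of ws i i] by auto
    then show ?thesis by (auto simp: cscalar_prod_self)
  qed
  define W where "W = mat n n (\<lambda>(a, i). ws ! i $ a / of_real (vnorm (ws ! i)))"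
  have W: "W \<in> carrier_mat n n" by (simp add: W_def)
  have "mat_adjoint W * W = 1\<^sub>m n"
  proof (rule eq_matI)
    fix i j assume "i < dim_row (1\<^sub>m n)" "j < dim_col (1\<^sub>m n)"
    then have ij: "i < n" "j < n" by auto
    have "(mat_adjoint W * W) $$ (i, j) = (\<Sum>a<n. cnj (W $$ (a, i)) * W $$ (a, j))"
      using ij W by (auto simp: scalar_prod_def atLeast0LessThan intro!: sum.cong)
    also have "\<dots> = (\<Sum>a<n. ws ! j $ a * cnj (ws ! i $ a)) / of_real (vnorm (ws ! i) * vnorm (ws ! j))"
      using ij by (auto simp: W_def sum_divide_distrib field_simps intro!: sum.cong)
    also have "(\<Sum>a<n. ws ! j $ a * cnj (ws ! i $ a)) = ws ! j \<bullet>c ws ! i"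
      using wsc[OF ij(1)] wsc[OF ij(2)]
      by (auto simp: scalar_prod_def atLeast0LessThan intro!: sum.cong)
    also have "\<dots> / of_real (vnorm (ws ! i) * vnorm (ws ! j)) = 1\<^sub>m n $$ (i, j)"
    proof (cases "i = j")
      case True
      then show ?thesis using nz[OF ij(1)] ij by (simp add: cscalar_prod_self power2_eq_square)
    next
      case False
      then show ?thesis using corthogonalD[OF ws(1), of j i] ws ij by auto
    qed
    finally show "(mat_adjoint W * W) $$ (i, j) = 1\<^sub>m n $$ (i, j)" .
  qed (use W in auto)
  moreover have "col W 0 = (1 / of_real (vnorm v)) \<cdot>\<^sub>v v"
    using n v hd by (intro eq_vecI) (auto simp: W_def)
  ultimately show ?thesis using that W by blast
qed

lemma hermitian_diagonalization:
  fixes H :: "complex mat"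
  assumes "H \<in> carrier_mat n n" "mat_adjoint H = H"
    and "char_poly H = (\<Prod>a \<leftarrow> es. [:- a, 1:])"
  shows "\<exists>Q \<in> carrier_mat n n. mat_adjoint Q * Q = 1\<^sub>m n \<and>
           mat_adjoint Q * H * Q = mat_diag n (\<lambda>i. es ! i)"
  using assms
proof (induction es arbitrary: n H)
  case Nil
  then have "n = 0" using degree_monic_char_poly[of H n] by auto
  then show ?case using Nil by (intro bexI[of _ "1\<^sub>m 0"]) (auto simp: mat_diag_def intro!: eq_matI)
next
  case (Cons e es)
  note H = Cons.prems(1)
  have mon: "monic (\<Prod>e\<leftarrow>es. [:- e, 1:])" by (rule monic_prod_list) auto
  then have "degree (char_poly H) = Suc (degree (\<Prod>e\<leftarrow>es. [:- e, 1:]))"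
    unfolding Cons.prems(3) list.map prod_list.Cons
    by (subst degree_mult_eq) (use mon in auto)
  then obtain r where n: "n = Suc r"
    using degree_monic_char_poly[OF H] by (cases n) auto
  have "eigenvalue H e"
    unfolding eigenvalue_root_char_poly[OF H] Cons.prems(3) by simp
  then obtain v where v: "v \<in> carrier_vec n" "v \<noteq> 0\<^sub>v n" and Hv: "H *\<^sub>v v = e \<cdot>\<^sub>v v"
    using H by (auto simp: eigenvalue_def eigenvector_def)
  obtain W c where W: "W \<in> carrier_mat n n" "mat_adjoint W * W = 1\<^sub>m n" "col W 0 = c \<cdot>\<^sub>v v"
    using unitary_completion[OF v] by blast
  have WW: "W * mat_adjoint W = 1\<^sub>m n" using unitary_right_inverse W by auto
  have Wa: "mat_adjoint W \<in> carrier_mat n n" using W by auto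
  define H' where "H' = mat_adjoint W * H * W"
  have H': "H' \<in> carrier_mat n n" unfolding H'_def using H W Wa by (intro mult_carrier_mat[of _ n n])
  have herm: "mat_adjoint H' = H'"
    unfolding H'_def using H W Wa Cons.prems(2)
    by (simp add: mat_adjoint_mult assoc_mult_mat[of _ n n _ n _ n])
  have n0: "0 < n" using n by simp
  have "H' = mat_adjoint W * (H * W)"
    unfolding H'_def using H W(1) by (simp add: mat_mult_assoc)
  then have "col H' 0 = mat_adjoint W *\<^sub>v (H *\<^sub>v col W 0)"
    by (simp only: col_mult2[OF Wa mult_carrier_mat[OF H W(1)] n0] col_mult2[OF H W(1) n0])
  also have "H *\<^sub>v col W 0 = e \<cdot>\<^sub>v col W 0"
    using W(3) Hv v H by (simp add: smult_smult_assoc mult.commute mult_mat_vec[of _ n n])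
  also have "mat_adjoint W *\<^sub>v (e \<cdot>\<^sub>v col W 0) = e \<cdot>\<^sub>v col (mat_adjoint W * W) 0"
    unfolding col_mult2[OF Wa W(1) n0] by (rule mat_mult_vec_smult) (use W(1) in simp)
  finally have col0: "col H' 0 = e \<cdot>\<^sub>v unit_vec n 0" using W(2) n by simp
  have i0: "H' $$ (i, 0) = (if i = 0 then e else 0)" if "i < n" for i
  proof -
    have "H' $$ (i, 0) = col H' 0 $ i" using H' that n by simp
    then show ?thesis using col0 that by simp
  qed
  have j0: "H' $$ (0, j) = (if j = 0 then e else 0)" if "j < n" for j
  proof (cases "j = 0")
    case True
    then show ?thesis using i0[of 0] n by simp
  next
    case False
    have "H' $$ (0, j) = cnj (H' $$ (j, 0))"
      using herm H' that n by (metis carrier_matD index_mat_adjoint zero_less_Suc)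
    then show ?thesis using i0[OF that] False by simp
  qed
  define H3 where "H3 = mat r r (\<lambda>(i, j). H' $$ (Suc i, Suc j))"
  have H3: "H3 \<in> carrier_mat r r" by (simp add: H3_def)
  have blk: "H' = four_block_mat (mat 1 1 (\<lambda>_. e)) (0\<^sub>m 1 r) (0\<^sub>m r 1) H3"
  proof (rule eq_matI)
    fix i j assume "i < dim_row (four_block_mat (mat 1 1 (\<lambda>_. e)) (0\<^sub>m 1 r) (0\<^sub>m r 1) H3)"
      "j < dim_col (four_block_mat (mat 1 1 (\<lambda>_. e)) (0\<^sub>m 1 r) (0\<^sub>m r 1) H3)"
    then show "H' $$ (i, j) = four_block_mat (mat 1 1 (\<lambda>_. e)) (0\<^sub>m 1 r) (0\<^sub>m r 1) H3 $$ (i, j)"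
      using i0[of i] j0[of j] n by (cases i; cases j) (auto simp: H3_def)
  qed (use H' n H3 in auto)
  have "W * H' * mat_adjoint W = (W * mat_adjoint W) * H * (W * mat_adjoint W)"
    unfolding H'_def using W(1) H by (simp add: mat_mult_assoc)
  then have "H = W * H' * mat_adjoint W" using WW H by simp
  then have "similar_mat_wit H H' W (mat_adjoint W)"
    using H H' W Wa WW by (intro similar_mat_witI[of _ _ n])
  then have "char_poly H = char_poly H'"
    by (intro char_poly_similar) (auto simp: similar_mat_def)
  also have "\<dots> = char_poly (mat 1 1 (\<lambda>_. e)) * char_poly H3"
    unfolding blk by (rule char_poly_four_block_zeros_col) (auto simp: H3_def)
  also have "char_poly (mat 1 1 (\<lambda>_. e)) = [:- e, 1:]"
    by (simp add: char_poly_defs det_def sign_def)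
  finally have "[:- e, 1:] * (\<Prod>a\<leftarrow>es. [:- a, 1:]) = [:- e, 1:] * char_poly H3"
    unfolding Cons.prems(3) list.map prod_list.Cons .
  moreover have "[:- e, 1:] \<noteq> 0" by simp
  ultimately have cp: "char_poly H3 = (\<Prod>a\<leftarrow>es. [:- a, 1:])"
    by (metis mult_left_cancel)
  have "mat_adjoint H3 = H3"
    by (rule eq_matI)
      (use herm H' n in \<open>auto simp: H3_def, metis Suc_mono carrier_matD index_mat_adjoint\<close>)
  from Cons.IH[OF H3 this cp] obtain Q where Q: "Q \<in> carrier_mat r r" "mat_adjoint Q * Q = 1\<^sub>m r"
    "mat_adjoint Q * H3 * Q = mat_diag r ((!) es)" by blast
  define P where "P = four_block_mat (1\<^sub>m 1) (0\<^sub>m 1 r) (0\<^sub>m r 1) Q"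
  have P: "P \<in> carrier_mat n n" using Q n by (auto intro!: carrier_matI simp: P_def)
  have Pa: "mat_adjoint P = four_block_mat (1\<^sub>m 1) (0\<^sub>m 1 r) (0\<^sub>m r 1) (mat_adjoint Q)"
    by (rule eq_matI) (use Q in \<open>auto simp: P_def\<close>)
  have Qa: "mat_adjoint Q \<in> carrier_mat r r" using Q by auto
  have PP: "mat_adjoint P * P = 1\<^sub>m n"
    unfolding Pa unfolding P_def using Q Qa n
    by (subst mult_four_block_mat[of _ 1 1 _ r _ r _ _ 1 _ r]) auto
  have "mat_adjoint P * H' * P = four_block_mat (mat 1 1 (\<lambda>_. e)) (0\<^sub>m 1 r) (0\<^sub>m r 1) (mat_adjoint Q * H3 * Q)"
    unfolding Pa blk unfolding P_def using Q Qa n H3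
    apply (subst mult_four_block_mat[of _ 1 1 _ r _ r _ _ 1 _ r], auto)
    apply (subst mult_four_block_mat[of _ 1 1 _ r _ r _ _ 1 _ r], auto)
    apply (simp add: left_add_zero_mat[OF mult_carrier_mat[OF Qa H3]]
        left_add_zero_mat[OF mult_carrier_mat[OF mult_carrier_mat[OF Qa H3] Q(1)]])
    done
  also have "\<dots> = mat_diag n (\<lambda>i. (e # es) ! i)"
    unfolding Q(3) using n
    by (intro eq_matI) (auto simp: mat_diag_def nth_Cons split: nat.splits)
  finally have D: "mat_adjoint P * H' * P = mat_diag n (\<lambda>i. (e # es) ! i)" .
  have Pac: "mat_adjoint P \<in> carrier_mat n n" using P by auto
  have "mat_adjoint (W * P) * (W * P) = mat_adjoint P * (mat_adjoint W * W) * P"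
    using W(1) P by (simp add: mat_adjoint_mult mat_mult_assoc)
  then have 1: "mat_adjoint (W * P) * (W * P) = 1\<^sub>m n" using W PP Pac P by simp
  have "mat_adjoint (W * P) * H * (W * P) = mat_adjoint P * H' * P"
    unfolding H'_def using W(1) P H by (simp add: mat_adjoint_mult mat_mult_assoc)
  then show ?case using 1 D W P by (intro bexI[of _ "W * P"]) auto
qed

lemma char_poly_gram:
  fixes B :: "complex mat"
  assumes B: "B \<in> carrier_mat p q"
  shows "char_poly (mat_adjoint B * B) = (\<Prod>s \<leftarrow> singular_value_list B. [:- of_real (s\<^sup>2), 1:])"
    and "length (singular_value_list B) = q"
    and "sorted (rev (singular_value_list B))"
    and "s \<in> set (singular_value_list B) \<Longrightarrow> 0 \<le> s"
proof -
  let ?H = "mat_adjoint B * B"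
  have H: "?H \<in> carrier_mat q q" using B by auto
  from char_poly_factorized[OF H] obtain as where as: "char_poly ?H = (\<Prod>a\<leftarrow>as. [:- a, 1:])"
    "length as = q" by blast
  have pr: "proots (char_poly ?H) = mset as"
  proof -
    have "proots (\<Prod>a\<leftarrow>as. [:- a, 1:]) = mset as" for as :: "complex list"
    proof (induction as)
      case (Cons a as)
      have "monic (\<Prod>a\<leftarrow>as. [:- a, 1:])" by (rule monic_prod_list) auto
      then have "proots ([:- a, 1:] * (\<Prod>a\<leftarrow>as. [:- a, 1:])) = {#a#} + mset as"
        using Cons by (subst proots_mult) auto
      then show ?case by simp
    qed simp
    then show ?thesis by (simp add: as)
  qed
  have real: "a = of_real ((sqrt (Re a))\<^sup>2) \<and> 0 \<le> Re a" if "a \<in> set as" for a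
  proof -
    have "poly (char_poly ?H) a = 0"
      unfolding as using that by (induction as) auto
    then obtain v where v: "v \<in> carrier_vec q" "v \<noteq> 0\<^sub>v q" "?H *\<^sub>v v = a \<cdot>\<^sub>v v"
      using carrier_matD[OF B] eigenvalue_root_char_poly[OF H] by (auto simp: eigenvalue_def eigenvector_def)
    have "of_real ((vnorm (B *\<^sub>v v))\<^sup>2) = v \<bullet>c (a \<cdot>\<^sub>v v)"
      using vnorm_mult_sq[OF B v(1)] v by simp
    also have "\<dots> = cnj a * of_real ((vnorm v)\<^sup>2)"
      using v by (simp add: conjugate_smult_vec cscalar_prod_self)
    finally have "cnj a = of_real ((vnorm (B *\<^sub>v v))\<^sup>2 / (vnorm v)\<^sup>2)"
      using vnorm_pos[OF v(1,2)] by (simp add: field_simps)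
    then have "a = of_real ((vnorm (B *\<^sub>v v))\<^sup>2 / (vnorm v)\<^sup>2)"
      by (metis complex_cnj_cnj complex_cnj_complex_of_real)
    then show ?thesis by auto
  qed
  let ?s = "singular_value_list B"
  have ms: "mset ?s = image_mset (\<lambda>z. sqrt (Re z)) (mset as)"
    by (simp add: singular_value_list_def pr)
  then show "length ?s = q" using as by (metis size_image_mset size_mset)
  show "sorted (rev ?s)" by (simp add: singular_value_list_def)
  show "0 \<le> s" if "s \<in> set ?s"
    using that real by (auto simp flip: set_mset_mset simp: ms)
  have "mset (map (\<lambda>s. of_real (s\<^sup>2)) ?s) = image_mset (\<lambda>a. of_real ((sqrt (Re a))\<^sup>2)) (mset as)"
    by (simp add: ms multiset.map_comp o_def)
  also have "\<dots> = image_mset (\<lambda>a. a) (mset as)"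
    by (rule image_mset_cong) (rule conjunct1[OF real, symmetric], simp)
  finally have m: "mset (map (\<lambda>s. of_real (s\<^sup>2)) ?s) = mset as" by simp
  have "(\<Prod>s\<leftarrow>?s. [:- of_real (s\<^sup>2), 1:]) = prod_mset (image_mset (\<lambda>a. [:- a, 1:]) (mset (map (\<lambda>s. of_real (s\<^sup>2)) ?s)))"
    by (simp add: prod_mset_prod_list[symmetric] multiset.map_comp o_def del: mset_map flip: mset_map)
  also have "\<dots> = char_poly ?H"
    unfolding m as by (simp flip: prod_mset_prod_list)
  finally show "char_poly ?H = (\<Prod>s\<leftarrow>?s. [:- of_real (s\<^sup>2), 1:])" by simp
qed

lemma gram_diagonalization:
  fixes B :: "complex mat"
  assumes B: "B \<in> carrier_mat p q"
  obtains Q where "Q \<in> carrier_mat q q" "mat_adjoint Q * Q = 1\<^sub>m q"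
    "mat_adjoint Q * (mat_adjoint B * B) * Q = mat_diag q (\<lambda>i. of_real ((singular_value_list B ! i)\<^sup>2))"
proof -
  let ?H = "mat_adjoint B * B"
  have H: "?H \<in> carrier_mat q q" "mat_adjoint ?H = ?H" using B by (auto simp: mat_adjoint_mult)
  have "char_poly ?H = (\<Prod>a \<leftarrow> map (\<lambda>s. of_real (s\<^sup>2)) (singular_value_list B). [:- a, 1:])"
    by (simp add: char_poly_gram[OF B] o_def)
  from hermitian_diagonalization[OF H this] obtain Q where Q: "Q \<in> carrier_mat q q"
    "mat_adjoint Q * Q = 1\<^sub>m q" "mat_adjoint Q * ?H * Q =
      mat_diag q (\<lambda>i. map (\<lambda>s. of_real (s\<^sup>2)) (singular_value_list B) ! i)" by blast
  have "mat_diag q (\<lambda>i. map (\<lambda>s. of_real (s\<^sup>2)) (singular_value_list B) ! i)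
      = (mat_diag q (\<lambda>i. of_real ((singular_value_list B ! i)\<^sup>2)) :: complex mat)"
    using char_poly_gram(2)[OF B] by (intro eq_matI) (auto simp: mat_diag_def)
  with Q that show ?thesis by simp
qed

lemma vnorm_gram_diagonalization:
  fixes B :: "complex mat"
  assumes "B \<in> carrier_mat p q" "Q \<in> carrier_mat q q"
    "mat_adjoint Q * (mat_adjoint B * B) * Q = mat_diag q (\<lambda>i. of_real ((s i)\<^sup>2))"
    and y: "y \<in> carrier_vec q"
  shows "(vnorm (B *\<^sub>v (Q *\<^sub>v y)))\<^sup>2 = (\<Sum>i<q. (s i)\<^sup>2 * (cmod (y $ i))\<^sup>2)"
proof -
  have Qa: "mat_adjoint Q \<in> carrier_mat q q" and Ba: "mat_adjoint B \<in> carrier_mat q p"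
    using assms by auto
  have "of_real ((vnorm ((B * Q) *\<^sub>v y))\<^sup>2) = y \<bullet>c (mat_adjoint (B * Q) * (B * Q) *\<^sub>v y)"
    using assms by (intro vnorm_mult_sq) auto
  also have "mat_adjoint (B * Q) * (B * Q) = mat_adjoint Q * (mat_adjoint B * B) * Q"
    using assms(1,2) by (simp add: mat_adjoint_mult mat_mult_assoc)
  also have "\<dots> = mat_diag q (\<lambda>i. of_real ((s i)\<^sup>2))" by fact
  also have "y \<bullet>c (mat_diag q (\<lambda>i. of_real ((s i)\<^sup>2)) *\<^sub>v y) = of_real (\<Sum>i<q. (s i)\<^sup>2 * (cmod (y $ i))\<^sup>2)"
  proof -
    have *: "(mat_diag q (\<lambda>i. of_real ((s i)\<^sup>2)) *\<^sub>v y) $ i = of_real ((s i)\<^sup>2) * y $ i" if "i < q" for i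
    proof -
      have "(mat_diag q (\<lambda>i. of_real ((s i)\<^sup>2)) *\<^sub>v y) $ i
          = (\<Sum>j<q. (if i = j then of_real ((s j)\<^sup>2) else 0) * y $ j)"
        using that y by (auto simp: mat_diag_def scalar_prod_def atLeast0LessThan intro!: sum.cong)
      also have "\<dots> = (\<Sum>j<q. if i = j then of_real ((s j)\<^sup>2) * y $ j else 0)"
        by (rule sum.cong) auto
      finally show ?thesis using that by simp
    qed
    show ?thesis
      using y * by (auto simp: scalar_prod_def atLeast0LessThan complex_norm_square mat_diag_def
          simp del: index_mult_mat_vec of_real_power intro!: sum.cong)
  qed
  finally have "(vnorm ((B * Q) *\<^sub>v y))\<^sup>2 = (\<Sum>i<q. (s i)\<^sup>2 * (cmod (y $ i))\<^sup>2)"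
    by (simp only: of_real_eq_iff)
  then show ?thesis using assms by (simp add: assoc_mult_mat_vec[of _ p q _ q])
qed

section \<open>Singular values\<close>

definition rdiag :: "nat \<Rightarrow> nat \<Rightarrow> (nat \<Rightarrow> real) \<Rightarrow> complex mat" where
  "rdiag p q f = mat p q (\<lambda>(i, j). if i = j then of_real (f i) else 0)"

lemma rdiag_carrier [simp]: "rdiag p q f \<in> carrier_mat p q"
  by (simp add: rdiag_def)

lemma rdiag_dim [simp]: "dim_row (rdiag p q f) = p" "dim_col (rdiag p q f) = q"
  by (simp_all add: rdiag_def)

lemma index_rdiag [simp]:
  "i < p \<Longrightarrow> j < q \<Longrightarrow> rdiag p q f $$ (i, j) = (if i = j then of_real (f i) else 0)"
  by (simp add: rdiag_def)

lemma rdiag_mult: "rdiag p q f * rdiag q r g = rdiag p r (\<lambda>i. if i < q then f i * g i else 0)"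
proof (rule eq_matI)
  fix i j assume "i < dim_row (rdiag p r (\<lambda>i. if i < q then f i * g i else 0))"
    "j < dim_col (rdiag p r (\<lambda>i. if i < q then f i * g i else 0))"
  then have ij: "i < p" "j < r" by auto
  have "(rdiag p q f * rdiag q r g) $$ (i, j) =
      (\<Sum>a<q. rdiag p q f $$ (i, a) * rdiag q r g $$ (a, j))"
    using ij by (auto simp: scalar_prod_def atLeast0LessThan intro!: sum.cong)
  also have "\<dots> = (\<Sum>a<q. if a = i then (if i = j then of_real (f i * g i) else 0) else 0)"
    using ij by (intro sum.cong) auto
  also have "\<dots> = rdiag p r (\<lambda>i. if i < q then f i * g i else 0) $$ (i, j)"
    using ij by simp
  finally show "(rdiag p q f * rdiag q r g) $$ (i, j)
      = rdiag p r (\<lambda>i. if i < q then f i * g i else 0) $$ (i, j)" .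
qed auto

lemma rdiag_mult_vec:
  assumes "x \<in> carrier_vec q" "i < p"
  shows "(rdiag p q f *\<^sub>v x) $ i = (if i < q then of_real (f i) * x $ i else 0)"
proof -
  have "(rdiag p q f *\<^sub>v x) $ i = (\<Sum>a<q. rdiag p q f $$ (i, a) * x $ a)"
    using assms by (auto simp: scalar_prod_def atLeast0LessThan intro!: sum.cong)
  also have "\<dots> = (\<Sum>a<q. if a = i then of_real (f i) * x $ i else 0)"
    using assms by (intro sum.cong) auto
  finally show ?thesis by simp
qed

lemma rdiag_adjoint [simp]: "mat_adjoint (rdiag p q f) = rdiag q p f"
  by (rule eq_matI) auto

lemma rdiag_one: "rdiag n n (\<lambda>_. 1) = 1\<^sub>m n"
  by (rule eq_matI) auto

lemma rdiag_cong: "(\<And>i. i < p \<Longrightarrow> i < q \<Longrightarrow> f i = g i) \<Longrightarrow> rdiag p q f = rdiag p q g"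
  by (rule eq_matI) auto

lemma vnorm_rdiag_mult:
  assumes "x \<in> carrier_vec q"
  shows "(vnorm (rdiag p q f *\<^sub>v x))\<^sup>2 = (\<Sum>i<min p q. (f i)\<^sup>2 * (cmod (x $ i))\<^sup>2)"
proof -
  have "(vnorm (rdiag p q f *\<^sub>v x))\<^sup>2 = (\<Sum>i<p. if i < q then (f i)\<^sup>2 * (cmod (x $ i))\<^sup>2 else 0)"
    using assms by (auto simp: vnorm_sq rdiag_mult_vec norm_mult power_mult_distrib
        simp del: index_mult_mat_vec intro!: sum.cong)
  also have "\<dots> = (\<Sum>i<min p q. (f i)\<^sup>2 * (cmod (x $ i))\<^sup>2)"
    by (rule sum.mono_neutral_cong_right) auto
  finally show ?thesis .
qed

lemma op_bounded_rdiag: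
  assumes "0 \<le> c" "\<And>i. i < p \<Longrightarrow> i < q \<Longrightarrow> \<bar>f i\<bar> \<le> c"
  shows "op_bounded (rdiag p q f) c"
proof (rule op_boundedI[OF rdiag_carrier])
  fix x :: "complex vec" assume x: "x \<in> carrier_vec q"
  have "(vnorm (rdiag p q f *\<^sub>v x))\<^sup>2 \<le> (\<Sum>i<min p q. c\<^sup>2 * (cmod (x $ i))\<^sup>2)"
    unfolding vnorm_rdiag_mult[OF x]
    using assms by (intro sum_mono mult_right_mono) (auto simp: abs_le_square_iff[symmetric])
  also have "\<dots> \<le> (\<Sum>i<q. c\<^sup>2 * (cmod (x $ i))\<^sup>2)"
    by (rule sum_mono2) auto
  also have "\<dots> = (c * vnorm x)\<^sup>2"
    using x by (simp add: power_mult_distrib vnorm_sq sum_distrib_left)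
  finally show "vnorm (rdiag p q f *\<^sub>v x) \<le> c * vnorm x"
    by (rule power2_le_imp_le) (use assms(1) in auto)
qed

abbreviation sv :: "complex mat \<Rightarrow> nat \<Rightarrow> real" where
  "sv B i \<equiv> singular_value B (Suc i)"

lemma singular_value_list_antimono:
  assumes "B \<in> carrier_mat p q" "i \<le> j" "j < q"
  shows "singular_value_list B ! j \<le> singular_value_list B ! i"
  using sorted_rev_nth_mono[of "singular_value_list B" i j] char_poly_gram(2,3)[OF assms(1)] assms
  by simp

lemma singular_value_list_nonneg:
  assumes "B \<in> carrier_mat p q" "i < q"
  shows "0 \<le> singular_value_list B ! i"
  using char_poly_gram(2,4)[OF assms(1)] assms by simp

lemma singular_value_list_le:
  assumes B: "B \<in> carrier_mat p q" and i: "i < q" and F: "F \<in> carrier_mat i q" and c: "0 \<le> c"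
    and le: "\<And>x. x \<in> carrier_vec q \<Longrightarrow> F *\<^sub>v x = 0\<^sub>v i \<Longrightarrow> vnorm (B *\<^sub>v x) \<le> c * vnorm x"
  shows "singular_value_list B ! i \<le> c"
proof -
  let ?s = "\<lambda>i. singular_value_list B ! i"
  obtain Q where Q: "Q \<in> carrier_mat q q" "mat_adjoint Q * Q = 1\<^sub>m q"
    "mat_adjoint Q * (mat_adjoint B * B) * Q = mat_diag q (\<lambda>i. of_real ((?s i)\<^sup>2))"
    using gram_diagonalization[OF B] by blast
  define G where "G = rdiag q (Suc i) (\<lambda>_. 1)"
  have G: "G \<in> carrier_mat q (Suc i)" "mat_adjoint G * G = 1\<^sub>m (Suc i)"
    using i by (auto simp: G_def rdiag_mult rdiag_one[symmetric] intro!: rdiag_cong)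
  have "F * Q * G \<in> carrier_mat i (Suc i)" using F Q G by auto
  then obtain z where z: "z \<in> carrier_vec (Suc i)" "z \<noteq> 0\<^sub>v (Suc i)" "F * Q * G *\<^sub>v z = 0\<^sub>v i"
    using nontrivial_kernel by blast
  define y where "y = G *\<^sub>v z"
  have y: "y \<in> carrier_vec q" using G z by (auto simp: y_def)
  have y0: "y $ a = 0" if "i < a" "a < q" for a
    using that z by (simp add: y_def G_def rdiag_mult_vec del: index_mult_mat_vec)
  have ny: "vnorm y = vnorm z" using isometry_vnorm G z by (simp add: y_def)
  have nQ: "vnorm (Q *\<^sub>v y) = vnorm y" using isometry_vnorm Q y by simp
  have "F *\<^sub>v (Q *\<^sub>v y) = 0\<^sub>v i"
    using z F Q G by (simp add: y_def mat_mult_assoc mat_mult_vec_assoc)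
  then have b: "vnorm (B *\<^sub>v (Q *\<^sub>v y)) \<le> c * vnorm y"
    using le[of "Q *\<^sub>v y"] Q y nQ by auto
  have "(?s i * vnorm y)\<^sup>2 = (\<Sum>a<q. (?s i)\<^sup>2 * (cmod (y $ a))\<^sup>2)"
    using y by (simp add: power_mult_distrib vnorm_sq sum_distrib_left)
  also have "\<dots> \<le> (\<Sum>a<q. (?s a)\<^sup>2 * (cmod (y $ a))\<^sup>2)"
  proof (rule sum_mono)
    fix a assume a: "a \<in> {..<q}"
    show "(?s i)\<^sup>2 * (cmod (y $ a))\<^sup>2 \<le> (?s a)\<^sup>2 * (cmod (y $ a))\<^sup>2"
    proof (cases "i < a")
      case False
      then show ?thesis
        using i singular_value_list_antimono[OF B, of a i] singular_value_list_nonneg[OF B i]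
        by (intro mult_right_mono power_mono) auto
    qed (use y0 a in auto)
  qed
  also have "\<dots> = (vnorm (B *\<^sub>v (Q *\<^sub>v y)))\<^sup>2"
    using vnorm_gram_diagonalization[OF B Q(1,3) y] by simp
  also have "\<dots> \<le> (c * vnorm y)\<^sup>2" using b by (intro power_mono) auto
  finally have "?s i * vnorm y \<le> c * vnorm y"
    by (rule power2_le_imp_le) (use c in auto)
  then show ?thesis using vnorm_pos[OF z(1,2)] ny by simp
qed

lemma singular_value_list_attained:
  assumes B: "B \<in> carrier_mat p q" and i: "i < q"
  obtains F where "F \<in> carrier_mat i q" "F * mat_adjoint F = 1\<^sub>m i"
    "\<And>x. x \<in> carrier_vec q \<Longrightarrow> F *\<^sub>v x = 0\<^sub>v i \<Longrightarrow>
      vnorm (B *\<^sub>v x) \<le> singular_value_list B ! i * vnorm x"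
proof -
  let ?s = "\<lambda>i. singular_value_list B ! i"
  obtain Q where Q: "Q \<in> carrier_mat q q" "mat_adjoint Q * Q = 1\<^sub>m q"
    "mat_adjoint Q * (mat_adjoint B * B) * Q = mat_diag q (\<lambda>i. of_real ((?s i)\<^sup>2))"
    using gram_diagonalization[OF B] by blast
  have QQ: "Q * mat_adjoint Q = 1\<^sub>m q" using unitary_right_inverse Q by blast
  define F where "F = rdiag i q (\<lambda>_. 1) * mat_adjoint Q"
  have F: "F \<in> carrier_mat i q" using Q by (auto simp: F_def intro!: mult_carrier_mat[of _ i q])
  have "F * mat_adjoint F = rdiag i q (\<lambda>_. 1) * (mat_adjoint Q * Q) * rdiag q i (\<lambda>_. 1)"
    unfolding F_def using Q(1) by (simp add: mat_adjoint_mult mat_mult_assoc)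
  also have "\<dots> = 1\<^sub>m i"
    unfolding Q(2) right_mult_one_mat[OF rdiag_carrier] rdiag_mult rdiag_one[symmetric]
    using i by (intro rdiag_cong) simp
  finally have FF: "F * mat_adjoint F = 1\<^sub>m i" .
  have "vnorm (B *\<^sub>v x) \<le> ?s i * vnorm x" if x: "x \<in> carrier_vec q" "F *\<^sub>v x = 0\<^sub>v i" for x
  proof -
    define y where "y = mat_adjoint Q *\<^sub>v x"
    have y: "y \<in> carrier_vec q" using x Q by (auto simp: y_def intro!: mult_mat_vec_carrier[of _ q q])
    have xy: "Q *\<^sub>v y = x"
      using x Q QQ by (simp add: y_def mat_mult_vec_assoc[symmetric])
    have "rdiag i q (\<lambda>_. 1) *\<^sub>v y = 0\<^sub>v i"
      using x Q by (simp add: y_def F_def mat_mult_vec_assoc)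
    then have y0: "y $ a = 0" if "a < i" for a
      using rdiag_mult_vec[OF y that, of "\<lambda>_. 1"] that i by simp
    have "(vnorm (B *\<^sub>v x))\<^sup>2 = (\<Sum>a<q. (?s a)\<^sup>2 * (cmod (y $ a))\<^sup>2)"
      using vnorm_gram_diagonalization[OF B Q(1,3) y] xy by simp
    also have "\<dots> \<le> (\<Sum>a<q. (?s i)\<^sup>2 * (cmod (y $ a))\<^sup>2)"
    proof (rule sum_mono)
      fix a assume a: "a \<in> {..<q}"
      show "(?s a)\<^sup>2 * (cmod (y $ a))\<^sup>2 \<le> (?s i)\<^sup>2 * (cmod (y $ a))\<^sup>2"
      proof (cases "a < i")
        case False
        then show ?thesis
          using a singular_value_list_antimono[OF B, of i a] singular_value_list_nonneg[OF B, of a]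
          by (intro mult_right_mono power_mono) auto
      qed (use y0 in auto)
    qed
    also have "\<dots> = (?s i * vnorm y)\<^sup>2"
      using y by (simp add: power_mult_distrib vnorm_sq sum_distrib_left)
    finally have "vnorm (B *\<^sub>v x) \<le> ?s i * vnorm y"
      by (rule power2_le_imp_le) (use singular_value_list_nonneg[OF B i] in auto)
    then show ?thesis using isometry_vnorm[OF Q(1,2) y] xy by simp
  qed
  with F FF that show ?thesis by blast
qed

text \<open>For \<open>i \<ge> p\<close> the right-hand side is 0 by definition, so this includes that the list ends in
  zeros.\<close>

lemma singular_value_list_nth:
  assumes B: "B \<in> carrier_mat p q" and i: "i < q"
  shows "singular_value_list B ! i = sv B i"
proof (cases "i < p")
  case True
  then show ?thesis using B i by (simp add: singular_value_def)
next
  case False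
  define F where "F = mat i q (\<lambda>(a, b). if a < p then B $$ (a, b) else 0)"
  have F: "F \<in> carrier_mat i q" by (simp add: F_def)
  have "singular_value_list B ! i \<le> 0"
  proof (rule singular_value_list_le[OF B i F])
    fix x :: "complex vec" assume x: "x \<in> carrier_vec q" "F *\<^sub>v x = 0\<^sub>v i"
    have "B *\<^sub>v x = 0\<^sub>v p"
    proof (rule eq_vecI)
      fix a assume "a < dim_vec (0\<^sub>v p :: complex vec)"
      then have a: "a < p" by simp
      have "row B a = row F a" using a False B by (intro eq_vecI) (auto simp: F_def)
      then have "(B *\<^sub>v x) $ a = (F *\<^sub>v x) $ a" using a B F False by auto
      then show "(B *\<^sub>v x) $ a = 0\<^sub>v p $ a" using a False x by simp
    qed (use B in auto)
    then show "vnorm (B *\<^sub>v x) \<le> 0 * vnorm x" by simp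
  qed simp
  then show ?thesis
    using singular_value_list_nonneg[OF B i] False B by (simp add: singular_value_def)
qed

lemma sv_nonneg [simp]: "0 \<le> sv B i"
  using singular_value_list_nonneg[of B "dim_row B" "dim_col B" i]
  by (auto simp: singular_value_def)

lemma sv_eq_0: "min (dim_row B) (dim_col B) \<le> i \<Longrightarrow> sv B i = 0"
  by (auto simp: singular_value_def)

lemma sv_antimono: "i \<le> j \<Longrightarrow> sv B j \<le> sv B i"
  using singular_value_list_antimono[of B "dim_row B" "dim_col B" i j]
    singular_value_list_nonneg[of B "dim_row B" "dim_col B" i]
  by (auto simp: singular_value_def)

text \<open>The next three lemmas are the Courant--Fischer characterization, with subspaces of
  codimension at most \<open>i\<close> given as kernels of matrices with \<open>i\<close> rows.\<close>

lemma sv_le: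
  assumes B: "B \<in> carrier_mat p q" and F: "F \<in> carrier_mat i q" and c: "0 \<le> c"
    and le: "\<And>x. x \<in> carrier_vec q \<Longrightarrow> F *\<^sub>v x = 0\<^sub>v i \<Longrightarrow> vnorm (B *\<^sub>v x) \<le> c * vnorm x"
  shows "sv B i \<le> c"
proof (cases "i < q")
  case True
  then show ?thesis
    using singular_value_list_le[OF B True F c le] singular_value_list_nth[OF B True] by simp
next
  case False
  then show ?thesis using c B by (simp add: singular_value_def)
qed

lemma sv_attained:
  assumes B: "B \<in> carrier_mat p q"
  obtains F where "F \<in> carrier_mat i q" "\<And>x. x \<in> carrier_vec q \<Longrightarrow> F *\<^sub>v x = 0\<^sub>v i \<Longrightarrow>
    vnorm (B *\<^sub>v x) \<le> sv B i * vnorm x"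
proof (cases "i < q")
  case True
  then show ?thesis
    using that singular_value_list_attained[OF B True] singular_value_list_nth[OF B True] by metis
next
  case False
  have "vnorm (B *\<^sub>v x) \<le> sv B i * vnorm x"
    if x: "x \<in> carrier_vec q" "rdiag i q (\<lambda>_. 1) *\<^sub>v x = 0\<^sub>v i" for x
  proof -
    have "x $ a = 0" if "a < q" for a
      using rdiag_mult_vec[OF x(1), of a i "\<lambda>_. 1"] x(2) that False by simp
    then have "x = 0\<^sub>v q" using x by (intro eq_vecI) auto
    moreover have "B *\<^sub>v 0\<^sub>v q = 0\<^sub>v p" using B by (intro eq_vecI) auto
    ultimately show ?thesis by simp
  qed
  then show ?thesis using that rdiag_carrier by blast
qed

lemma sv_ge:
  assumes B: "B \<in> carrier_mat p q" and G: "G \<in> carrier_mat q (Suc i)"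
    and inj: "\<And>y. y \<in> carrier_vec (Suc i) \<Longrightarrow> y \<noteq> 0\<^sub>v (Suc i) \<Longrightarrow> G *\<^sub>v y \<noteq> 0\<^sub>v q"
    and ge: "\<And>y. y \<in> carrier_vec (Suc i) \<Longrightarrow> c * vnorm (G *\<^sub>v y) \<le> vnorm (B *\<^sub>v (G *\<^sub>v y))"
  shows "c \<le> sv B i"
proof -
  obtain F where F: "F \<in> carrier_mat i q" "\<And>x. x \<in> carrier_vec q \<Longrightarrow> F *\<^sub>v x = 0\<^sub>v i \<Longrightarrow>
    vnorm (B *\<^sub>v x) \<le> sv B i * vnorm x" using sv_attained[OF B] by blast
  have "F * G \<in> carrier_mat i (Suc i)" using F G by auto
  then obtain y where y: "y \<in> carrier_vec (Suc i)" "y \<noteq> 0\<^sub>v (Suc i)" "F * G *\<^sub>v y = 0\<^sub>v i"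
    using nontrivial_kernel by blast
  have x: "G *\<^sub>v y \<in> carrier_vec q" using G y by auto
  have "F *\<^sub>v (G *\<^sub>v y) = 0\<^sub>v i" using y F G by (simp add: mat_mult_vec_assoc)
  then have "c * vnorm (G *\<^sub>v y) \<le> sv B i * vnorm (G *\<^sub>v y)"
    using F(2)[OF x] ge[OF y(1)] by linarith
  then show ?thesis using vnorm_pos[OF x inj[OF y(1,2)]] by simp
qed

lemma op_bounded_sv: "op_bounded B (sv B 0)"
proof -
  obtain F where F: "F \<in> carrier_mat 0 (dim_col B)" "\<And>x. x \<in> carrier_vec (dim_col B) \<Longrightarrow>
    F *\<^sub>v x = 0\<^sub>v 0 \<Longrightarrow> vnorm (B *\<^sub>v x) \<le> sv B 0 * vnorm x"
    using sv_attained[of B "dim_row B" "dim_col B" 0] by blast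
  then show ?thesis by (auto simp: op_bounded_def intro!: F(2) eq_vecI)
qed

lemma sv_mult_left:
  assumes "op_bounded X c" "0 \<le> c" "dim_col X = dim_row Y"
  shows "sv (X * Y) i \<le> c * sv Y i"
proof -
  let ?q = "dim_col Y"
  obtain F where F: "F \<in> carrier_mat i ?q" "\<And>x. x \<in> carrier_vec ?q \<Longrightarrow>
    F *\<^sub>v x = 0\<^sub>v i \<Longrightarrow> vnorm (Y *\<^sub>v x) \<le> sv Y i * vnorm x"
    using sv_attained[of Y "dim_row Y" ?q i] by blast
  show ?thesis
  proof (rule sv_le[of _ "dim_row X" ?q, OF _ F(1)])
    fix x assume x: "x \<in> carrier_vec ?q" "F *\<^sub>v x = 0\<^sub>v i"
    have "vnorm (X * Y *\<^sub>v x) = vnorm (X *\<^sub>v (Y *\<^sub>v x))"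
      using x assms by (simp add: mat_mult_vec_assoc)
    also have "\<dots> \<le> c * vnorm (Y *\<^sub>v x)"
      using assms x by (intro op_boundedD[of _ _ "dim_row X" "dim_row Y"] carrier_matI carrier_vecI) auto
    also have "\<dots> \<le> c * (sv Y i * vnorm x)" using F(2)[OF x] assms by (intro mult_left_mono) auto
    finally show "vnorm (X * Y *\<^sub>v x) \<le> c * sv Y i * vnorm x" by simp
  qed (use assms in auto)
qed

lemma sv_mult_right:
  assumes "op_bounded Y c" "0 \<le> c" "dim_col X = dim_row Y"
  shows "sv (X * Y) i \<le> c * sv X i"
proof -
  let ?p = "dim_col X"
  obtain F where F: "F \<in> carrier_mat i ?p" "\<And>x. x \<in> carrier_vec ?p \<Longrightarrow>
    F *\<^sub>v x = 0\<^sub>v i \<Longrightarrow> vnorm (X *\<^sub>v x) \<le> sv X i * vnorm x"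
    using sv_attained[of X "dim_row X" ?p i] by blast
  show ?thesis
  proof (rule sv_le[of _ "dim_row X" "dim_col Y" "F * Y"])
    show "F * Y \<in> carrier_mat i (dim_col Y)" using F by (intro carrier_matI) auto
    fix x assume x: "x \<in> carrier_vec (dim_col Y)" "F * Y *\<^sub>v x = 0\<^sub>v i"
    have "vnorm (X * Y *\<^sub>v x) = vnorm (X *\<^sub>v (Y *\<^sub>v x))"
      using x assms by (simp add: mat_mult_vec_assoc)
    also have "\<dots> \<le> sv X i * vnorm (Y *\<^sub>v x)"
      using x F assms by (intro F(2)) (auto simp: mat_mult_vec_assoc[symmetric] intro: carrier_vecI)
    also have "\<dots> \<le> sv X i * (c * vnorm x)"
      using assms x by (intro mult_left_mono op_boundedD[of _ _ "dim_row Y" "dim_col Y"]) auto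
    finally show "vnorm (X * Y *\<^sub>v x) \<le> c * sv X i * vnorm x" by (simp add: ac_simps)
  qed (use assms in auto)
qed

lemma sv_add:
  assumes A: "A \<in> carrier_mat p q" and B: "B \<in> carrier_mat p q"
  shows "sv (A + B) (i + j) \<le> sv A i + sv B j"
proof -
  obtain F where F: "F \<in> carrier_mat i q" "\<And>x. x \<in> carrier_vec q \<Longrightarrow>
    F *\<^sub>v x = 0\<^sub>v i \<Longrightarrow> vnorm (A *\<^sub>v x) \<le> sv A i * vnorm x"
    using sv_attained[OF A] by blast
  obtain G where G: "G \<in> carrier_mat j q" "\<And>x. x \<in> carrier_vec q \<Longrightarrow>
    G *\<^sub>v x = 0\<^sub>v j \<Longrightarrow> vnorm (B *\<^sub>v x) \<le> sv B j * vnorm x"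
    using sv_attained[OF B] by blast
  show ?thesis
  proof (rule sv_le[of _ p q "F @\<^sub>r G"])
    show "F @\<^sub>r G \<in> carrier_mat (i + j) q" using F G by auto
    fix x :: "complex vec" assume x: "x \<in> carrier_vec q" "(F @\<^sub>r G) *\<^sub>v x = 0\<^sub>v (i + j)"
    have e: "((F @\<^sub>r G) *\<^sub>v x) = (F *\<^sub>v x) @\<^sub>v (G *\<^sub>v x)"
      using F G x by (intro mat_mult_append) auto
    have "F *\<^sub>v x = 0\<^sub>v i"
    proof (rule eq_vecI)
      fix a assume a: "a < dim_vec (0\<^sub>v i)"
      then have "((F *\<^sub>v x) @\<^sub>v (G *\<^sub>v x)) $ a = 0" using e x by (metis add.commute index_zero_vec trans_less_add2)
      then show "(F *\<^sub>v x) $ a = 0\<^sub>v i $ a" using a F by (simp add: append_vec_def Let_def)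
    qed (use F in auto)
    moreover have "G *\<^sub>v x = 0\<^sub>v j"
    proof (rule eq_vecI)
      fix a assume a: "a < dim_vec (0\<^sub>v j)"
      then have "((F *\<^sub>v x) @\<^sub>v (G *\<^sub>v x)) $ (i + a) = 0"
        unfolding e[symmetric] x(2) by simp
      then show "(G *\<^sub>v x) $ a = 0\<^sub>v j $ a" using a F G by (simp add: append_vec_def Let_def)
    qed (use G in auto)
    ultimately have "vnorm (A *\<^sub>v x) + vnorm (B *\<^sub>v x) \<le> sv A i * vnorm x + sv B j * vnorm x"
      using F(2)[OF x(1)] G(2)[OF x(1)] by linarith
    moreover have "vnorm ((A + B) *\<^sub>v x) \<le> vnorm (A *\<^sub>v x) + vnorm (B *\<^sub>v x)"
      using A B x by (subst add_mult_distrib_mat_vec[of _ p q]) (auto intro!: vnorm_triangle[of _ p])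
    ultimately show "vnorm ((A + B) *\<^sub>v x) \<le> (sv A i + sv B j) * vnorm x"
      by (simp add: distrib_right)
  qed (use A B in auto)
qed

lemma sv_rdiag:
  assumes f: "\<And>i. i < min p q \<Longrightarrow> 0 \<le> f i" "\<And>i j. i \<le> j \<Longrightarrow> j < min p q \<Longrightarrow> f j \<le> f i"
  shows "sv (rdiag p q f) i = (if i < min p q then f i else 0)"
proof (cases "i < min p q")
  case True
  have "sv (rdiag p q f) i \<le> f i"
  proof (rule sv_le[OF rdiag_carrier rdiag_carrier[of i q "\<lambda>_. 1"]])
    fix x :: "complex vec" assume x: "x \<in> carrier_vec q" "rdiag i q (\<lambda>_. 1) *\<^sub>v x = 0\<^sub>v i"
    have x0: "x $ a = 0" if "a < i" for a
      using rdiag_mult_vec[OF x(1) that, of "\<lambda>_. 1"] x(2) that True by simp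
    have "(vnorm (rdiag p q f *\<^sub>v x))\<^sup>2 \<le> (\<Sum>a<min p q. (f i)\<^sup>2 * (cmod (x $ a))\<^sup>2)"
      unfolding vnorm_rdiag_mult[OF x(1)]
    proof (rule sum_mono)
      fix a assume a: "a \<in> {..<min p q}"
      show "(f a)\<^sup>2 * (cmod (x $ a))\<^sup>2 \<le> (f i)\<^sup>2 * (cmod (x $ a))\<^sup>2"
      proof (cases "a < i")
        case False
        then show ?thesis
          using a f by (intro mult_right_mono power_mono) auto
      qed (use x0 in auto)
    qed
    also have "\<dots> \<le> (\<Sum>a<q. (f i)\<^sup>2 * (cmod (x $ a))\<^sup>2)" by (rule sum_mono2) auto
    also have "\<dots> = (f i * vnorm x)\<^sup>2"
      using x by (simp add: power_mult_distrib vnorm_sq sum_distrib_left)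
    finally show "vnorm (rdiag p q f *\<^sub>v x) \<le> f i * vnorm x"
      by (rule power2_le_imp_le) (use f(1)[OF True] in auto)
  qed (use f True in auto)
  moreover have "f i \<le> sv (rdiag p q f) i"
  proof (rule sv_ge[OF rdiag_carrier rdiag_carrier[of q "Suc i" "\<lambda>_. 1"]])
    fix y :: "complex vec" assume y: "y \<in> carrier_vec (Suc i)"
    let ?x = "rdiag q (Suc i) (\<lambda>_. 1) *\<^sub>v y"
    have x: "?x \<in> carrier_vec q" by (intro carrier_vecI) simp
    have xa: "?x $ a = (if a < Suc i then y $ a else 0)" if "a < q" for a
      using rdiag_mult_vec[OF y that, of "\<lambda>_. 1"] by simp
    show "?x \<noteq> 0\<^sub>v q" if "y \<noteq> 0\<^sub>v (Suc i)"
    proof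
      assume 0: "?x = 0\<^sub>v q"
      have "y $ a = 0" if "a < Suc i" for a
        using xa[of a] 0 that True by simp
      then have "y = 0\<^sub>v (Suc i)" using y by (intro eq_vecI) auto
      with that show False by simp
    qed
    have "(f i * vnorm ?x)\<^sup>2 = (\<Sum>a<q. (f i)\<^sup>2 * (cmod (?x $ a))\<^sup>2)"
      by (simp add: power_mult_distrib vnorm_sq sum_distrib_left del: index_mult_mat_vec)
    also have "\<dots> = (\<Sum>a<min p q. (f i)\<^sup>2 * (cmod (?x $ a))\<^sup>2)"
      using True xa by (intro sum.mono_neutral_right) (auto simp del: index_mult_mat_vec)
    also have "\<dots> \<le> (\<Sum>a<min p q. (f a)\<^sup>2 * (cmod (?x $ a))\<^sup>2)"
    proof (rule sum_mono)
      fix a assume a: "a \<in> {..<min p q}"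
      show "(f i)\<^sup>2 * (cmod (?x $ a))\<^sup>2 \<le> (f a)\<^sup>2 * (cmod (?x $ a))\<^sup>2"
      proof (cases "a < Suc i")
        case True
        then show ?thesis
          using f \<open>i < min p q\<close> by (intro mult_right_mono power_mono) auto
      qed (use xa a in \<open>auto simp del: index_mult_mat_vec\<close>)
    qed
    also have "\<dots> = (vnorm (rdiag p q f *\<^sub>v ?x))\<^sup>2"
      using vnorm_rdiag_mult[OF x] by simp
    finally show "f i * vnorm ?x \<le> vnorm (rdiag p q f *\<^sub>v ?x)"
      by (rule power2_le_imp_le) simp
  qed
  ultimately show ?thesis using True by simp
next
  case False
  then have "min (dim_row (rdiag p q f)) (dim_col (rdiag p q f)) \<le> i" by auto
  from sv_eq_0[OF this] False show ?thesis by auto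
qed

lemma sv_adjoint_le: "sv (mat_adjoint B) i \<le> sv B i"
proof (cases "i < dim_col B")
  case False
  then have "sv (mat_adjoint B) i = 0" by (intro sv_eq_0) auto
  then show ?thesis by simp
next
  case True
  define p q where "p = dim_row B" and "q = dim_col B"
  have B: "B \<in> carrier_mat p q" and i: "i < q" using True by (simp_all add: p_def q_def)
  obtain F where F: "F \<in> carrier_mat i q" "F * mat_adjoint F = 1\<^sub>m i"
    "\<And>x. x \<in> carrier_vec q \<Longrightarrow> F *\<^sub>v x = 0\<^sub>v i \<Longrightarrow> vnorm (B *\<^sub>v x) \<le> sv B i * vnorm x"
    using singular_value_list_attained[OF B i] singular_value_list_nth[OF B i] by metis
  define P where "P = 1\<^sub>m q - mat_adjoint F * F"
  have P: "P \<in> carrier_mat q q" unfolding P_def using F(1) by (intro carrier_matI) auto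
  note d = carrier_matD[OF F(1)] carrier_matD[OF B] carrier_matD[OF P]
  have "F * P = F - (F * mat_adjoint F) * F"
    unfolding P_def using F(1) by (simp add: mat_mult_distribs mat_mult_assoc)
  then have FP: "F * P = 0\<^sub>m i q" unfolding F(2) using F(1) by simp
  have Pa: "mat_adjoint P = P"
    unfolding P_def using F(1)
    by (subst mat_adjoint_minus[of _ q q]) (auto simp: mat_adjoint_mult)
  have "P * P = P - mat_adjoint F * (F * P)"
    using d by (subst (1) P_def) (simp add: mat_mult_distribs mat_mult_assoc)
  also have "\<dots> = P" unfolding FP using F(1) P by (intro eq_matI) auto
  finally have PP: "P * P = P" .
  have bP: "op_bounded P 1"
  proof (rule op_boundedI[OF P])
    fix x :: "complex vec" assume x: "x \<in> carrier_vec q"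
    have Px: "P *\<^sub>v x \<in> carrier_vec q" using P x by auto
    have "(vnorm (P *\<^sub>v x))\<^sup>2 = cmod (x \<bullet>c (P *\<^sub>v x))"
      using arg_cong[OF vnorm_mult_sq[OF P x], of cmod] unfolding Pa PP by (simp add: norm_power)
    also have "\<dots> \<le> vnorm x * vnorm (P *\<^sub>v x)" by (rule cscalar_prod_le[OF x Px])
    finally have "vnorm (P *\<^sub>v x) * vnorm (P *\<^sub>v x) \<le> vnorm x * vnorm (P *\<^sub>v x)"
      by (simp add: power2_eq_square)
    then show "vnorm (P *\<^sub>v x) \<le> 1 * vnorm x"
      by (metis mult_1 mult_le_cancel_right order_le_less vnorm_nonneg)
  qed
  have BP: "B * P \<in> carrier_mat p q" using B P by auto
  have "op_bounded (B * P) (sv B i)"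
  proof (rule op_boundedI[OF BP])
    fix x :: "complex vec" assume x: "x \<in> carrier_vec q"
    have Px: "P *\<^sub>v x \<in> carrier_vec q" using P x by auto
    have "F *\<^sub>v (P *\<^sub>v x) = (F * P) *\<^sub>v x" using F(1) P x by (simp add: mat_mult_vec_assoc)
    also have "\<dots> = 0\<^sub>v i" unfolding FP using x by (intro eq_vecI) auto
    finally have "vnorm (B *\<^sub>v (P *\<^sub>v x)) \<le> sv B i * vnorm (P *\<^sub>v x)" using F(3)[OF Px] by simp
    also have "\<dots> \<le> sv B i * vnorm x"
      using op_boundedD[OF bP P x] by (intro mult_left_mono) auto
    finally show "vnorm (B * P *\<^sub>v x) \<le> sv B i * vnorm x"
      using B P x by (simp add: mat_mult_vec_assoc)
  qed
  then have bound: "op_bounded (mat_adjoint (B * P)) (sv B i)"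
    using BP by (rule op_bounded_adjoint) simp
  have Ba: "mat_adjoint B \<in> carrier_mat q p" and Fa: "mat_adjoint F \<in> carrier_mat q i"
    using B F(1) by auto
  have "mat_adjoint (B * P) = mat_adjoint B - mat_adjoint F * (F * mat_adjoint B)"
    using d by (simp add: mat_adjoint_mult Pa) (simp add: P_def mat_mult_distribs mat_mult_assoc)
  then have split: "mat_adjoint B = mat_adjoint (B * P) + mat_adjoint F * (F * mat_adjoint B)"
    using d by (auto intro!: eq_matI simp del: index_mult_mat(1))
  show ?thesis
  proof (rule sv_le[OF Ba])
    show FB: "F * mat_adjoint B \<in> carrier_mat i p" using F(1) Ba by auto
    fix y :: "complex vec" assume y: "y \<in> carrier_vec p" "F * mat_adjoint B *\<^sub>v y = 0\<^sub>v i"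
    have "mat_adjoint B *\<^sub>v y = mat_adjoint (B * P) *\<^sub>v y + (mat_adjoint F * (F * mat_adjoint B)) *\<^sub>v y"
      by (subst split, rule add_mult_distrib_mat_vec[OF mat_adjoint_carrier[OF BP]
            mult_carrier_mat[OF Fa FB] y(1)])
    also have "(mat_adjoint F * (F * mat_adjoint B)) *\<^sub>v y = mat_adjoint F *\<^sub>v 0\<^sub>v i"
      using y d by (subst mat_mult_vec_assoc) auto
    also have "\<dots> = 0\<^sub>v q" using Fa by (intro eq_vecI) (auto simp: scalar_prod_def)
    finally have "mat_adjoint B *\<^sub>v y = mat_adjoint (B * P) *\<^sub>v y"
      using mult_mat_vec_carrier[OF mat_adjoint_carrier[OF BP] y(1)] by simp
    then show "vnorm (mat_adjoint B *\<^sub>v y) \<le> sv B i * vnorm y"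
      using op_boundedD[OF bound mat_adjoint_carrier[OF BP] y(1)] by simp
  qed simp
qed

lemma sv_adjoint: "sv (mat_adjoint B) i = sv B i"
  using sv_adjoint_le[of B i] sv_adjoint_le[of "mat_adjoint B" i] by simp

lemma mat_rank_le_iff: "mat_rank B \<le> r \<longleftrightarrow> sv B r = 0"
proof -
  define p q where "p = dim_row B" and "q = dim_col B"
  have B: "B \<in> carrier_mat p q" by (simp add: p_def q_def)
  interpret vec_space "TYPE(complex)" p .
  have cB: "set (cols B) \<subseteq> carrier_vec p" using B cols_dim by blast
  have "lin_indpt {}"
    by (metis (no_types) empty_subsetI fin_dim finite_basis_exists subset_li_is_li vec_vs
        vectorspace.basis_def)
  then obtain S where S: "maximal S (\<lambda>T. T \<subseteq> set (cols B) \<and> lin_indpt T)"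
    using maximal_exists_superset[of "set (cols B)" "\<lambda>T. T \<subseteq> set (cols B) \<and> lin_indpt T" "{}"]
    by blast
  have rank: "mat_rank B = card S"
    using rank_card_indpt[OF B S] by (simp add: mat_rank_def p_def)
  have Ssub: "S \<subseteq> set (cols B)" and Sli: "lin_indpt S" using S by (auto simp: maximal_def)
  have Sc: "S \<subseteq> carrier_vec p" and Sfin: "finite S"
    using Ssub cB finite_subset by auto
  obtain ss where ss: "set ss = S" "distinct ss" using Sfin finite_distinct_list by blast
  have len: "length ss = card S" using ss distinct_card by fastforce
  define G where "G = mat_of_cols p ss"
  have G: "G \<in> carrier_mat p (card S)" unfolding G_def len[symmetric] by simp
  have colsG: "cols G = ss" using ss Sc by (simp add: G_def)
  show ?thesis
  proof
    assume r: "mat_rank B \<le> r"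
    have "\<exists>v. v \<in> carrier_vec (card S) \<and> col B j = G *\<^sub>v v" if j: "j < q" for j
    proof -
      have cj: "col B j \<in> set (cols B)" using j by (auto simp: cols_def q_def)
      have "col B j \<in> span S"
      proof (rule ccontr)
        assume n: "col B j \<notin> span S"
        then have nS: "col B j \<notin> S" using Sc in_own_span by auto
        have "lin_indpt (insert (col B j) S)"
          using lin_dep_iff_in_span[OF Sc Sli _ nS] n cj cB by auto
        then show False
          using S cj Ssub nS unfolding maximal_def by (metis insertI1 insert_subset subset_insertI)
      qed
      then have "col B j \<in> span_list ss" using span_list_as_span[of ss] ss Sc by simp
      then obtain c where "col B j = lincomb_list c ss" by (auto elim: in_span_listE)
      also have "\<dots> = G *\<^sub>v vec (length ss) c"
        unfolding G_def using ss Sc by (intro lincomb_list_as_mat_mult) auto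
      finally show ?thesis using len by (intro exI[of _ "vec (length ss) c"]) auto
    qed
    then obtain v where v: "\<And>j. j < q \<Longrightarrow> v j \<in> carrier_vec (card S)"
      "\<And>j. j < q \<Longrightarrow> col B j = G *\<^sub>v v j" by metis
    define F where "F = mat_of_cols (card S) (map v [0..<q])"
    have F: "F \<in> carrier_mat (card S) q"
      using mat_of_cols_carrier(1)[of "card S" "map v [0..<q]"] by (simp add: F_def)
    have BF: "B = G * F"
    proof (rule mat_col_eqI)
      fix j assume "j < dim_col (G * F)"
      then have j: "j < q" using F by simp
      then have "col F j = v j" using v(1) by (simp add: F_def)
      then show "col B j = col (G * F) j"
        using v(2)[OF j] col_mult2[OF G F j] by simp
    qed (use B G F in auto)
    have "G *\<^sub>v 0\<^sub>v (card S) = 0\<^sub>v p" using G by (intro eq_vecI) auto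
    then have "sv B (card S) \<le> 0"
      by (intro sv_le[OF B F]) (use G F in \<open>auto simp: BF mat_mult_vec_assoc\<close>)
    then show "sv B r = 0"
      using sv_antimono[of "card S" r B] sv_nonneg[of B r] r rank by linarith
  next
    assume 0: "sv B r = 0"
    obtain F where F: "F \<in> carrier_mat r q" "\<And>x. x \<in> carrier_vec q \<Longrightarrow> F *\<^sub>v x = 0\<^sub>v r \<Longrightarrow>
      vnorm (B *\<^sub>v x) \<le> sv B r * vnorm x" using sv_attained[OF B] by blast
    show "mat_rank B \<le> r"
    proof (rule ccontr)
      assume "\<not> mat_rank B \<le> r"
      then have rlt: "r < card S" using rank by simp
      have "\<exists>a<q. col B a = ss ! b" if "b < card S" for b
      proof -
        have "ss ! b \<in> set (cols B)" using that len ss Ssub by (metis nth_mem subsetD)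
        then show ?thesis by (auto simp: cols_def q_def)
      qed
      then obtain f where f: "\<And>b. b < card S \<Longrightarrow> f b < q" "\<And>b. b < card S \<Longrightarrow> col B (f b) = ss ! b"
        by metis
      define P where "P = mat q (card S) (\<lambda>(a, b). if a = f b then 1 else 0 :: complex)"
      have P: "P \<in> carrier_mat q (card S)" by (simp add: P_def)
      have BP: "B * P = G"
      proof (rule mat_col_eqI)
        fix b assume "b < dim_col G"
        then have b: "b < card S" using G by simp
        have "col (B * P) b = B *\<^sub>v col P b" using col_mult2[OF B P b] .
        also have "col P b = unit_vec q (f b)"
          using b by (intro eq_vecI) (auto simp: P_def unit_vec_def)
        also have "B *\<^sub>v unit_vec q (f b) = col B (f b)"
          using B f(1)[OF b] by (intro eq_vecI) auto
        finally show "col (B * P) b = col G b"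
          using f(2)[OF b] colsG G b by (metis carrier_matD(2) cols_nth)
      qed (use B G P in auto)
      have "F * P \<in> carrier_mat r (card S)" using F P by auto
      then obtain x where x: "x \<in> carrier_vec (card S)" "x \<noteq> 0\<^sub>v (card S)" "F * P *\<^sub>v x = 0\<^sub>v r"
        using nontrivial_kernel rlt by blast
      have Px: "P *\<^sub>v x \<in> carrier_vec q" using P x by auto
      have "F *\<^sub>v (P *\<^sub>v x) = 0\<^sub>v r" using x F P by (simp add: mat_mult_vec_assoc)
      then have "vnorm (B *\<^sub>v (P *\<^sub>v x)) = 0"
        using F(2)[OF Px] 0 vnorm_nonneg[of "B *\<^sub>v (P *\<^sub>v x)"] by simp
      then have "B *\<^sub>v (P *\<^sub>v x) = 0\<^sub>v p"
        using vnorm_eq_0[of "B *\<^sub>v (P *\<^sub>v x)" p] B Px by auto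
      then have "G *\<^sub>v x = 0\<^sub>v p" using BP B P x by (simp add: mat_mult_vec_assoc[symmetric])
      then have "lin_dep (set (cols G))"
        using lin_depI[OF G x(1,2)] colsG ss by simp
      then show False using colsG ss Sli by simp
    qed
  qed
qed

lemma mat_rank_cong:
  assumes "\<And>i. sv B i = sv D i"
  shows "mat_rank B = mat_rank D"
  using mat_rank_le_iff[of B] mat_rank_le_iff[of D] assms by (metis order.antisym order_refl)

section \<open>Norms of matrices over the scalar field\<close>

lemma mats_overD: "B \<in> mats_over K p q \<Longrightarrow> B \<in> carrier_mat p q"
  by (simp add: mats_over_def)

lemma mats_overI:
  assumes "B \<in> carrier_mat p q" "\<And>i j. i < p \<Longrightarrow> j < q \<Longrightarrow> B $$ (i, j) \<in> K"
  shows "B \<in> mats_over K p q"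
  using assms by (auto simp: mats_over_def elements_mat_def)

lemma mats_over_index: "B \<in> mats_over K p q \<Longrightarrow> i < p \<Longrightarrow> j < q \<Longrightarrow> B $$ (i, j) \<in> K"
  unfolding mats_over_def by (blast intro: elements_matI)

locale scalar_field =
  fixes K :: "complex set"
  assumes K: "K = \<real> \<or> K = UNIV"
begin

lemma real_mem: "of_real x \<in> K"
  using K by auto

lemma rdiag_over [simp]: "rdiag p q f \<in> mats_over K p q"
  using K by (intro mats_overI) (auto simp: rdiag_def)

lemma one_over [simp]: "1\<^sub>m n \<in> mats_over K n n"
  using rdiag_over[of n n "\<lambda>_. 1"] by (simp add: rdiag_one)

lemma closed: "a \<in> K \<Longrightarrow> b \<in> K \<Longrightarrow> a + b \<in> K" "a \<in> K \<Longrightarrow> b \<in> K \<Longrightarrow> a - b \<in> K"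
    "a \<in> K \<Longrightarrow> b \<in> K \<Longrightarrow> a * b \<in> K"
  using K by auto

lemma add_over: "B \<in> mats_over K p q \<Longrightarrow> D \<in> mats_over K p q \<Longrightarrow> B + D \<in> mats_over K p q"
  using mats_overD[of B K p q] mats_overD[of D K p q]
  by (intro mats_overI) (auto simp: closed mats_over_index)

lemma minus_over: "B \<in> mats_over K p q \<Longrightarrow> D \<in> mats_over K p q \<Longrightarrow> B - D \<in> mats_over K p q"
  using mats_overD[of B K p q] mats_overD[of D K p q]
  by (intro mats_overI) (auto simp: closed mats_over_index minus_carrier_mat)

lemma mult_over:
  assumes "B \<in> mats_over K p q" "D \<in> mats_over K q r"
  shows "B * D \<in> mats_over K p r"
proof (rule mats_overI)
  show "B * D \<in> carrier_mat p r" using assms by (auto dest!: mats_overD)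
  fix i j assume ij: "i < p" "j < r"
  have "(B * D) $$ (i, j) = (\<Sum>a<q. B $$ (i, a) * D $$ (a, j))"
    using ij assms[THEN mats_overD] by (auto simp: scalar_prod_def atLeast0LessThan intro!: sum.cong)
  also have "\<dots> \<in> K"
    using K mats_over_index[OF assms(1)] mats_over_index[OF assms(2)] ij
    by (auto intro!: sum_in_Reals Reals_mult)
  finally show "(B * D) $$ (i, j) \<in> K" .
qed

lemma adjoint_over:
  assumes "B \<in> mats_over K p q"
  shows "mat_adjoint B \<in> mats_over K q p"
proof (rule mats_overI)
  show "mat_adjoint B \<in> carrier_mat q p" using assms[THEN mats_overD] by auto
  fix i j assume ij: "i < q" "j < p"
  then show "mat_adjoint B $$ (i, j) \<in> K"
    using K mats_over_index[OF assms, of j i] mats_overD[OF assms] by (auto simp: Reals_cnj_iff)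
qed

lemma smult_over: "c \<in> K \<Longrightarrow> B \<in> mats_over K p q \<Longrightarrow> c \<cdot>\<^sub>m B \<in> mats_over K p q"
  using mats_overD[of B K p q] by (intro mats_overI) (auto simp: closed mats_over_index)

end

locale sv_norm = scalar_field +
  fixes N :: "complex mat \<Rightarrow> real"
  assumes fam: "norm_family K N" and normd: "normalized K N" and unif: "uniformly_generated K N"
    and uinv: "unitarily_invariant K N"
begin

lemma N_nonneg: "B \<in> mats_over K p q \<Longrightarrow> 0 < p \<Longrightarrow> 0 < q \<Longrightarrow> 0 \<le> N B"
  using fam by (auto simp: norm_family_def)

lemma N_triangle:
  "B \<in> mats_over K p q \<Longrightarrow> D \<in> mats_over K p q \<Longrightarrow> 0 < p \<Longrightarrow> 0 < q \<Longrightarrow> N (B + D) \<le> N B + N D"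
  using fam by (auto simp: norm_family_def)

lemma N_smult:
  "c \<in> K \<Longrightarrow> B \<in> mats_over K p q \<Longrightarrow> 0 < p \<Longrightarrow> 0 < q \<Longrightarrow> N (c \<cdot>\<^sub>m B) = cmod c * N B"
  using fam by (auto simp: norm_family_def)

lemma N_cong_sv:
  assumes "B \<in> mats_over K p q" "D \<in> mats_over K p' q'" "0 < p" "0 < q" "0 < p'" "0 < q'"
    and "\<And>i. sv B i = sv D i"
  shows "N B = N D"
proof -
  obtain \<phi> :: "real list \<Rightarrow> real" where \<phi>: "\<And>p q B. 0 < p \<Longrightarrow> 0 < q \<Longrightarrow> B \<in> mats_over K p q \<Longrightarrow>
      N B = \<phi> (map (singular_value B) [1..<Suc (mat_rank B)])"
    using unif by (auto simp: uniformly_generated_def)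
  have "singular_value B i = singular_value D i" if "1 \<le> i" for i
    using assms(7)[of "i - 1"] that by simp
  then have "map (singular_value B) [1..<Suc (mat_rank B)] = map (singular_value D) [1..<Suc (mat_rank D)]"
    using mat_rank_cong[OF assms(7)] by (intro map_cong) auto
  then show ?thesis using \<phi> assms by metis
qed

lemma N_rdiag_flip:
  assumes "0 < s"
  shows "N (rdiag s s (f(i := - f i))) = N (rdiag s s f)"
proof -
  define P where "P = rdiag s s (\<lambda>j. if j = i then - 1 else 1)"
  have PP: "P * P = 1\<^sub>m s" unfolding P_def rdiag_mult rdiag_one[symmetric]
    by (rule rdiag_cong) simp
  have "P \<in> unitaries_over K s"
    using PP by (simp add: unitaries_over_def P_def)
  moreover have "1\<^sub>m s \<in> unitaries_over K s"
    by (simp add: unitaries_over_def)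
  ultimately have "N (P * rdiag s s f * 1\<^sub>m s) = N (rdiag s s f)"
    using uinv assms unfolding unitarily_invariant_def by (metis rdiag_over)
  moreover have "P * rdiag s s f * 1\<^sub>m s = rdiag s s (f(i := - f i))"
    unfolding P_def rdiag_mult rdiag_one[symmetric] by (rule rdiag_cong) simp
  ultimately show ?thesis by simp
qed

text \<open>Shrinking one diagonal entry replaces the matrix by a convex combination of itself and
  its image under a sign flip.\<close>

lemma N_rdiag_update:
  assumes s: "0 < s" and a: "\<bar>a\<bar> \<le> \<bar>f i\<bar>"
  shows "N (rdiag s s (f(i := a))) \<le> N (rdiag s s f)"
proof (cases "f i = 0")
  case True
  then show ?thesis using a by (metis abs_le_zero_iff abs_zero fun_upd_triv order_refl)
next
  case False
  define r where "r = a / f i"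
  have r: "\<bar>r\<bar> \<le> 1" using a False by (simp add: r_def abs_divide)
  let ?c = "complex_of_real ((1 + r) / 2)" and ?d = "complex_of_real ((1 - r) / 2)"
  let ?g = "f(i := - f i)"
  have "rdiag s s (f(i := a)) = ?c \<cdot>\<^sub>m rdiag s s f + ?d \<cdot>\<^sub>m rdiag s s ?g"
  proof (rule eq_matI)
    fix j l assume "j < dim_row (?c \<cdot>\<^sub>m rdiag s s f + ?d \<cdot>\<^sub>m rdiag s s ?g)"
      "l < dim_col (?c \<cdot>\<^sub>m rdiag s s f + ?d \<cdot>\<^sub>m rdiag s s ?g)"
    then have jl: "j < s" "l < s" by auto
    have "a = (1 + r) / 2 * f i + (1 - r) / 2 * (- f i)"
      using False by (simp add: r_def field_simps)
    then have "complex_of_real a = ?c * of_real (f i) + ?d * of_real (- f i)"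
      by (metis of_real_add of_real_mult)
    moreover have "?c * z + ?d * z = z" for z by (simp add: field_simps)
    ultimately show "rdiag s s (f(i := a)) $$ (j, l) = (?c \<cdot>\<^sub>m rdiag s s f + ?d \<cdot>\<^sub>m rdiag s s ?g) $$ (j, l)"
      using jl by (auto simp del: of_real_divide of_real_add of_real_diff of_real_minus)
  qed auto
  then have "N (rdiag s s (f(i := a))) \<le> N (?c \<cdot>\<^sub>m rdiag s s f) + N (?d \<cdot>\<^sub>m rdiag s s ?g)"
    using N_triangle[of "?c \<cdot>\<^sub>m rdiag s s f" s s "?d \<cdot>\<^sub>m rdiag s s ?g"] s
    by (simp add: smult_over real_mem del: of_real_divide)
  also have "\<dots> = cmod ?c * N (rdiag s s f) + cmod ?d * N (rdiag s s ?g)"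
    using N_smult[OF real_mem rdiag_over s s] by metis
  also have "\<dots> = (1 + r) / 2 * N (rdiag s s f) + (1 - r) / 2 * N (rdiag s s f)"
    using r N_rdiag_flip[OF s] by (simp add: abs_le_iff del: of_real_divide)
  finally show ?thesis by (simp add: field_simps)
qed

lemma N_rdiag_mono:
  assumes s: "0 < s" and ab: "\<And>i. i < s \<Longrightarrow> \<bar>a i\<bar> \<le> \<bar>b i\<bar>"
  shows "N (rdiag s s a) \<le> N (rdiag s s b)"
proof -
  have "N (rdiag s s (\<lambda>i. if i < r then a i else b i)) \<le> N (rdiag s s b)" if "r \<le> s" for r
    using that
  proof (induction r)
    case (Suc r)
    have "(\<lambda>i. if i < Suc r then a i else b i) = (\<lambda>i. if i < r then a i else b i)(r := a r)"
      by (auto simp: fun_eq_iff less_Suc_eq)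
    then have "N (rdiag s s (\<lambda>i. if i < Suc r then a i else b i))
        \<le> N (rdiag s s (\<lambda>i. if i < r then a i else b i))"
      using N_rdiag_update[OF s, of "a r" "\<lambda>i. if i < r then a i else b i" r] ab[of r] Suc.prems
      by simp
    with Suc show ?case by simp
  qed simp
  from this[of s] have "N (rdiag s s (\<lambda>i. if i < s then a i else b i)) \<le> N (rdiag s s b)" by simp
  also have "rdiag s s (\<lambda>i. if i < s then a i else b i) = rdiag s s a"
    by (rule rdiag_cong) simp
  finally show ?thesis .
qed

lemma N_eq_rdiag:
  assumes "B \<in> mats_over K p q" "0 < p" "0 < q" "min p q \<le> s"
  shows "N B = N (rdiag s s (sv B))"
proof (rule N_cong_sv[OF assms(1) rdiag_over assms(2,3)])
  show "sv B i = sv (rdiag s s (sv B)) i" for i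
    using sv_rdiag[of s s "sv B" i] sv_antimono[of _ _ B] sv_eq_0[of B i] assms(4) mats_overD[OF assms(1)]
    by auto
qed (use assms in auto)

lemma N_mono:
  assumes B: "B \<in> mats_over K p q" "0 < p" "0 < q" and D: "D \<in> mats_over K p' q'" "0 < p'" "0 < q'"
    and c: "0 \<le> c" and le: "\<And>i. sv B i \<le> c * sv D i"
  shows "N B \<le> c * N D"
proof -
  define s where "s = p + p'"
  have s: "0 < s" "min p q \<le> s" "min p' q' \<le> s" using B by (auto simp: s_def)
  have "N B = N (rdiag s s (sv B))" using N_eq_rdiag B s by blast
  also have "\<dots> \<le> N (rdiag s s (\<lambda>i. c * sv D i))"
    using le c by (intro N_rdiag_mono s) (simp add: abs_mult)
  also have "rdiag s s (\<lambda>i. c * sv D i) = of_real c \<cdot>\<^sub>m rdiag s s (sv D)"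
    by (rule eq_matI) auto
  also have "N \<dots> = c * N (rdiag s s (sv D))"
    using N_smult[OF real_mem rdiag_over s(1) s(1)] c by simp
  also have "N (rdiag s s (sv D)) = N D" using N_eq_rdiag D s by metis
  finally show ?thesis .
qed

lemma sv_le_N:
  assumes "B \<in> mats_over K p q" "0 < p" "0 < q"
  shows "sv B i \<le> N B"
proof -
  let ?x = "rdiag 1 1 (\<lambda>_. sv B 0)"
  have x: "?x \<in> mats_over K 1 1" by simp
  have "\<forall>x \<in> mats_over K 1 1. N x = sqrt (\<Sum>i<1. (cmod (x $$ (i, 0)))\<^sup>2)"
    using normd[unfolded normalized_def, rule_format, of 1] by simp
  from bspec[OF this x] have "N ?x = sv B 0" by simp
  moreover have "N ?x \<le> 1 * N B"
  proof (rule N_mono[OF x _ _ assms])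
    show "sv ?x i \<le> 1 * sv B i" for i
      using sv_rdiag[of 1 1 "\<lambda>_. sv B 0" i] by (cases i) auto
  qed auto
  ultimately show ?thesis using sv_antimono[of 0 i B] by simp
qed

lemma N_mult_left:
  assumes "X * Y \<in> mats_over K p q" "0 < p" "0 < q" "Y \<in> mats_over K p' q" "0 < p'"
    "dim_col X = p'" "op_bounded X c" "0 \<le> c"
  shows "N (X * Y) \<le> c * N Y"
proof (rule N_mono[OF assms(1-5,3,8)])
  show "sv (X * Y) i \<le> c * sv Y i" for i
    using assms mats_overD[OF assms(4)] by (intro sv_mult_left) auto
qed

lemma N_mult_right:
  assumes "X * Y \<in> mats_over K p q" "0 < p" "0 < q" "X \<in> mats_over K p q'" "0 < q'"
    "dim_row Y = q'" "op_bounded Y c" "0 \<le> c"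
  shows "N (X * Y) \<le> c * N X"
proof (rule N_mono[OF assms(1-4,2,5,8)])
  show "sv (X * Y) i \<le> c * sv X i" for i
    using assms mats_overD[OF assms(4)] by (intro sv_mult_right) auto
qed

end

section \<open>Pseudoinverse and truncated singular value decomposition\<close>

lemma pinv_eqI:
  assumes B: "B \<in> carrier_mat p q" and X: "X \<in> carrier_mat q p"
    and "B * X * B = B" "X * B * X = X"
    and "mat_adjoint (B * X) = B * X" "mat_adjoint (X * B) = X * B"
  shows "pinv B = X"
  unfolding pinv_def
proof (rule the_equality)
  show "X \<in> carrier_mat (dim_col B) (dim_row B) \<and> B * X * B = B \<and> X * B * X = X \<and>
      mat_adjoint (B * X) = B * X \<and> mat_adjoint (X * B) = X * B"
    using assms by auto
  fix Y
  assume "Y \<in> carrier_mat (dim_col B) (dim_row B) \<and> B * Y * B = B \<and> Y * B * Y = Y \<and>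
      mat_adjoint (B * Y) = B * Y \<and> mat_adjoint (Y * B) = Y * B"
  then have Y: "Y \<in> carrier_mat q p" and y: "B * Y * B = B" "Y * B * Y = Y"
    "mat_adjoint (B * Y) = B * Y" "mat_adjoint (Y * B) = Y * B" using B by auto
  note d = carrier_matD[OF B] carrier_matD[OF X] carrier_matD[OF Y]
  have "B * X = mat_adjoint (B * Y * B * X)" using y(1) assms(5) by simp
  also have "\<dots> = mat_adjoint ((B * Y) * (B * X))" using d by (simp add: mat_mult_assoc)
  also have "\<dots> = (B * X) * (B * Y)"
    using d y(3) assms(5) by (subst mat_adjoint_mult) auto
  also have "\<dots> = (B * X * B) * Y" using d by (simp add: mat_mult_assoc)
  finally have BX: "B * X = B * Y" using assms(3) by simp
  have "X * B = mat_adjoint (X * (B * Y * B))" using y(1) assms(6) by simp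
  also have "\<dots> = mat_adjoint ((X * B) * (Y * B))" using d by (simp add: mat_mult_assoc)
  also have "\<dots> = (Y * B) * (X * B)"
    using d y(4) assms(6) by (subst mat_adjoint_mult) auto
  also have "\<dots> = Y * (B * X * B)" using d by (simp add: mat_mult_assoc)
  finally have XB: "X * B = Y * B" using assms(3) by simp
  have "Y = Y * (B * Y)" using y(2) d by (simp add: mat_mult_assoc)
  also have "\<dots> = (Y * B) * X" using BX d by (simp add: mat_mult_assoc)
  also have "\<dots> = X" using XB assms(4) by simp
  finally show "Y = X" .
qed

lemma sandwich_mult:
  fixes W V U :: "complex mat"
  assumes "V \<in> carrier_mat q q" "mat_adjoint V * V = 1\<^sub>m q"
    and "dim_col W = p" "dim_col U = r"
  shows "(W * rdiag p q f * mat_adjoint V) * (V * rdiag q r g * mat_adjoint U) =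
    W * rdiag p r (\<lambda>i. if i < q then f i * g i else 0) * mat_adjoint U"
proof -
  have "(W * rdiag p q f * mat_adjoint V) * (V * rdiag q r g * mat_adjoint U) =
    W * rdiag p q f * ((mat_adjoint V * V) * (rdiag q r g * mat_adjoint U))"
    using assms(1,3,4) by (simp add: mat_mult_assoc)
  also have "\<dots> = W * rdiag p q f * (rdiag q r g * mat_adjoint U)"
    unfolding assms(2) using assms(4)
    by (subst left_mult_one_mat[of _ q "dim_row U"]) (auto intro!: carrier_matI)
  also have "\<dots> = W * (rdiag p q f * rdiag q r g) * mat_adjoint U"
    using assms(3,4) by (simp add: mat_mult_assoc)
  finally show ?thesis by (simp only: rdiag_mult)
qed

lemma sandwich_adjoint:
  fixes W V :: "complex mat"
  assumes "dim_col W = p" "dim_col V = q"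
  shows "mat_adjoint (W * rdiag p q f * mat_adjoint V) = V * rdiag q p f * mat_adjoint W"
  using assms by (simp add: mat_adjoint_mult mat_mult_assoc)

lemma sandwich_minus:
  fixes W V :: "complex mat"
  assumes "dim_col W = p" "dim_col V = q"
  shows "W * rdiag p q f * mat_adjoint V - W * rdiag p q g * mat_adjoint V =
    W * rdiag p q (\<lambda>i. f i - g i) * mat_adjoint V"
proof -
  have "rdiag p q (\<lambda>i. f i - g i) = rdiag p q f - rdiag p q g"
    by (rule eq_matI) auto
  then show ?thesis using assms by (simp add: mat_mult_distribs)
qed

lemma op_bounded_sandwich:
  assumes "W \<in> carrier_mat p p" "mat_adjoint W * W = 1\<^sub>m p"
    and "V \<in> carrier_mat q q" "mat_adjoint V * V = 1\<^sub>m q"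
    and "0 \<le> c" "\<And>i. i < p \<Longrightarrow> i < q \<Longrightarrow> \<bar>f i\<bar> \<le> c"
  shows "op_bounded (W * rdiag p q f * mat_adjoint V) c"
proof -
  have "op_bounded (W * rdiag p q f) (1 * c)"
    using assms by (intro op_bounded_mult op_bounded_isometry[of W p p] op_bounded_rdiag) auto
  moreover have "op_bounded (mat_adjoint V) 1"
    using assms by (intro op_bounded_adjoint op_bounded_isometry) auto
  ultimately have "op_bounded (W * rdiag p q f * mat_adjoint V) (1 * c * 1)"
    by (rule op_bounded_mult[of _ _ _ _ p q q]) (use assms in auto)
  then show ?thesis by simp
qed

lemma sv_rdiag_tail:
  assumes "\<And>i. 0 \<le> s i" "\<And>i j. i \<le> j \<Longrightarrow> s j \<le> s i"
  shows "sv (rdiag p q (\<lambda>a. if a < k then 0 else s a)) i \<le> s (k + i)"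
proof (rule sv_le[OF rdiag_carrier])
  let ?F = "mat i q (\<lambda>(a, b). if b = k + a then 1 else 0) :: complex mat"
  show "?F \<in> carrier_mat i q" by simp
  fix x :: "complex vec" assume x: "x \<in> carrier_vec q" "?F *\<^sub>v x = 0\<^sub>v i"
  have x0: "x $ (k + a) = 0" if "a < i" "k + a < q" for a
  proof -
    have "(?F *\<^sub>v x) $ a = (\<Sum>b<q. (if b = k + a then 1 else 0) * x $ b)"
      using x(1) that by (auto simp: scalar_prod_def atLeast0LessThan intro!: sum.cong)
    also have "\<dots> = (\<Sum>b<q. if b = k + a then x $ b else 0)" by (rule sum.cong) auto
    finally show ?thesis using x(2) that by simp
  qed
  let ?g = "\<lambda>a. if a < k then 0 else s a"
  have "(vnorm (rdiag p q ?g *\<^sub>v x))\<^sup>2 \<le> (\<Sum>a<min p q. (s (k + i))\<^sup>2 * (cmod (x $ a))\<^sup>2)"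
    unfolding vnorm_rdiag_mult[OF x(1)]
  proof (rule sum_mono)
    fix a assume a: "a \<in> {..<min p q}"
    consider "a < k" | "k \<le> a" "a < k + i" | "k + i \<le> a" by linarith
    then show "(?g a)\<^sup>2 * (cmod (x $ a))\<^sup>2 \<le> (s (k + i))\<^sup>2 * (cmod (x $ a))\<^sup>2"
    proof cases
      case 2
      then show ?thesis using x0[of "a - k"] a by auto
    next
      case 3
      then show ?thesis using assms by (intro mult_right_mono power_mono) auto
    qed auto
  qed
  also have "\<dots> \<le> (\<Sum>a<q. (s (k + i))\<^sup>2 * (cmod (x $ a))\<^sup>2)" by (rule sum_mono2) auto
  also have "\<dots> = (s (k + i) * vnorm x)\<^sup>2"
    using x by (simp add: power_mult_distrib vnorm_sq sum_distrib_left)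
  finally show "vnorm (rdiag p q ?g *\<^sub>v x) \<le> s (k + i) * vnorm x"
    by (rule power2_le_imp_le) (use assms in auto)
qed (use assms in auto)

lemma unitaries_overD:
  "Q \<in> unitaries_over K p \<Longrightarrow> Q \<in> mats_over K p p" "Q \<in> unitaries_over K p \<Longrightarrow> Q \<in> carrier_mat p p"
  "Q \<in> unitaries_over K p \<Longrightarrow> mat_adjoint Q * Q = 1\<^sub>m p"
  "Q \<in> unitaries_over K p \<Longrightarrow> Q * mat_adjoint Q = 1\<^sub>m p"
  by (auto simp: unitaries_over_def dest: mats_overD)

context scalar_field
begin

lemma truncated_svd_pinv:
  assumes B: "B \<in> mats_over K p q" and t: "truncated_svd K k B X"
  shows "X \<in> mats_over K p q" "pinv X \<in> mats_over K q p"
    and "X * pinv X * X = X" "pinv X * X * pinv X = pinv X"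
    and "X * pinv X * B = X" "B * pinv X * X = X"
    and "pinv X * B = pinv X * X" "B * pinv X = X * pinv X"
    and "op_bounded (X * pinv X) 1" "op_bounded (pinv X * X) 1"
    and "op_bounded (1\<^sub>m p - X * pinv X) 1" "op_bounded (1\<^sub>m q - pinv X * X) 1"
    and "0 < sv B (k - 1) \<Longrightarrow> op_bounded (pinv X) (1 / sv B (k - 1))"
    and "sv (B - X) i \<le> sv B (k + i)"
proof -
  have Bc: "B \<in> carrier_mat p q" using B by (rule mats_overD)
  obtain W V where W: "W \<in> unitaries_over K p" and V: "V \<in> unitaries_over K q"
    and Beq0: "B = W * mat p q (\<lambda>(i, j). if i = j then of_real (sv B i) else 0) * mat_adjoint V"
    and Xeq0: "X = W * mat p q (\<lambda>(i, j). if i = j \<and> i < k then of_real (sv B i) else 0) * mat_adjoint V"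
    using t Bc unfolding truncated_svd_def by auto
  note w = unitaries_overD[OF W] and v = unitaries_overD[OF V]
  define s where "s = sv B"
  let ?f = "\<lambda>i. if i < k then s i else 0"
  let ?g = "\<lambda>i. if i < k then inverse (s i) else 0"
  have Beq: "B = W * rdiag p q s * mat_adjoint V"
    using Beq0 by (simp only: rdiag_def s_def)
  have "mat p q (\<lambda>(i, j). if i = j \<and> i < k then of_real (sv B i) else 0) = rdiag p q ?f"
    by (rule eq_matI) (auto simp: s_def)
  then have Xeq: "X = W * rdiag p q ?f * mat_adjoint V" using Xeq0 by simp
  define Y where "Y = V * rdiag q p ?g * mat_adjoint W"
  have X: "X \<in> mats_over K p q" unfolding Xeq
    using w v by (intro mult_over[of _ p q] mult_over[of _ p p] adjoint_over rdiag_over) auto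
  have Y: "Y \<in> mats_over K q p" unfolding Y_def
    using w v by (intro mult_over[of _ q p] mult_over[of _ q q] adjoint_over rdiag_over) auto
  note dw = carrier_matD(2)[OF w(2)] and dv = carrier_matD(2)[OF v(2)]
  note sm = sandwich_mult[OF v(2,3) dw dw] sandwich_mult[OF v(2,3) dw dv]
    sandwich_mult[OF v(2,3) dv dw] sandwich_mult[OF v(2,3) dv dv]
    sandwich_mult[OF w(2,3) dw dw] sandwich_mult[OF w(2,3) dw dv]
    sandwich_mult[OF w(2,3) dv dw] sandwich_mult[OF w(2,3) dv dv]
  have inv: "s i * inverse (s i) = of_bool (s i \<noteq> 0)" "inverse (s i) * s i = of_bool (s i \<noteq> 0)"
    for i by auto
  have XYX: "X * Y * X = X"
    unfolding Xeq Y_def sm by (intro arg_cong2[of _ _ _ _ "(*)"] refl rdiag_cong) (auto simp: inv)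
  have YXY: "Y * X * Y = Y"
    unfolding Xeq Y_def sm by (intro arg_cong2[of _ _ _ _ "(*)"] refl rdiag_cong) (auto simp: inv)
  have XYB: "X * Y * B = X"
    unfolding Xeq Y_def Beq sm by (intro arg_cong2[of _ _ _ _ "(*)"] refl rdiag_cong) (auto simp: inv)
  have BYX: "B * Y * X = X"
    unfolding Xeq Y_def Beq sm by (intro arg_cong2[of _ _ _ _ "(*)"] refl rdiag_cong) (auto simp: inv)
  have YB: "Y * B = Y * X"
    unfolding Xeq Y_def Beq sm by (intro arg_cong2[of _ _ _ _ "(*)"] refl rdiag_cong) simp
  have BY: "B * Y = X * Y"
    unfolding Xeq Y_def Beq sm by (intro arg_cong2[of _ _ _ _ "(*)"] refl rdiag_cong) simp
  have XY: "X * Y = W * rdiag p p (\<lambda>i. if i < q then ?f i * ?g i else 0) * mat_adjoint W"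
    and YX: "Y * X = V * rdiag q q (\<lambda>i. if i < p then ?g i * ?f i else 0) * mat_adjoint V"
    unfolding Xeq Y_def sm by simp_all
  have pY: "pinv X = Y"
    by (rule pinv_eqI[OF mats_overD[OF X] mats_overD[OF Y] XYX YXY])
      (simp_all add: XY YX sandwich_adjoint[OF dw dw] sandwich_adjoint[OF dv dv])
  have s0: "0 \<le> s i" for i by (simp add: s_def)
  have fg: "0 \<le> ?f i * ?g i" "?f i * ?g i \<le> 1" "0 \<le> ?g i * ?f i" "?g i * ?f i \<le> 1" for i
    using s0[of i] by (cases "s i = 0"; simp)+
  have fg': "\<bar>if b then ?f i * ?g i else 0\<bar> \<le> 1" "\<bar>if b then ?g i * ?f i else 0\<bar> \<le> 1"
    "\<bar>1 - (if b then ?f i * ?g i else 0)\<bar> \<le> 1" "\<bar>1 - (if b then ?g i * ?f i else 0)\<bar> \<le> 1" for i b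
    using fg[of i] by (auto simp del: right_inverse left_inverse)
  show "X \<in> mats_over K p q" "pinv X \<in> mats_over K q p" using X Y pY by auto
  show "X * pinv X * X = X" "pinv X * X * pinv X = pinv X"
    "X * pinv X * B = X" "B * pinv X * X = X"
    "pinv X * B = pinv X * X" "B * pinv X = X * pinv X"
    unfolding pY by (fact XYX YXY XYB BYX YB BY)+
  show "op_bounded (X * pinv X) 1" unfolding pY XY
    by (rule op_bounded_sandwich[OF w(2,3) w(2,3)]) (simp, rule fg')
  show "op_bounded (pinv X * X) 1" unfolding pY YX
    by (rule op_bounded_sandwich[OF v(2,3) v(2,3)]) (simp, rule fg')
  have oW: "1\<^sub>m p = W * rdiag p p (\<lambda>_. 1) * mat_adjoint W" using w by (simp add: rdiag_one)
  have oV: "1\<^sub>m q = V * rdiag q q (\<lambda>_. 1) * mat_adjoint V" using v by (simp add: rdiag_one)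
  show "op_bounded (1\<^sub>m p - X * pinv X) 1" unfolding pY XY
    by (subst oW, subst sandwich_minus[OF dw dw], rule op_bounded_sandwich[OF w(2,3) w(2,3)]) (simp, rule fg')
  show "op_bounded (1\<^sub>m q - pinv X * X) 1" unfolding pY YX
    by (subst oV, subst sandwich_minus[OF dv dv], rule op_bounded_sandwich[OF v(2,3) v(2,3)]) (simp, rule fg')
  show "op_bounded (pinv X) (1 / sv B (k - 1))" if pos: "0 < sv B (k - 1)"
    unfolding pY Y_def
  proof (rule op_bounded_sandwich[OF v(2,3) w(2,3)])
    fix i
    show "\<bar>?g i\<bar> \<le> 1 / sv B (k - 1)"
    proof (cases "i < k")
      case True
      then have "sv B (k - 1) \<le> s i" using sv_antimono[of i "k - 1" B] by (simp add: s_def)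
      then show ?thesis using True pos by (simp add: field_simps)
    qed (use pos in simp)
  qed (use pos in simp)
  have "B - X = W * rdiag p q s * mat_adjoint V - X" using Beq by simp
  also have "\<dots> = W * rdiag p q (\<lambda>i. s i - ?f i) * mat_adjoint V"
    unfolding Xeq by (rule sandwich_minus[OF dw dv])
  also have "rdiag p q (\<lambda>i. s i - ?f i) = rdiag p q (\<lambda>i. if i < k then 0 else s i)"
    by (rule rdiag_cong) auto
  finally have BX: "B - X = W * rdiag p q (\<lambda>i. if i < k then 0 else s i) * mat_adjoint V" .
  have "sv (B - X) i \<le> 1 * sv (W * rdiag p q (\<lambda>i. if i < k then 0 else s i)) i"
    unfolding BX using v by (intro sv_mult_right op_bounded_adjoint op_bounded_isometry) auto
  also have "\<dots> \<le> 1 * (1 * sv (rdiag p q (\<lambda>i. if i < k then 0 else s i)) i)"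
    using w by (intro mult_left_mono sv_mult_left op_bounded_isometry) auto
  also have "\<dots> \<le> sv B (k + i)"
    using sv_rdiag_tail[of s p q k i] sv_antimono by (simp add: s_def)
  finally show "sv (B - X) i \<le> sv B (k + i)" .
qed

end

section \<open>Rows of maximal volume\<close>

lemma det_one_plus_mult:
  fixes A B :: "complex mat"
  assumes A: "A \<in> carrier_mat p r" and B: "B \<in> carrier_mat r p"
  shows "det (1\<^sub>m p + A * B) = det (1\<^sub>m r + B * A)"
proof -
  let ?M = "four_block_mat (1\<^sub>m p) (- A) B (1\<^sub>m r)"
  let ?L = "four_block_mat (1\<^sub>m p) (0\<^sub>m p r) (- B) (1\<^sub>m r)"
  have M: "?M \<in> carrier_mat (p + r) (p + r)" and L: "?L \<in> carrier_mat (p + r) (p + r)"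
    using A B by auto
  have "?M * ?L = four_block_mat (1\<^sub>m p + A * B) (- A) (0\<^sub>m r p) (1\<^sub>m r)"
    using A B by (subst mult_four_block_mat[of _ p p _ r _ r _ _ p _ r]) auto
  moreover have "?L * ?M = four_block_mat (1\<^sub>m p) (- A) (0\<^sub>m r p) (1\<^sub>m r + B * A)"
    using A B by (subst mult_four_block_mat[of _ p p _ r _ r _ _ p _ r])
      (auto intro!: cong_four_block_mat simp: comm_add_mat[of "B * A" r r])
  moreover have "det (?M * ?L) = det (?L * ?M)"
    using det_mult[OF M L] det_mult[OF L M] by simp
  ultimately show ?thesis
    using A B det_four_block_mat_lower_left_zero[of "1\<^sub>m p + A * B" p "- A" r "0\<^sub>m r p" "1\<^sub>m r"]
      det_four_block_mat_lower_left_zero[of "1\<^sub>m p" p "- A" r "0\<^sub>m r p" "1\<^sub>m r + B * A"]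
    by simp
qed

lemma det_gram:
  assumes B: "B \<in> carrier_mat p q" and "q \<le> p"
  shows "det (mat_adjoint B * B) = of_real ((volume B)\<^sup>2)"
proof -
  obtain Q where Q: "Q \<in> carrier_mat q q" "mat_adjoint Q * Q = 1\<^sub>m q"
    "mat_adjoint Q * (mat_adjoint B * B) * Q = mat_diag q (\<lambda>i. of_real ((singular_value_list B ! i)\<^sup>2))"
    using gram_diagonalization[OF B] by blast
  have Qa: "mat_adjoint Q \<in> carrier_mat q q" using Q by auto
  have H: "mat_adjoint B * B \<in> carrier_mat q q" using B by auto
  have "det (mat_adjoint Q) * det Q = 1" using det_mult[OF Qa Q(1)] Q(2) by simp
  then have "det (mat_adjoint B * B) = det (mat_adjoint Q * (mat_adjoint B * B) * Q)"
    using det_mult[OF mult_carrier_mat[OF Qa H] Q(1)] det_mult[OF Qa H]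
    by (simp add: ac_simps)
  also have "\<dots> = (\<Prod>i = 0..<q. of_real ((singular_value_list B ! i)\<^sup>2))"
    unfolding Q(3)
    by (subst det_upper_triangular[of _ q])
      (auto simp: prod_list_diag_prod mat_diag_def upper_triangular_def)
  also have "\<dots> = (\<Prod>i = 0..<q. of_real ((sv B i)\<^sup>2))"
    using singular_value_list_nth[OF B] by simp
  also have "\<dots> = of_real ((\<Prod>i = 0..<q. sv B i)\<^sup>2)" by (simp add: prod_power_distrib)
  also have "(\<Prod>i = 0..<q. sv B i) = volume B"
    unfolding volume_def using assms
    by (auto simp: min_absorb2 intro!: prod.reindex_bij_witness[of _ "\<lambda>i. i - 1" Suc])
  finally show ?thesis .
qed

lemma gram_inverse:
  assumes B: "B \<in> carrier_mat p q" and pos: "\<And>i. i < q \<Longrightarrow> 0 < sv B i"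
  obtains H where "H \<in> carrier_mat q q" "mat_adjoint H = H"
    "H * (mat_adjoint B * B) = 1\<^sub>m q" "(mat_adjoint B * B) * H = 1\<^sub>m q"
proof -
  let ?G = "mat_adjoint B * B"
  obtain Q where Q: "Q \<in> carrier_mat q q" "mat_adjoint Q * Q = 1\<^sub>m q"
    "mat_adjoint Q * ?G * Q = mat_diag q (\<lambda>i. of_real ((singular_value_list B ! i)\<^sup>2))"
    using gram_diagonalization[OF B] by blast
  have QQ: "Q * mat_adjoint Q = 1\<^sub>m q" using unitary_right_inverse Q by blast
  have G: "?G \<in> carrier_mat q q" using B by auto
  have dQ: "dim_col Q = q" using Q by auto
  have D: "mat_adjoint Q * ?G * Q = rdiag q q (\<lambda>i. (sv B i)\<^sup>2)"
    unfolding Q(3) using singular_value_list_nth[OF B]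
    by (intro eq_matI) (auto simp: mat_diag_def)
  have "Q * (mat_adjoint Q * ?G * Q) * mat_adjoint Q = (Q * mat_adjoint Q) * ?G * (Q * mat_adjoint Q)"
    using Q(1) B by (simp add: mat_mult_assoc)
  then have Geq: "?G = Q * rdiag q q (\<lambda>i. (sv B i)\<^sup>2) * mat_adjoint Q"
    unfolding D QQ left_mult_one_mat[OF G] right_mult_one_mat[OF G] by (rule sym)
  define H where "H = Q * rdiag q q (\<lambda>i. inverse ((sv B i)\<^sup>2)) * mat_adjoint Q"
  have one: "Q * rdiag q q f * mat_adjoint Q = 1\<^sub>m q" if "\<And>i. i < q \<Longrightarrow> f i = 1" for f
  proof -
    have "rdiag q q f = 1\<^sub>m q" unfolding rdiag_one[symmetric] using that by (rule rdiag_cong)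
    then show ?thesis using QQ Q by simp
  qed
  show ?thesis
  proof
    show "H \<in> carrier_mat q q" using Q by (auto simp: H_def)
    show "mat_adjoint H = H" unfolding H_def by (rule sandwich_adjoint[OF dQ dQ])
    show "H * ?G = 1\<^sub>m q" "?G * H = 1\<^sub>m q"
      unfolding Geq H_def sandwich_mult[OF Q(1,2) dQ dQ]
      using pos by (auto intro!: one simp: less_imp_neq[THEN not_sym])
  qed
qed

definition row_sel :: "nat \<Rightarrow> nat set \<Rightarrow> complex mat" where
  "row_sel m I = mat (card I) m (\<lambda>(a, b). if b = pick I a then 1 else 0)"

lemma bij_betw_pick: "finite I \<Longrightarrow> bij_betw (pick I) {..<card I} I"
proof -
  assume fin: "finite I"
  have inj: "inj_on (pick I) {..<card I}"
    by (rule linorder_inj_onI') (metis lessThan_iff nat_neq_iff pick_mono)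
  have sub: "pick I ` {..<card I} \<subseteq> I" by (auto simp: pick_in_set)
  have "pick I ` {..<card I} = I"
    using card_subset_eq[OF fin sub] card_image[OF inj] by simp
  with inj show ?thesis by (simp add: bij_betw_def)
qed

context
  fixes m :: nat and I :: "nat set"
  assumes I: "I \<subseteq> {..<m}"
begin

lemma row_sel_carrier [simp]: "row_sel m I \<in> carrier_mat (card I) m"
  by (simp add: row_sel_def)

lemma row_sel_dim [simp]: "dim_row (row_sel m I) = card I" "dim_col (row_sel m I) = m"
  by (simp_all add: row_sel_def)

lemma pick_less: "a < card I \<Longrightarrow> pick I a < m" "a < card I \<Longrightarrow> pick I a \<in> I"
  using I pick_in_set[of a I] by auto

lemma card_index_set: "card {i. i < m \<and> i \<in> I} = card I"
  using I by (metis (no_types, lifting) Collect_cong Collect_mem_eq lessThan_iff subsetD)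

lemma row_sel_mult_index:
  assumes "A \<in> carrier_mat m r" "a < card I" "j < r"
  shows "(row_sel m I * A) $$ (a, j) = A $$ (pick I a, j)"
proof -
  have "(row_sel m I * A) $$ (a, j) = (\<Sum>b<m. (if b = pick I a then 1 else 0) * A $$ (b, j))"
    using assms by (auto simp: row_sel_def scalar_prod_def atLeast0LessThan intro!: sum.cong)
  also have "\<dots> = (\<Sum>b<m. if b = pick I a then A $$ (b, j) else 0)"
    by (rule sum.cong) auto
  finally show ?thesis using pick_less[OF assms(2)] by simp
qed

lemma submatrix_rows: "A \<in> carrier_mat m r \<Longrightarrow> submatrix A I UNIV = row_sel m I * A"
  by (rule eq_matI)
    (auto simp: submatrix_def card_index_set pick_UNIV row_sel_mult_index simp del: index_mult_mat(1))

lemma submatrix_cols: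
  assumes "A \<in> carrier_mat r m"
  shows "submatrix A UNIV I = A * mat_adjoint (row_sel m I)"
proof (rule eq_matI)
  fix i j assume "i < dim_row (A * mat_adjoint (row_sel m I))" "j < dim_col (A * mat_adjoint (row_sel m I))"
  then have ij: "i < r" "j < card I" using assms by auto
  have "(A * mat_adjoint (row_sel m I)) $$ (i, j) = (\<Sum>b<m. A $$ (i, b) * (if b = pick I j then 1 else 0))"
    using assms ij by (auto simp: row_sel_def scalar_prod_def atLeast0LessThan intro!: sum.cong)
  also have "\<dots> = (\<Sum>b<m. if b = pick I j then A $$ (i, b) else 0)"
    by (rule sum.cong) auto
  also have "\<dots> = A $$ (i, pick I j)" using pick_less[OF ij(2)] by simp
  finally show "submatrix A UNIV I $$ (i, j) = (A * mat_adjoint (row_sel m I)) $$ (i, j)"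
    using assms ij by (simp add: submatrix_def card_index_set pick_UNIV)
qed (use assms in \<open>auto simp: submatrix_def card_index_set\<close>)

lemma op_bounded_row_sel: "op_bounded (row_sel m I) 1" "op_bounded (mat_adjoint (row_sel m I)) 1"
proof -
  let ?S = "mat_adjoint (row_sel m I)"
  have fin: "finite I" using I finite_subset by blast
  have "row_sel m I * ?S = 1\<^sub>m (card I)"
  proof (rule eq_matI)
    fix i j assume "i < dim_row (1\<^sub>m (card I))" "j < dim_col (1\<^sub>m (card I))"
    then have ij: "i < card I" "j < card I" by auto
    have "(row_sel m I * ?S) $$ (i, j) = ?S $$ (pick I i, j)"
      using ij by (intro row_sel_mult_index[of _ "card I"]) auto
    also have "\<dots> = (if pick I i = pick I j then 1 else 0)"
      using ij pick_less by (simp add: row_sel_def)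
    also have "\<dots> = 1\<^sub>m (card I) $$ (i, j)"
      using ij bij_betw_pick[OF fin] by (auto simp: bij_betw_def inj_on_eq_iff)
    finally show "(row_sel m I * ?S) $$ (i, j) = 1\<^sub>m (card I) $$ (i, j)" .
  qed auto
  then show S: "op_bounded ?S 1"
    by (intro op_bounded_isometry[of _ m "card I"]) auto
  then show "op_bounded (row_sel m I) 1"
    using op_bounded_adjoint[OF S, of m "card I"] by simp
qed

lemma gram_submatrix_index:
  assumes W: "W \<in> carrier_mat m k" and "a < k" "b < k"
  shows "(mat_adjoint (submatrix W I UNIV) * submatrix W I UNIV) $$ (a, b) =
    (\<Sum>i\<in>I. cnj (W $$ (i, a)) * W $$ (i, b))"
proof -
  have fin: "finite I" using I finite_subset by blast
  have "(mat_adjoint (submatrix W I UNIV) * submatrix W I UNIV) $$ (a, b) =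
    (\<Sum>c<card I. cnj (W $$ (pick I c, a)) * W $$ (pick I c, b))"
    using assms by (auto simp: submatrix_def card_index_set pick_UNIV scalar_prod_def
        atLeast0LessThan intro!: sum.cong)
  also have "\<dots> = (\<Sum>i\<in>I. cnj (W $$ (i, a)) * W $$ (i, b))"
    by (rule sum.reindex_bij_betw[OF bij_betw_pick[OF fin]])
  finally show ?thesis .
qed

lemma vnorm_submatrix_mult:
  assumes W: "W \<in> carrier_mat m k" and x: "x \<in> carrier_vec k"
  shows "(vnorm (submatrix W I UNIV *\<^sub>v x))\<^sup>2 = (\<Sum>i\<in>I. (cmod ((W *\<^sub>v x) $ i))\<^sup>2)"
proof -
  have fin: "finite I" using I finite_subset by blast
  have "(vnorm (submatrix W I UNIV *\<^sub>v x))\<^sup>2 = (\<Sum>c<card I. (cmod ((W *\<^sub>v x) $ pick I c))\<^sup>2)"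
  proof -
    have "(submatrix W I UNIV *\<^sub>v x) $ c = (W *\<^sub>v x) $ pick I c" if "c < card I" for c
      using W x that pick_less[OF that]
      by (auto simp: submatrix_def card_index_set pick_UNIV scalar_prod_def intro!: sum.cong)
    then show ?thesis
      using W by (simp add: vnorm_sq submatrix_def card_index_set del: index_mult_mat_vec)
  qed
  also have "\<dots> = (\<Sum>i\<in>I. (cmod ((W *\<^sub>v x) $ i))\<^sup>2)"
    by (rule sum.reindex_bij_betw[OF bij_betw_pick[OF fin]])
  finally show ?thesis .
qed

end

lemma sum_trace_mult:
  fixes X Y :: "complex mat"
  assumes "X \<in> carrier_mat p q" "Y \<in> carrier_mat q p"
  shows "(\<Sum>i<p. (X * Y) $$ (i, i)) = (\<Sum>j<q. (Y * X) $$ (j, j))"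
proof -
  have "(\<Sum>i<p. (X * Y) $$ (i, i)) = (\<Sum>i<p. \<Sum>j<q. X $$ (i, j) * Y $$ (j, i))"
    using assms by (auto simp: scalar_prod_def atLeast0LessThan intro!: sum.cong)
  also have "\<dots> = (\<Sum>j<q. \<Sum>i<p. X $$ (i, j) * Y $$ (j, i))" by (rule sum.swap)
  also have "\<dots> = (\<Sum>j<q. (Y * X) $$ (j, j))"
    using assms by (auto simp: scalar_prod_def atLeast0LessThan mult.commute intro!: sum.cong)
  finally show ?thesis .
qed

lemma mult_mat_vec_sum:
  fixes A :: "complex mat"
  assumes "A \<in> carrier_mat p q" "v \<in> carrier_vec q" "i < p"
  shows "(A *\<^sub>v v) $ i = (\<Sum>j<q. A $$ (i, j) * v $ j)"
  using assms by (auto simp: scalar_prod_def atLeast0LessThan intro!: sum.cong)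

lemma sum_if_subset:
  fixes f :: "nat \<Rightarrow> 'a::comm_monoid_add"
  assumes "I \<subseteq> {..<m}"
  shows "(\<Sum>i<m. if i \<in> I then f i else 0) = sum f I"
  using assms by (simp add: sum.If_cases Int_absorb1)

lemma submatrix_rows_carrier:
  "I \<subseteq> {..<m} \<Longrightarrow> A \<in> carrier_mat m r \<Longrightarrow> submatrix A I UNIV \<in> carrier_mat (card I) r"
  by (intro carrier_matI) (simp_all add: dim_submatrix card_index_set)

lemma det_2x2:
  fixes M :: "complex mat"
  assumes M: "M \<in> carrier_mat 2 2"
  shows "det M = M $$ (0, 0) * M $$ (1, 1) - M $$ (0, 1) * M $$ (1, 0)"
proof -
  let ?m = "\<lambda>i j. mat 1 1 (\<lambda>_. M $$ (i, j))"
  have "M = four_block_mat (?m 0 0) (?m 0 1) (?m 1 0) (?m 1 1)"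
  proof (rule eq_matI)
    fix i j assume "i < dim_row (four_block_mat (?m 0 0) (?m 0 1) (?m 1 0) (?m 1 1))"
      "j < dim_col (four_block_mat (?m 0 0) (?m 0 1) (?m 1 0) (?m 1 1))"
    then have "i < 2" "j < 2" by auto
    then show "M $$ (i, j) = four_block_mat (?m 0 0) (?m 0 1) (?m 1 0) (?m 1 1) $$ (i, j)"
      by (auto simp: less_2_cases_iff)
  qed (use M in auto)
  moreover have "det (four_block_mat (?m 0 0) (?m 0 1) (?m 1 0) (?m 1 1)) =
      det (?m 0 0 * ?m 1 1 - ?m 0 1 * ?m 1 0)"
    by (rule det_four_block_mat[of _ 1]) (auto simp: scalar_prod_def intro!: eq_matI)
  ultimately have "det M = det (?m 0 0 * ?m 1 1 - ?m 0 1 * ?m 1 0)" by simp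
  also have "\<dots> = (?m 0 0 * ?m 1 1 - ?m 0 1 * ?m 1 0) $$ (0, 0)"
    by (rule det_single) (auto intro!: carrier_matI)
  finally show ?thesis by (simp add: scalar_prod_def)
qed

text \<open>Exchanging row \<open>i \<in> I\<close> for row \<open>j\<close> multiplies the Gram determinant by
  \<open>(1 - T i i) (1 + T j j) + |T j i|\<^sup>2\<close>, which is at most 1 by maximality. Summing over \<open>i\<close>, with
  the trace of \<open>T\<close> over \<open>I\<close> equal to \<open>k\<close> and \<open>T j j\<close> the sum of all \<open>|T j i|\<^sup>2\<close>, gives the bound.\<close>

lemma max_volume_rows_leverage:
  assumes W: "W \<in> carrier_mat m k" and I: "I \<subseteq> {..<m}"
    and pos: "\<And>i. i < k \<Longrightarrow> 0 < sv (submatrix W I UNIV) i"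
    and max: "max_volume_rows W I"
    and j: "j < m" "j \<notin> I" and kl: "k \<le> card I"
    and H: "H \<in> carrier_mat k k" "mat_adjoint H = H"
      "H * (mat_adjoint (submatrix W I UNIV) * submatrix W I UNIV) = 1\<^sub>m k"
      "(mat_adjoint (submatrix W I UNIV) * submatrix W I UNIV) * H = 1\<^sub>m k"
  defines "T \<equiv> W * H * mat_adjoint W"
  shows "(\<Sum>i\<in>I. (cmod (T $$ (j, i)))\<^sup>2) * (real (card I) - real k + 1) \<le> real k"
proof -
  let ?B = "submatrix W I UNIV"
  let ?G = "mat_adjoint ?B * ?B"
  have fin: "finite I" using I finite_subset by blast
  have Wa: "mat_adjoint W \<in> carrier_mat k m" using W by auto
  have T: "T \<in> carrier_mat m m" using W H by (auto simp: T_def)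
  have Ta: "mat_adjoint T = T"
    unfolding T_def using W H(1,2) by (simp add: mat_adjoint_mult mat_mult_assoc)
  have Tsym: "T $$ (a, b) = cnj (T $$ (b, a))" if "a < m" "b < m" for a b
    using Ta T that by (metis carrier_matD index_mat_adjoint)
  have B: "?B \<in> carrier_mat (card I) k"
    using W by (simp add: submatrix_rows_carrier[OF I])
  have G: "?G \<in> carrier_mat k k" using B by auto
  define P where "P = rdiag m m (\<lambda>i. if i \<in> I then 1 else 0)"
  have P: "P \<in> carrier_mat m m" by (simp add: P_def)
  have Gindex: "?G $$ (a, b) = (\<Sum>i\<in>I. cnj (W $$ (i, a)) * W $$ (i, b))" if "a < k" "b < k" for a b
    using gram_submatrix_index[OF I W] that by simp
  have PX: "(P * X) $$ (i, b) = (if i \<in> I then X $$ (i, b) else 0)"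
    if "i < m" "b < c" "X \<in> carrier_mat m c" for i b c X
  proof -
    have "(P * X) $$ (i, b) = (P *\<^sub>v col X b) $ i"
      using that P by simp
    also have "\<dots> = (if i \<in> I then X $$ (i, b) else 0)"
      unfolding P_def using that by (subst rdiag_mult_vec) auto
    finally show ?thesis .
  qed
  have WPW: "mat_adjoint W * (P * W) = ?G"
  proof (rule eq_matI)
    fix a b assume "a < dim_row ?G" "b < dim_col ?G"
    then have ab: "a < k" "b < k" using B by auto
    have "(mat_adjoint W * (P * W)) $$ (a, b) = (\<Sum>i<m. cnj (W $$ (i, a)) * (P * W) $$ (i, b))"
      using ab W P by (auto simp: scalar_prod_def atLeast0LessThan simp del: index_mult_mat(1)
          intro!: sum.cong simp: times_mat_def)
    also have "\<dots> = (\<Sum>i<m. if i \<in> I then cnj (W $$ (i, a)) * W $$ (i, b) else 0)"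
      using PX[OF _ ab(2) W] by (intro sum.cong) auto
    finally show "(mat_adjoint W * (P * W)) $$ (a, b) = ?G $$ (a, b)"
      unfolding sum_if_subset[OF I] Gindex[OF ab] .
  qed (use W B P in auto)
  have TPT: "T * (P * T) = T"
  proof -
    have "T * (P * T) = W * H * (mat_adjoint W * (P * W)) * (H * mat_adjoint W)"
      unfolding T_def using W H(1) P by (simp add: mat_mult_assoc)
    also have "\<dots> = W * (H * ?G) * (H * mat_adjoint W)"
      unfolding WPW using W H(1) B by (simp add: mat_mult_assoc)
    also have "\<dots> = T"
      unfolding H(3) T_def using W H(1) by (simp add: mat_mult_assoc)
    finally show ?thesis .
  qed
  have tr: "(\<Sum>i\<in>I. T $$ (i, i)) = of_nat k"
  proof -
    have "(\<Sum>i\<in>I. T $$ (i, i)) = (\<Sum>i<m. (P * T) $$ (i, i))"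
      unfolding sum_if_subset[OF I, symmetric] using PX[OF _ _ T] by (intro sum.cong) auto
    also have "P * T = (P * W * H) * mat_adjoint W"
      unfolding T_def using W H(1) P by (simp add: mat_mult_assoc)
    also have "(\<Sum>i<m. ((P * W * H) * mat_adjoint W) $$ (i, i)) =
        (\<Sum>a<k. (mat_adjoint W * (P * W * H)) $$ (a, a))"
      using W H P by (intro sum_trace_mult) auto
    also have "mat_adjoint W * (P * W * H) = (mat_adjoint W * (P * W)) * H"
      using W H(1) P by (simp add: mat_mult_assoc)
    also have "\<dots> = 1\<^sub>m k" unfolding WPW by (rule H(4))
    finally show ?thesis by simp
  qed
  let ?l = "\<Sum>i\<in>I. (cmod (T $$ (j, i)))\<^sup>2"
  have Tjj: "T $$ (j, j) = of_real ?l"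
  proof -
    have "T $$ (j, j) = (T * (P * T)) $$ (j, j)" unfolding TPT ..
    also have "\<dots> = (\<Sum>i<m. T $$ (j, i) * (P * T) $$ (i, j))"
      using T P j by (auto simp: scalar_prod_def atLeast0LessThan simp del: index_mult_mat(1)
          intro!: sum.cong simp: times_mat_def)
    also have "\<dots> = (\<Sum>i<m. if i \<in> I then of_real ((cmod (T $$ (j, i)))\<^sup>2) else 0)"
    proof (rule sum.cong)
      fix i assume "i \<in> {..<m}"
      then have i: "i < m" by simp
      show "T $$ (j, i) * (P * T) $$ (i, j) = (if i \<in> I then of_real ((cmod (T $$ (j, i)))\<^sup>2) else 0)"
        unfolding PX[OF i j(1) T] using Tsym[OF i j(1)] by (simp add: complex_norm_square del: of_real_power)
    qed simp
    finally show ?thesis unfolding sum_if_subset[OF I] by simp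
  qed
  have detG: "det ?G = of_real ((volume ?B)\<^sup>2)" using det_gram[OF B kl] .
  have "det ?G * det H = 1" using det_mult[OF G H(1)] H(4) by simp
  then have vpos: "0 < (volume ?B)\<^sup>2" using detG by (cases "volume ?B = 0") auto
  have swap: "(1 - Re (T $$ (i, i))) * (1 + ?l) + (cmod (T $$ (j, i)))\<^sup>2 \<le> 1" if i: "i \<in> I" for i
  proof -
    have im: "i < m" using i I by auto
    define I' where "I' = insert j (I - {i})"
    have I': "I' \<subseteq> {..<m}" "card I' = card I"
      using I j i fin card_Suc_Diff1[OF fin i] by (auto simp: I'_def)
    let ?B' = "submatrix W I' UNIV"
    have B': "?B' \<in> carrier_mat (card I) k"
      using submatrix_rows_carrier[OF I'(1) W] I'(2) by simp
    have vol: "volume ?B' \<le> volume ?B"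
      using max I' W unfolding max_volume_rows_def by auto
    have v0: "0 \<le> volume ?B'" unfolding volume_def
    proof (rule prod_nonneg)
      fix a show "0 \<le> singular_value ?B' a" if "a \<in> {1..min (dim_row ?B') (dim_col ?B')}"
        using that sv_nonneg[of ?B' "a - 1"] by simp
    qed
    define L where "L = mat 2 k (\<lambda>(a, b). if a = 0 then W $$ (i, b) else W $$ (j, b))"
    define R where "R = mat k 2 (\<lambda>(b, a). if a = 0 then - cnj (W $$ (i, b)) else cnj (W $$ (j, b)))"
    have L: "L \<in> carrier_mat 2 k" and R: "R \<in> carrier_mat k 2" by (simp_all add: L_def R_def)
    have G': "mat_adjoint ?B' * ?B' = ?G + R * L"
    proof (rule eq_matI)
      fix a b assume "a < dim_row (?G + R * L)" "b < dim_col (?G + R * L)"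
      then have ab: "a < k" "b < k" using R L by auto
      have "(mat_adjoint ?B' * ?B') $$ (a, b) = (\<Sum>i\<in>I'. cnj (W $$ (i, a)) * W $$ (i, b))"
        using gram_submatrix_index[OF I'(1) W] ab by simp
      also have "\<dots> = cnj (W $$ (j, a)) * W $$ (j, b) + (\<Sum>i\<in>I - {i}. cnj (W $$ (i, a)) * W $$ (i, b))"
        unfolding I'_def using fin j by (subst sum.insert) auto
      also have "(\<Sum>i\<in>I - {i}. cnj (W $$ (i, a)) * W $$ (i, b)) = ?G $$ (a, b) - cnj (W $$ (i, a)) * W $$ (i, b)"
        unfolding Gindex[OF ab] using fin i by (simp add: sum_diff1)
      also have "cnj (W $$ (j, a)) * W $$ (j, b) + (?G $$ (a, b) - cnj (W $$ (i, a)) * W $$ (i, b)) =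
          (?G + R * L) $$ (a, b)"
        using ab L R G by (simp add: L_def R_def scalar_prod_def numeral_2_eq_2 del: index_mult_mat(1))
          (simp add: scalar_prod_def numeral_2_eq_2)
      finally show "(mat_adjoint ?B' * ?B') $$ (a, b) = (?G + R * L) $$ (a, b)" .
    qed (use B' R L in auto)
    have "?G * (1\<^sub>m k + (H * R) * L) = ?G * 1\<^sub>m k + (?G * H) * (R * L)"
      using G H(1) R L B by (simp add: mat_mult_distribs mat_mult_assoc)
    also have "\<dots> = ?G + R * L"
      unfolding H(4) right_mult_one_mat[OF G] using R L by simp
    finally have "det (mat_adjoint ?B' * ?B') = det ?G * det (1\<^sub>m k + (H * R) * L)"
      using det_mult[OF G, of "1\<^sub>m k + (H * R) * L"] G' H R L by simp
    also have "det (1\<^sub>m k + (H * R) * L) = det (1\<^sub>m 2 + L * (H * R))"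
      using H R L by (intro det_one_plus_mult) auto
    finally have "of_real ((volume ?B')\<^sup>2) = of_real ((volume ?B)\<^sup>2) * det (1\<^sub>m 2 + L * (H * R))"
      using det_gram[OF B' kl] detG by simp
    then have rho: "det (1\<^sub>m 2 + L * (H * R)) = of_real ((volume ?B')\<^sup>2 / (volume ?B)\<^sup>2)"
      using vpos by (simp add: field_simps)
    have entry: "(L * (H * R)) $$ (a, b) =
        (if b = 0 then - 1 else 1) * T $$ (if a = 0 then i else j, if b = 0 then i else j)"
      if ab: "a < 2" "b < 2" for a b
    proof -
      let ?a = "if a = 0 then i else j" and ?b = "if b = 0 then i else j"
      let ?s = "if b = 0 then - 1 else 1 :: complex"
      have mb: "?a < m" "?b < m" using im j by auto
      have r: "row L a = row W ?a" using ab mb W by (intro eq_vecI) (auto simp: L_def)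
      have c: "col R b = ?s \<cdot>\<^sub>v col (mat_adjoint W) ?b"
        using ab mb W by (intro eq_vecI) (auto simp: R_def)
      have "(L * (H * R)) $$ (a, b) = row L a \<bullet> col (H * R) b"
        using ab L R by (intro index_mult_mat(1)) auto
      also have "col (H * R) b = H *\<^sub>v col R b" by (rule col_mult2[OF H(1) R ab(2)])
      also have "H *\<^sub>v col R b = ?s \<cdot>\<^sub>v (H *\<^sub>v col (mat_adjoint W) ?b)"
        unfolding c using H(1) W by (intro mat_mult_vec_smult) auto
      also have "row L a \<bullet> (?s \<cdot>\<^sub>v (H *\<^sub>v col (mat_adjoint W) ?b)) =
          ?s * (row W ?a \<bullet> (H *\<^sub>v col (mat_adjoint W) ?b))"
        unfolding r using W H(1) mb by (intro scalar_prod_smult_distrib[of _ k]) auto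
      also have "row W ?a \<bullet> (H *\<^sub>v col (mat_adjoint W) ?b) = (W * (H * mat_adjoint W)) $$ (?a, ?b)"
        unfolding col_mult2[OF H(1) Wa mb(2), symmetric]
        using mb W H(1) by (intro index_mult_mat(1)[symmetric]) auto
      also have "W * (H * mat_adjoint W) = T" unfolding T_def using W H(1) by (simp add: mat_mult_assoc)
      finally show ?thesis .
    qed
    let ?M = "1\<^sub>m 2 + L * (H * R)"
    have M: "?M \<in> carrier_mat 2 2" using L H R by auto
    have "det ?M = ?M $$ (0, 0) * ?M $$ (1, 1) - ?M $$ (0, 1) * ?M $$ (1, 0)"
      using det_2x2[OF M] by simp
    also have "\<dots> = (1 - T $$ (i, i)) * (1 + T $$ (j, j)) + T $$ (i, j) * T $$ (j, i)"
      using L H R by (simp add: entry del: index_mult_mat(1))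
    also have "T $$ (i, j) * T $$ (j, i) = of_real ((cmod (T $$ (j, i)))\<^sup>2)"
      using Tsym[OF im j(1)] by (simp add: complex_norm_square mult.commute del: of_real_power)
    finally have "Re (det ?M) = (1 - Re (T $$ (i, i))) * (1 + ?l) + (cmod (T $$ (j, i)))\<^sup>2"
      unfolding Tjj by (simp del: of_real_power of_real_sum)
    moreover have "Re (det ?M) \<le> 1"
      unfolding rho using vol v0 vpos by (simp add: power_mono)
    ultimately show ?thesis by simp
  qed
  have retr: "(\<Sum>i\<in>I. Re (T $$ (i, i))) = real k"
    using arg_cong[OF tr, of Re] by simp
  have "(\<Sum>i\<in>I. (1 - Re (T $$ (i, i))) * (1 + ?l) + (cmod (T $$ (j, i)))\<^sup>2) \<le> (\<Sum>i\<in>I. 1)"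
    by (rule sum_mono) (rule swap)
  also have "(\<Sum>i\<in>I. (1 - Re (T $$ (i, i))) * (1 + ?l) + (cmod (T $$ (j, i)))\<^sup>2) =
      (real (card I) - real k) * (1 + ?l) + ?l"
    by (simp only: sum.distrib sum_distrib_right[symmetric] sum_subtractf retr) simp
  finally show "?l * (real (card I) - real k + 1) \<le> real k" by (simp add: algebra_simps)
qed

lemma max_volume_rows_lower_bound:
  assumes W: "W \<in> carrier_mat m k" "mat_adjoint W * W = 1\<^sub>m k" and I: "I \<subseteq> {..<m}"
    and k: "1 \<le> k" and pos: "0 < sv (submatrix W I UNIV) (k - 1)"
    and max: "max_volume_rows W I" and x: "x \<in> carrier_vec k"
  shows "vnorm x \<le> t_const k m (card I) * vnorm (submatrix W I UNIV *\<^sub>v x)"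
    and "1 \<le> t_const k m (card I)" and "k \<le> card I"
proof -
  let ?B = "submatrix W I UNIV"
  have fin: "finite I" using I finite_subset by blast
  have B: "?B \<in> carrier_mat (card I) k"
    using W by (simp add: submatrix_rows_carrier[OF I])
  show kl: "k \<le> card I"
  proof (rule ccontr)
    assume "\<not> k \<le> card I"
    then have "sv ?B (k - 1) = 0" using B k by (intro sv_eq_0) auto
    then show False using pos by simp
  qed
  have lm: "card I \<le> m" using card_mono[of "{..<m}" I] I by simp
  define c where "c = real (card I) - real k + 1"
  have c: "0 < c" using kl by (simp add: c_def)
  have tsq: "(t_const k m (card I))\<^sup>2 = 1 + real k * (real m - real (card I)) / c"
    unfolding t_const_def c_def[symmetric] using c lm by (intro real_sqrt_pow2) simp
  show t1: "1 \<le> t_const k m (card I)"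
    unfolding t_const_def c_def[symmetric] using c lm by simp
  have pos': "0 < sv ?B i" if "i < k" for i
    using sv_antimono[of i "k - 1" ?B] pos that by linarith
  obtain H where H: "H \<in> carrier_mat k k" "mat_adjoint H = H"
    "H * (mat_adjoint ?B * ?B) = 1\<^sub>m k" "(mat_adjoint ?B * ?B) * H = 1\<^sub>m k"
    using gram_inverse[OF B pos'] by blast
  define T where "T = W * H * mat_adjoint W"
  have T: "T \<in> carrier_mat m m" using W H by (auto simp: T_def)
  define y where "y = W *\<^sub>v x"
  have y: "y \<in> carrier_vec m" using W x by (simp add: y_def)
  let ?g = "\<Sum>i\<in>I. (cmod (y $ i))\<^sup>2"
  have g: "(vnorm (?B *\<^sub>v x))\<^sup>2 = ?g" using vnorm_submatrix_mult[OF I W(1) x] by (simp add: y_def)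
  have row: "(cmod (y $ j))\<^sup>2 \<le> real k / c * ?g" if j: "j < m" "j \<notin> I" for j
  proof -
    let ?l = "\<Sum>i\<in>I. (cmod (T $$ (j, i)))\<^sup>2"
    have lev: "?l * c \<le> real k"
      using max_volume_rows_leverage[OF W(1) I pos' max j kl H] by (simp add: T_def c_def)
    define D where "D = rdiag m m (\<lambda>i. if i \<in> I then 1 else 0)"
    have Dy: "(D *\<^sub>v y) $ i = (if i \<in> I then y $ i else 0)" if "i < m" for i
      unfolding D_def using rdiag_mult_vec[OF y that] that by simp
    have D: "D \<in> carrier_mat m m" by (simp add: D_def)
    have "mat_adjoint W *\<^sub>v (D *\<^sub>v y) = (mat_adjoint ?B * ?B) *\<^sub>v x"
    proof (rule eq_vecI)
      fix a assume "a < dim_vec ((mat_adjoint ?B * ?B) *\<^sub>v x)"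
      then have a: "a < k" using B by simp
      have "(mat_adjoint W *\<^sub>v (D *\<^sub>v y)) $ a = (\<Sum>i<m. cnj (W $$ (i, a)) * (D *\<^sub>v y) $ i)"
        using a W(1) D y
        by (subst mult_mat_vec_sum[OF mat_adjoint_carrier[OF W(1)] mult_mat_vec_carrier[OF D y] a])
          (auto simp del: index_mult_mat_vec intro!: sum.cong)
      also have "\<dots> = (\<Sum>i<m. if i \<in> I then cnj (W $$ (i, a)) * y $ i else 0)"
        using Dy by (intro sum.cong) auto
      also have "\<dots> = (\<Sum>i\<in>I. cnj (W $$ (i, a)) * y $ i)" by (rule sum_if_subset[OF I])
      also have "\<dots> = (\<Sum>i\<in>I. \<Sum>b<k. cnj (W $$ (i, a)) * W $$ (i, b) * x $ b)"
        using I W(1) x unfolding y_def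
        by (auto simp: scalar_prod_def atLeast0LessThan sum_distrib_left ac_simps intro!: sum.cong)
      also have "\<dots> = (\<Sum>b<k. \<Sum>i\<in>I. cnj (W $$ (i, a)) * W $$ (i, b) * x $ b)" by (rule sum.swap)
      also have "\<dots> = (\<Sum>b<k. (mat_adjoint ?B * ?B) $$ (a, b) * x $ b)"
        using gram_submatrix_index[OF I W(1) a] by (intro sum.cong) (auto simp: sum_distrib_right)
      also have "\<dots> = ((mat_adjoint ?B * ?B) *\<^sub>v x) $ a"
        using B by (intro mult_mat_vec_sum[OF _ x a, symmetric]) auto
      finally show "(mat_adjoint W *\<^sub>v (D *\<^sub>v y)) $ a = ((mat_adjoint ?B * ?B) *\<^sub>v x) $ a" .
    qed (use W B in auto)
    then have "T *\<^sub>v (D *\<^sub>v y) = W *\<^sub>v ((H * (mat_adjoint ?B * ?B)) *\<^sub>v x)"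
      unfolding T_def using W(1) H(1) D y x B by (simp add: mat_mult_vec_assoc del: assoc_mult_mat_vec)
    also have "\<dots> = y" unfolding H(3) using x by (simp add: y_def)
    finally have "y $ j = (T *\<^sub>v (D *\<^sub>v y)) $ j" by simp
    also have "\<dots> = (\<Sum>i<m. T $$ (j, i) * (D *\<^sub>v y) $ i)"
      using mult_mat_vec_sum[OF T mult_mat_vec_carrier[OF D y] j(1)] .
    also have "\<dots> = (\<Sum>i<m. if i \<in> I then T $$ (j, i) * y $ i else 0)"
      using Dy by (intro sum.cong) auto
    also have "\<dots> = (\<Sum>i\<in>I. T $$ (j, i) * y $ i)" by (rule sum_if_subset[OF I])
    finally have "cmod (y $ j) \<le> (\<Sum>i\<in>I. \<bar>cmod (T $$ (j, i))\<bar> * \<bar>cmod (y $ i)\<bar>)"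
      by (auto simp: norm_mult intro!: sum_norm_le)
    also have "\<dots> \<le> L2_set (\<lambda>i. cmod (T $$ (j, i))) I * L2_set (\<lambda>i. cmod (y $ i)) I"
      by (rule L2_set_mult_ineq)
    finally have "(cmod (y $ j))\<^sup>2 \<le> (L2_set (\<lambda>i. cmod (T $$ (j, i))) I * L2_set (\<lambda>i. cmod (y $ i)) I)\<^sup>2"
      by (intro power_mono) auto
    also have "\<dots> = ?l * ?g"
      by (simp add: L2_set_def power_mult_distrib sum_nonneg)
    also have "\<dots> \<le> real k / c * ?g"
      using lev c by (intro mult_right_mono) (auto simp: field_simps sum_nonneg)
    finally show ?thesis .
  qed
  have "(vnorm x)\<^sup>2 = (vnorm y)\<^sup>2" using isometry_vnorm[OF W x] by (simp add: y_def)
  also have "\<dots> = (\<Sum>i<m. (cmod (y $ i))\<^sup>2)" using y by (simp add: vnorm_sq)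
  also have "\<dots> = ?g + (\<Sum>j\<in>{..<m} - I. (cmod (y $ j))\<^sup>2)"
    using sum.subset_diff[OF I, of "\<lambda>i. (cmod (y $ i))\<^sup>2"] by simp
  also have "\<dots> \<le> ?g + (\<Sum>j\<in>{..<m} - I. real k / c * ?g)"
    using row by (intro add_left_mono sum_mono) auto
  also have "\<dots> = ?g + (real m - real (card I)) * (real k / c * ?g)"
    using I fin lm by (simp add: card_Diff_subset of_nat_diff)
  also have "\<dots> = (t_const k m (card I) * vnorm (?B *\<^sub>v x))\<^sup>2"
    unfolding power_mult_distrib g tsq by (simp add: algebra_simps)
  finally show "vnorm x \<le> t_const k m (card I) * vnorm (?B *\<^sub>v x)"
    by (rule power2_le_imp_le) (use t1 in auto)
qed

lemma left_factor_exists: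
  assumes W: "W \<in> carrier_mat m k" "mat_adjoint W * W = 1\<^sub>m k"
    and B: "B \<in> carrier_mat l k" and pos: "\<And>i. i < k \<Longrightarrow> 0 < sv B i" and t: "0 \<le> t"
    and le: "\<And>x. x \<in> carrier_vec k \<Longrightarrow> vnorm x \<le> t * vnorm (B *\<^sub>v x)"
  obtains L where "L \<in> carrier_mat m l" "L * B = W" "op_bounded L t"
proof -
  obtain H where H: "H \<in> carrier_mat k k" "mat_adjoint H = H"
    "H * (mat_adjoint B * B) = 1\<^sub>m k" "(mat_adjoint B * B) * H = 1\<^sub>m k"
    using gram_inverse[OF B pos] by blast
  define X where "X = H * mat_adjoint B"
  have Ba: "mat_adjoint B \<in> carrier_mat k l" using B by auto
  have X: "X \<in> carrier_mat k l" using H(1) Ba by (simp add: X_def)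
  have XB: "X * B = 1\<^sub>m k" unfolding X_def using H(1) B H(3) by (simp add: mat_mult_assoc)
  have "op_bounded X t"
  proof (rule op_boundedI[OF X])
    fix y :: "complex vec" assume y: "y \<in> carrier_vec l"
    let ?x = "X *\<^sub>v y"
    have x: "?x \<in> carrier_vec k" using X y by auto
    have Bx: "B *\<^sub>v ?x \<in> carrier_vec l" using B x by auto
    have "(vnorm (B *\<^sub>v ?x))\<^sup>2 = cmod ((B *\<^sub>v ?x) \<bullet>c (B *\<^sub>v ?x))"
      by (simp add: cscalar_prod_self norm_power)
    also have "(B *\<^sub>v ?x) \<bullet>c (B *\<^sub>v ?x) = ?x \<bullet>c (mat_adjoint B *\<^sub>v (B *\<^sub>v ?x))"
      by (rule cscalar_prod_mult_left[OF B x Bx])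
    also have "mat_adjoint B *\<^sub>v (B *\<^sub>v ?x) = (mat_adjoint B * B * H) *\<^sub>v (mat_adjoint B *\<^sub>v y)"
      unfolding X_def using B H(1) y by (simp add: mat_mult_vec_assoc)
    also have "\<dots> = mat_adjoint B *\<^sub>v y"
      unfolding H(4) by (rule one_mult_mat_vec, rule mult_mat_vec_carrier[OF Ba y])
    also have "?x \<bullet>c (mat_adjoint B *\<^sub>v y) = (B *\<^sub>v ?x) \<bullet>c y"
      by (rule cscalar_prod_mult_left[OF B x y, symmetric])
    also have "cmod \<dots> \<le> vnorm (B *\<^sub>v ?x) * vnorm y" by (rule cscalar_prod_le[OF Bx y])
    finally have "vnorm (B *\<^sub>v ?x) * vnorm (B *\<^sub>v ?x) \<le> vnorm (B *\<^sub>v ?x) * vnorm y"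
      by (simp add: power2_eq_square)
    then have "vnorm (B *\<^sub>v ?x) \<le> vnorm y"
      by (metis mult_le_cancel_left order_le_less vnorm_nonneg)
    then have "t * vnorm (B *\<^sub>v ?x) \<le> t * vnorm y" using t by (rule mult_left_mono)
    then show "vnorm ?x \<le> t * vnorm y" using le[OF x] by linarith
  qed
  then have "op_bounded (W * X) (1 * t)"
    by (intro op_bounded_mult[OF op_bounded_isometry[OF W] _ W(1) X]) auto
  moreover have "W * X * B = W" using W(1) X B XB by (simp add: mat_mult_assoc)
  moreover have "W * X \<in> carrier_mat m l" using W(1) X by auto
  ultimately show ?thesis using that by simp
qed

section \<open>Perturbation bounds\<close>

context sv_norm
begin

lemma N_minus_commute:
  assumes "B \<in> mats_over K p q" "D \<in> mats_over K p q" "0 < p" "0 < q"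
  shows "N (B - D) = N (D - B)"
proof -
  have "- 1 \<in> K" using real_mem[of "- 1"] by simp
  from N_smult[OF this minus_over[OF assms(2,1)] assms(3,4)]
  have "N (- 1 \<cdot>\<^sub>m (D - B)) = N (D - B)" by simp
  moreover have "- 1 \<cdot>\<^sub>m (D - B) = B - D"
    using assms(1,2)[THEN mats_overD] by (intro eq_matI) auto
  ultimately show ?thesis by simp
qed

lemma N_diff:
  assumes "B \<in> mats_over K p q" "D \<in> mats_over K p q" "0 < p" "0 < q"
  shows "N (B - D) \<le> N B + N D"
proof -
  have z: "0\<^sub>m p q \<in> mats_over K p q"
    using minus_over[OF assms(1,1)] mats_overD[OF assms(1)] by simp
  have "N (B + (0\<^sub>m p q - D)) \<le> N B + N (0\<^sub>m p q - D)"
    using assms z by (intro N_triangle minus_over)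
  also have "N (0\<^sub>m p q - D) = N (D - 0\<^sub>m p q)" by (rule N_minus_commute[OF z assms(2-4)])
  also have "D - 0\<^sub>m p q = D" using mats_overD[OF assms(2)] by (intro eq_matI) auto
  also have "B + (0\<^sub>m p q - D) = B - D"
    using assms(1,2)[THEN mats_overD] by (intro eq_matI) auto
  finally show ?thesis .
qed

lemma N_truncation_le:
  assumes B: "B \<in> mats_over K p q" and C: "C \<in> mats_over K p q" and pq: "0 < p" "0 < q"
    and X: "truncated_svd K k B X" and rank: "mat_rank C \<le> k"
  shows "N (B - X) \<le> N (B - C)"
proof -
  note t = truncated_svd_pinv[OF B X]
  have "sv (B - X) i \<le> 1 * sv (B - C) i" for i
  proof -
    have "B = (B - C) + C"
      using B C by (intro eq_matI) (auto dest!: mats_overD)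
    then have "sv B (i + k) \<le> sv (B - C) i + sv C k"
      using sv_add[of "B - C" p q C i k] mats_overD[OF C] minus_over[OF B C] by (auto dest: mats_overD)
    then show ?thesis using t(14)[of i] rank mat_rank_le_iff[of C k] by (simp add: add.commute)
  qed
  then have "N (B - X) \<le> 1 * N (B - C)"
    using t(1) by (intro N_mono[OF minus_over pq minus_over pq]) (use B C in auto)
  then show ?thesis by simp
qed

lemma N_residual:
  assumes B: "B \<in> mats_over K p q" and C: "C \<in> mats_over K p q" and pq: "0 < p" "0 < q"
    and X: "truncated_svd K k B X" and rank: "mat_rank C \<le> k"
  shows "N ((1\<^sub>m p - X * pinv X) * C) \<le> 2 * N (B - C)"
    and "N (C * (1\<^sub>m q - pinv X * X)) \<le> 2 * N (B - C)"
proof -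
  note t = truncated_svd_pinv[OF B X]
  have le: "N (B - X) \<le> N (B - C)" by (rule N_truncation_le[OF assms])
  note d = carrier_matD[OF mats_overD[OF B]] carrier_matD[OF mats_overD[OF C]]
    carrier_matD[OF mats_overD[OF t(1)]] carrier_matD[OF mats_overD[OF t(2)]]
  have P: "1\<^sub>m p - X * pinv X \<in> mats_over K p p" (is "?P \<in> _")
    using t by (intro minus_over mult_over[of _ p q]) auto
  have Q: "1\<^sub>m q - pinv X * X \<in> mats_over K q q" (is "?Q \<in> _")
    using t by (intro minus_over mult_over[of _ q p]) auto
  have D: "B - C \<in> mats_over K p q" by (rule minus_over[OF B C])
  have PB: "?P * B = B - X"
    using d t(5) B by (simp add: mat_mult_distribs left_mult_one_mat[OF mats_overD[OF B]])
  have BQ: "B * ?Q = B - X"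
    using d t(6) t(8) t(3) B
    by (simp add: mat_mult_distribs right_mult_one_mat[OF mats_overD[OF B]] mat_mult_assoc[symmetric])
  have "?P * C = (B - X) - ?P * (B - C)"
    unfolding PB[symmetric] using d
    by (subst mat_mult_distribs(4)) (auto intro!: eq_matI simp del: index_mult_mat(1))
  then have "N (?P * C) \<le> N (B - X) + N (?P * (B - C))"
    using N_diff[OF minus_over[OF B t(1)] mult_over[OF P D] pq] by simp
  also have "N (?P * (B - C)) \<le> 1 * N (B - C)"
    using d by (intro N_mult_left[OF mult_over[OF P D] pq D pq(1) _ t(11)]) auto
  finally show "N (?P * C) \<le> 2 * N (B - C)" using le by simp
  have "C * ?Q = (B - X) - (B - C) * ?Q"
    unfolding BQ[symmetric] using d
    by (subst mat_mult_distribs(3)) (auto intro!: eq_matI simp del: index_mult_mat(1))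
  then have "N (C * ?Q) \<le> N (B - X) + N ((B - C) * ?Q)"
    using N_diff[OF minus_over[OF B t(1)] mult_over[OF D Q] pq] by simp
  also have "N ((B - C) * ?Q) \<le> 1 * N (B - C)"
    using d by (intro N_mult_right[OF mult_over[OF D Q] pq D pq(2) _ t(12)]) auto
  finally show "N (C * ?Q) \<le> 2 * N (B - C)" using le by simp
qed

end

text \<open>The hypotheses of the theorem after choosing matrices \<open>L\<close> and \<open>M\<close> that recover \<open>A\<close> from
  its selected rows and columns; \<open>P\<close> and \<open>Q\<close> are the row selection matrices of \<open>I\<close> and \<open>J\<close>.\<close>

locale cur_perturbation = sv_norm +
  fixes m n l r k :: nat and A E P Q L M :: "complex mat" and tI tJ :: real
  assumes A: "A \<in> mats_over K m n" and E: "E \<in> mats_over K m n"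
    and P: "P \<in> mats_over K l m" "op_bounded P 1"
    and Q: "Q \<in> mats_over K n r" "op_bounded Q 1"
    and L: "L \<in> carrier_mat m l" "op_bounded L tI" and t: "1 \<le> tI" "1 \<le> tJ"
    and M: "M \<in> carrier_mat r n" "op_bounded M tJ"
    and LR: "L * (P * A) = A" and CM: "(A * Q) * M = A"
    and dims: "0 < m" "0 < n" "0 < l" "0 < r" "0 < k"
    and rankA: "mat_rank A \<le> k"
begin

abbreviation "At \<equiv> A + E"

lemmas carriers = mats_overD[OF A] mats_overD[OF E] mats_overD[OF P(1)] mats_overD[OF Q(1)] L(1) M(1)
lemmas dd = carriers[THEN carrier_matD(1)] carriers[THEN carrier_matD(2)]

lemma products_over: "At \<in> mats_over K m n" "A * Q \<in> mats_over K m r" "E * Q \<in> mats_over K m r"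
  "At * Q \<in> mats_over K m r" "P * A \<in> mats_over K l n" "P * E \<in> mats_over K l n" "P * At \<in> mats_over K l n"
  "P * A * Q \<in> mats_over K l r" "P * E * Q \<in> mats_over K l r" "P * At * Q \<in> mats_over K l r"
  by (intro mult_over[of _ l m] mult_over[of _ m n] mult_over[of _ l n] add_over A E P Q)+

lemma split_sums: "At * Q = A * Q + E * Q" "P * At = P * A + P * E" "P * At * Q = P * A * Q + P * E * Q"
  using dd by (simp_all add: mat_mult_distribs)

lemma N_parts: "N (E * Q) \<le> N E" "N (P * E) \<le> N E" "N (P * E * Q) \<le> N E"
proof -
  show 1: "N (E * Q) \<le> N E"
    using N_mult_right[OF products_over(3) dims(1,4) E dims(2) _ Q(2)] dd by simp
  show "N (P * E) \<le> N E"
    using N_mult_left[OF products_over(6) dims(3,2) E dims(1) _ P(2)] dd by simp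
  have "P * E * Q = P * (E * Q)" using dd by (simp add: mat_mult_assoc)
  then have "N (P * E * Q) \<le> N (E * Q)"
    using N_mult_left[OF _ dims(3,4) products_over(3) dims(1) _ P(2)] products_over(9) dd by simp
  with 1 show "N (P * E * Q) \<le> N E" by simp
qed

lemma diff_parts: "At * Q - A * Q = E * Q" "P * At - P * A = P * E" "P * At * Q - P * A * Q = P * E * Q"
proof -
  show "At * Q - A * Q = E * Q" "P * At - P * A = P * E"
    unfolding split_sums(1,2) using dd by (auto intro!: eq_matI simp del: index_mult_mat(1))
  show "P * At * Q - P * A * Q = P * E * Q"
    unfolding split_sums(3) using dd by (auto intro!: eq_matI simp del: index_mult_mat(1))
qed

lemma rank_parts: "mat_rank (A * Q) \<le> k" "mat_rank (P * A) \<le> k" "mat_rank (P * A * Q) \<le> k"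
proof -
  have 0: "sv A k = 0" using rankA by (simp add: mat_rank_le_iff)
  have "sv (A * Q) k \<le> 1 * sv A k" using dd by (intro sv_mult_right Q) auto
  then show "mat_rank (A * Q) \<le> k" using 0 sv_nonneg[of "A * Q" k] by (simp add: mat_rank_le_iff)
  have PA: "sv (P * A) k \<le> 1 * sv A k" using dd by (intro sv_mult_left P) auto
  then show "mat_rank (P * A) \<le> k" using 0 sv_nonneg[of "P * A" k] by (simp add: mat_rank_le_iff)
  have "sv (P * A * Q) k \<le> 1 * sv (P * A) k" using dd by (intro sv_mult_right Q) auto
  then have "sv (P * A * Q) k = 0" using 0 PA sv_nonneg[of "P * A * Q" k] by linarith
  then show "mat_rank (P * A * Q) \<le> k" by (simp add: mat_rank_le_iff)
qed

lemma projection_bound: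
  assumes X: "truncated_svd K k (At * Q) X" and Z: "truncated_svd K k (P * At) Z"
  shows "N (A - X * pinv X * At * pinv Z * Z) \<le> (2 * tI + 2 * tJ + 3) * N E"
proof -
  note x = truncated_svd_pinv[OF products_over(4) X] and z = truncated_svd_pinv[OF products_over(7) Z]
  define F where "F = X * pinv X"
  define G where "G = pinv Z * Z"
  have F: "F \<in> mats_over K m m" and G: "G \<in> mats_over K n n"
    using x z by (auto simp: F_def G_def intro!: mult_over)
  have F': "1\<^sub>m m - F \<in> mats_over K m m" and G': "1\<^sub>m n - G \<in> mats_over K n n"
    by (intro minus_over one_over F G)+
  note d = dd mats_overD[OF F, THEN carrier_matD(1)] mats_overD[OF F, THEN carrier_matD(2)]
    mats_overD[OF G, THEN carrier_matD(1)] mats_overD[OF G, THEN carrier_matD(2)]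
  note dx = mats_overD[OF x(1), THEN carrier_matD(1)] mats_overD[OF x(1), THEN carrier_matD(2)]
    mats_overD[OF x(2), THEN carrier_matD(1)] mats_overD[OF x(2), THEN carrier_matD(2)]
    mats_overD[OF z(1), THEN carrier_matD(1)] mats_overD[OF z(1), THEN carrier_matD(2)]
    mats_overD[OF z(2), THEN carrier_matD(1)] mats_overD[OF z(2), THEN carrier_matD(2)]
  have "N ((1\<^sub>m m - F) * A) \<le> tJ * N ((1\<^sub>m m - F) * (A * Q))"
  proof -
    have eq: "((1\<^sub>m m - F) * (A * Q)) * M = (1\<^sub>m m - F) * A"
      using d CM by (simp add: mat_mult_assoc)
    show ?thesis
      using N_mult_right[of "(1\<^sub>m m - F) * (A * Q)" M m n r tJ] mult_over[OF F' A]
        mult_over[OF F' products_over(2)] dims M t d by (simp add: eq)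
  qed
  also have "\<dots> \<le> tJ * (2 * N E)"
  proof (intro mult_left_mono)
    have "N ((1\<^sub>m m - F) * (A * Q)) \<le> 2 * N (At * Q - A * Q)"
      unfolding F_def by (rule N_residual(1)[OF products_over(4,2) dims(1,4) X rank_parts(1)])
    then show "N ((1\<^sub>m m - F) * (A * Q)) \<le> 2 * N E" using diff_parts(1) N_parts(1) by simp
  qed (use t in simp)
  finally have 1: "N ((1\<^sub>m m - F) * A) \<le> tJ * (2 * N E)" .
  have "N (A * (1\<^sub>m n - G)) \<le> tI * N ((P * A) * (1\<^sub>m n - G))"
  proof -
    have "L * ((P * A) * (1\<^sub>m n - G)) = (L * (P * A)) * (1\<^sub>m n - G)"
      using d by (simp add: mat_mult_assoc)
    then have eq: "L * ((P * A) * (1\<^sub>m n - G)) = A * (1\<^sub>m n - G)" unfolding LR .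
    show ?thesis
      using N_mult_left[of L "(P * A) * (1\<^sub>m n - G)" m n l tI] mult_over[OF A G']
        mult_over[OF products_over(5) G'] dims L t d by (simp add: eq)
  qed
  also have "\<dots> \<le> tI * (2 * N E)"
  proof (intro mult_left_mono)
    have "N ((P * A) * (1\<^sub>m n - G)) \<le> 2 * N (P * At - P * A)"
      unfolding G_def by (rule N_residual(2)[OF products_over(7,5) dims(3,2) Z rank_parts(2)])
    then show "N ((P * A) * (1\<^sub>m n - G)) \<le> 2 * N E" using diff_parts(2) N_parts(2) by simp
  qed (use t in simp)
  finally have 2: "N (A * (1\<^sub>m n - G)) \<le> tI * (2 * N E)" .
  have AG: "A * (1\<^sub>m n - G) \<in> mats_over K m n" by (rule mult_over[OF A G'])
  have "N (F * (A * (1\<^sub>m n - G))) \<le> 1 * N (A * (1\<^sub>m n - G))"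
    using d x(9) unfolding F_def[symmetric]
    by (intro N_mult_left[OF mult_over[OF F AG] dims(1,2) AG dims(1)]) auto
  with 2 have 3: "N (F * (A * (1\<^sub>m n - G))) \<le> tI * (2 * N E)" by simp
  have EG: "E * G \<in> mats_over K m n" by (rule mult_over[OF E G])
  have "N (F * (E * G)) \<le> 1 * N (E * G)"
    using d x(9) unfolding F_def[symmetric]
    by (intro N_mult_left[OF mult_over[OF F EG] dims(1,2) EG dims(1)]) auto
  moreover have "N (E * G) \<le> 1 * N E"
    using d z(10) unfolding G_def[symmetric]
    by (intro N_mult_right[OF EG dims(1,2) E dims(2)]) auto
  ultimately have 4: "N (F * (E * G)) \<le> N E" by simp
  have "X * pinv X * At * pinv Z * Z = F * (A * G) + F * (E * G)"
    unfolding F_def G_def using d dx by (simp add: mat_mult_assoc mat_mult_distribs)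
  moreover have "(1\<^sub>m m - F) * A = A - F * A" "F * (A * (1\<^sub>m n - G)) = F * A - F * (A * G)"
    using d left_mult_one_mat[OF mats_overD[OF A]] right_mult_one_mat[OF mats_overD[OF A]]
    by (simp_all add: mat_mult_distribs)
  ultimately have split: "A - X * pinv X * At * pinv Z * Z =
      ((1\<^sub>m m - F) * A + F * (A * (1\<^sub>m n - G))) - F * (E * G)"
    using d by (auto intro!: eq_matI simp del: index_mult_mat(1))
  have "N (((1\<^sub>m m - F) * A + F * (A * (1\<^sub>m n - G))) - F * (E * G))
      \<le> N ((1\<^sub>m m - F) * A + F * (A * (1\<^sub>m n - G))) + N (F * (E * G))"
    by (intro N_diff[of _ m n] add_over mult_over[OF F' A] mult_over[OF F AG] mult_over[OF F EG] dims)
  moreover have "N ((1\<^sub>m m - F) * A + F * (A * (1\<^sub>m n - G))) \<le> N ((1\<^sub>m m - F) * A) + N (F * (A * (1\<^sub>m n - G)))"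
    by (intro N_triangle[of _ m n] mult_over[OF F' A] mult_over[OF F AG] dims)
  ultimately have "N (A - X * pinv X * At * pinv Z * Z) \<le> tJ * (2 * N E) + tI * (2 * N E) + N E"
    unfolding split using 1 3 4 by linarith
  then show ?thesis using N_nonneg[OF E dims(1,2)] by (simp add: algebra_simps)
qed

lemma cross_bound:
  assumes X: "truncated_svd K k (P * At * Q) X" and \<mu>: "1 \<le> \<mu>"
    and posA: "0 < sv A (k - 1)" and gap: "4 * \<mu> * tI * tJ * N E \<le> sv A (k - 1)"
  shows "N (A - At * Q * pinv X * (P * At)) \<le>
    (1 / (2 * \<mu>) + (1 + 1 / (2 * \<mu>)) * (tI + tJ) + (4 + 1 / (2 * \<mu>)) * tI * tJ) * N E"
proof -
  note x = truncated_svd_pinv[OF products_over(10) X]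
  define Y where "Y = pinv X"
  note x' = x[folded Y_def]
  define h where "h = 1 / (2 * \<mu>)"
  define e where "e = N E"
  have e0: "0 \<le> e" using N_nonneg[OF E dims(1,2)] by (simp add: e_def)
  have h: "0 < h" "h \<le> 1" using \<mu> by (auto simp: h_def)
  define C R U Ct Rt Ut D where "C = A * Q" and "R = P * A" and "U = P * A * Q"
    and "Ct = At * Q" and "Rt = P * At" and "Ut = P * At * Q" and "D = U - Ut"
  note defs = C_def R_def U_def Ct_def Rt_def Ut_def
  have C: "C \<in> mats_over K m r" and R: "R \<in> mats_over K l n" and U: "U \<in> mats_over K l r"
    and Ct: "Ct \<in> mats_over K m r" and Rt: "Rt \<in> mats_over K l n" and Ut: "Ut \<in> mats_over K l r"
    unfolding defs by (rule products_over)+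
  have X': "X \<in> mats_over K l r" and Y: "Y \<in> mats_over K r l" using x' by auto
  have D: "D \<in> mats_over K l r" unfolding D_def by (rule minus_over[OF U Ut])
  have EC: "E * Q \<in> mats_over K m r" and ER: "P * E \<in> mats_over K l n" by (rule products_over)+
  note all = A E C R U Ct Rt Ut X' Y D EC ER
  note d = dd all[THEN mats_overD, THEN carrier_matD(1)] all[THEN mats_overD, THEN carrier_matD(2)]
  have ND: "N D \<le> e"
    unfolding D_def N_minus_commute[OF U Ut dims(3,4)]
    using diff_parts(3) N_parts(3) by (simp add: U_def Ut_def e_def)
  have NEC: "N (E * Q) \<le> e" and NER: "N (P * E) \<le> e" using N_parts by (simp_all add: e_def)
  have bD: "op_bounded D e"
    using op_bounded_sv sv_le_N[OF D dims(3,4)] ND by (rule op_bounded_mono[OF _ order_trans])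
  have bEC: "op_bounded (E * Q) e"
    using op_bounded_sv sv_le_N[OF EC dims(1,4)] NEC by (rule op_bounded_mono[OF _ order_trans])
  have LUM: "L * (U * M) = A"
    using LR CM dd unfolding U_def by (simp add: mat_mult_assoc)
  have LU: "L * U = C"
    using LR dd unfolding U_def C_def by (simp add: mat_mult_assoc[symmetric])
  have UM: "U * M = R"
    using CM dd unfolding U_def R_def by (simp add: mat_mult_assoc)
  have svA: "sv A (k - 1) \<le> tI * tJ * sv U (k - 1)"
  proof -
    have "sv A (k - 1) \<le> tI * sv (U * M) (k - 1)"
      unfolding LUM[symmetric] using L t d by (intro sv_mult_left) auto
    also have "\<dots> \<le> tI * (tJ * sv U (k - 1))"
      using M t d by (intro mult_left_mono sv_mult_right) auto
    finally show ?thesis by simp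
  qed
  have tt: "0 < tI * tJ" using t by simp
  have "tI * tJ * (4 * \<mu> * e) \<le> tI * tJ * sv U (k - 1)"
    using svA gap by (simp add: e_def ac_simps)
  then have Ue: "4 * \<mu> * e \<le> sv U (k - 1)" using tt by (simp only: mult_le_cancel_left_pos)
  have "0 < tI * tJ * sv U (k - 1)" using svA posA by linarith
  then have Upos: "0 < sv U (k - 1)" using tt by (simp only: zero_less_mult_pos)
  define s where "s = sv Ut (k - 1)"
  have Us: "sv U (k - 1) \<le> e + s"
  proof -
    have "U = D + Ut" unfolding D_def using U Ut by (intro eq_matI) (auto dest!: mats_overD)
    then have "sv U (0 + (k - 1)) \<le> sv D 0 + sv Ut (k - 1)"
      using sv_add[of D l r Ut 0 "k - 1"] D Ut by (auto dest: mats_overD)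
    then show ?thesis using sv_le_N[OF D dims(3,4), of 0] ND by (simp add: s_def)
  qed
  have se: "2 * \<mu> * e \<le> s"
  proof -
    have "1 * e \<le> \<mu> * e" using \<mu> e0 by (rule mult_right_mono)
    then show ?thesis using Ue Us e0 by linarith
  qed
  have spos: "0 < s"
  proof (cases "e = 0")
    case True
    then show ?thesis using Us Upos by simp
  next
    case False
    then have "0 < 2 * \<mu> * e" using e0 \<mu> by simp
    then show ?thesis using se by linarith
  qed
  have bY: "op_bounded Y (1 / s)"
    using x(13) spos unfolding Y_def s_def Ut_def by simp
  have es: "e * (1 / s) \<le> h"
    using se spos \<mu> by (simp add: h_def field_simps)
  have se': "1 / s * e \<le> h" using es by simp
  have YUt: "Y * Ut = Y * X" "Ut * Y = X * Y" "X * Y * Ut = X" and YX1: "op_bounded (X * Y) 1"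
    "op_bounded (Y * X) 1" "op_bounded (1\<^sub>m l - X * Y) 1"
    using x' by (auto simp: Ut_def)
  have Ueq: "U = Ut + D" unfolding D_def using U Ut by (intro eq_matI) (auto dest!: mats_overD)
  have bYD: "op_bounded (Y * D) h"
    using op_bounded_mono[OF op_bounded_mult[OF bY bD mats_overD[OF Y] mats_overD[OF D]] se'] spos by simp
  have bDY: "op_bounded (D * Y) h"
    using op_bounded_mono[OF op_bounded_mult[OF bD bY mats_overD[OF D] mats_overD[OF Y]] es] e0 by simp
  have bYU: "op_bounded (Y * U) (1 + h)"
  proof -
    have "Y * U = Y * X + Y * D" unfolding Ueq YUt(1)[symmetric] using d by (simp add: mat_mult_distribs)
    then show ?thesis using op_bounded_add[OF YX1(2) bYD, of r r] all[THEN mats_overD] by simp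
  qed
  have bUY: "op_bounded (U * Y) (1 + h)"
  proof -
    have "U * Y = X * Y + D * Y" unfolding Ueq YUt(2)[symmetric] using d by (simp add: mat_mult_distribs)
    then show ?thesis using op_bounded_add[OF YX1(1) bDY, of l l] all[THEN mats_overD] by simp
  qed
  have XY: "1\<^sub>m l - X * Y \<in> mats_over K l l" and YX: "Y * X \<in> mats_over K r r"
    by (intro minus_over one_over mult_over[OF X' Y] mult_over[OF Y X'])+
  have YU: "Y * U \<in> mats_over K r r" and UY: "U * Y \<in> mats_over K l l" and YD: "Y * D \<in> mats_over K r r"
    and DYD: "D * (Y * D) \<in> mats_over K l r"
    by (intro mult_over[of _ _ l] mult_over[of _ _ r] Y U D)+

  have NZ: "N (U - U * (Y * U)) \<le> (3 + h) * e"
  proof -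
    have "U * (Y * U) = X + X * (Y * D) + D * (Y * X) + D * (Y * D)"
    proof -
      have "U * (Y * U) = (Ut * Y) * Ut + (Ut * Y) * D + D * (Y * Ut) + D * (Y * D)"
        unfolding Ueq using d
        by (simp add: mat_mult_distribs mat_mult_assoc)
          (auto intro!: eq_matI simp del: index_mult_mat(1))
      then show ?thesis unfolding YUt using d by (simp add: mat_mult_assoc)
    qed
    moreover have "(1\<^sub>m l - X * Y) * D = D - X * (Y * D)"
      using d left_mult_one_mat[OF mats_overD[OF D]] by (simp add: mat_mult_distribs mat_mult_assoc)
    ultimately have split: "U - U * (Y * U) =
        (Ut - X) + (1\<^sub>m l - X * Y) * D - D * (Y * X) - D * (Y * D)"
      using d by (subst (1) Ueq) (auto intro!: eq_matI simp del: index_mult_mat(1))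
    have "N ((Ut - X) + (1\<^sub>m l - X * Y) * D - D * (Y * X) - D * (Y * D)) \<le>
        N ((Ut - X) + (1\<^sub>m l - X * Y) * D - D * (Y * X)) + N (D * (Y * D))"
      by (intro N_diff[of _ l r] minus_over add_over Ut X' mult_over[OF XY D] mult_over[OF D YX] DYD dims)
    moreover have "N ((Ut - X) + (1\<^sub>m l - X * Y) * D - D * (Y * X)) \<le>
        N ((Ut - X) + (1\<^sub>m l - X * Y) * D) + N (D * (Y * X))"
      by (intro N_diff[of _ l r] minus_over add_over Ut X' mult_over[OF XY D] mult_over[OF D YX] dims)
    moreover have "N ((Ut - X) + (1\<^sub>m l - X * Y) * D) \<le> N (Ut - X) + N ((1\<^sub>m l - X * Y) * D)"
      by (intro N_triangle[of _ l r] minus_over Ut X' mult_over[OF XY D] dims)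
    moreover have "N (Ut - X) \<le> N (Ut - U)"
      using N_truncation_le[OF Ut U dims(3,4) X[folded Ut_def]] rank_parts(3) by (simp add: U_def)
    moreover have "N (Ut - U) \<le> e" using ND N_minus_commute[OF U Ut dims(3,4)] by (simp add: D_def)
    moreover have "N ((1\<^sub>m l - X * Y) * D) \<le> 1 * N D"
      using d by (intro N_mult_left[OF mult_over[OF XY D] dims(3,4) D dims(3) _ YX1(3)]) auto
    moreover have "N (D * (Y * X)) \<le> 1 * N D"
      using d by (intro N_mult_right[OF mult_over[OF D YX] dims(3,4) D dims(4) _ YX1(2)]) auto
    moreover have "N (D * (Y * D)) \<le> h * N D"
      using d h by (intro N_mult_right[OF DYD dims(3,4) D dims(4) _ bYD]) auto
    moreover have "h * N D \<le> h * e" using ND h by (intro mult_left_mono) auto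
    ultimately have "N (U - U * (Y * U)) \<le> e + e + e + h * e"
      unfolding split using ND by linarith
    then show ?thesis by (simp add: algebra_simps)
  qed

  have Z: "U - U * (Y * U) \<in> mats_over K l r" by (intro minus_over U mult_over[OF U YU])
  have CYR: "C * (Y * R) \<in> mats_over K m n" by (intro mult_over[OF C] mult_over[OF Y R])
  have LZM: "L * ((U - U * (Y * U)) * M) = A - C * (Y * R)"
  proof -
    have "L * ((U - U * (Y * U)) * M) = L * (U * M) - (L * U) * (Y * (U * M))"
      using d by (simp add: mat_mult_distribs mat_mult_assoc)
    then show ?thesis unfolding LUM unfolding LU UM .
  qed
  have "N (A - C * (Y * R)) \<le> (tI * tJ) * N (U - U * (Y * U))"
    unfolding LZM[symmetric]
  proof (rule N_mono[OF _ dims(1,2) Z dims(3,4)])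
    show "L * ((U - U * (Y * U)) * M) \<in> mats_over K m n" unfolding LZM by (rule minus_over[OF A CYR])
    show "sv (L * ((U - U * (Y * U)) * M)) i \<le> tI * tJ * sv (U - U * (Y * U)) i" for i
    proof -
      have "sv (L * ((U - U * (Y * U)) * M)) i \<le> tI * sv ((U - U * (Y * U)) * M) i"
        using L t d by (intro sv_mult_left) auto
      also have "\<dots> \<le> tI * (tJ * sv (U - U * (Y * U)) i)"
        using M t d by (intro mult_left_mono sv_mult_right) auto
      finally show ?thesis by simp
    qed
  qed (use tt in simp)
  also have "\<dots> \<le> (tI * tJ) * ((3 + h) * e)" using NZ tt by (intro mult_left_mono) auto
  finally have 1: "N (A - C * (Y * R)) \<le> (tI * tJ) * ((3 + h) * e)" .

  have ECYR: "E * Q * (Y * R) \<in> mats_over K m n" by (intro mult_over[OF EC] mult_over[OF Y R])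
  have 2: "N (E * Q * (Y * R)) \<le> tJ * ((1 + h) * e)"
  proof -
    have eq: "(E * Q * (Y * U)) * M = E * Q * (Y * R)"
      unfolding UM[symmetric] using d by (simp add: mat_mult_assoc)
    have "N (E * Q * (Y * R)) \<le> tJ * N (E * Q * (Y * U))"
      unfolding eq[symmetric]
      using ECYR d t by (intro N_mult_right[OF _ dims(1,2) mult_over[OF EC YU] dims(4) _ M(2)])
        (auto simp: eq)
    also have "N (E * Q * (Y * U)) \<le> (1 + h) * N (E * Q)"
      using d h by (intro N_mult_right[OF mult_over[OF EC YU] dims(1,4) EC dims(4) _ bYU]) auto
    finally have "N (E * Q * (Y * R)) \<le> tJ * ((1 + h) * N (E * Q))" using t by simp
    also have "\<dots> \<le> tJ * ((1 + h) * e)" using NEC t h by (intro mult_left_mono) auto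
    finally show ?thesis .
  qed

  have CYER: "C * (Y * (P * E)) \<in> mats_over K m n" by (intro mult_over[OF C] mult_over[OF Y ER])
  have 3: "N (C * (Y * (P * E))) \<le> tI * ((1 + h) * e)"
  proof -
    have "L * ((U * Y) * (P * E)) = (L * U) * (Y * (P * E))" using d by (simp add: mat_mult_assoc)
    then have eq: "L * ((U * Y) * (P * E)) = C * (Y * (P * E))" unfolding LU .
    have "N (C * (Y * (P * E))) \<le> tI * N ((U * Y) * (P * E))"
      unfolding eq[symmetric]
      using CYER d t by (intro N_mult_left[OF _ dims(1,2) mult_over[OF UY ER] dims(3) _ L(2)])
        (auto simp: eq)
    also have "N ((U * Y) * (P * E)) \<le> (1 + h) * N (P * E)"
      using d h by (intro N_mult_left[OF mult_over[OF UY ER] dims(3,2) ER dims(3) _ bUY]) auto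
    finally have "N (C * (Y * (P * E))) \<le> tI * ((1 + h) * N (P * E))" using t by simp
    also have "\<dots> \<le> tI * ((1 + h) * e)" using NER t h by (intro mult_left_mono) auto
    finally show ?thesis .
  qed

  have ECY: "E * Q * Y \<in> mats_over K m l" by (rule mult_over[OF EC Y])
  have 4: "N (E * Q * Y * (P * E)) \<le> h * e"
  proof -
    have "op_bounded (E * Q * Y) h"
      using op_bounded_mono[OF op_bounded_mult[OF bEC bY mats_overD[OF EC] mats_overD[OF Y]] es] e0 by simp
    then have "N (E * Q * Y * (P * E)) \<le> h * N (P * E)"
      using d h by (intro N_mult_left[OF mult_over[OF ECY ER] dims(1,2) ER dims(3)]) auto
    also have "\<dots> \<le> h * e" using NER h by (intro mult_left_mono) auto
    finally show ?thesis .
  qed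

  have "At * Q * Y * (P * At) = C * (Y * R) + E * Q * (Y * R) + C * (Y * (P * E)) + E * Q * Y * (P * E)"
    unfolding split_sums(1,2) C_def R_def using d
    by (simp add: mat_mult_distribs mat_mult_assoc)
      (auto intro!: eq_matI simp del: index_mult_mat(1))
  then have split: "A - At * Q * Y * (P * At) =
      (((A - C * (Y * R)) - E * Q * (Y * R)) - C * (Y * (P * E))) - E * Q * Y * (P * E)"
    using d by (auto intro!: eq_matI simp del: index_mult_mat(1))
  have "N ((((A - C * (Y * R)) - E * Q * (Y * R)) - C * (Y * (P * E))) - E * Q * Y * (P * E)) \<le>
      N (((A - C * (Y * R)) - E * Q * (Y * R)) - C * (Y * (P * E))) + N (E * Q * Y * (P * E))"
    by (intro N_diff[of _ m n] minus_over A CYR ECYR CYER mult_over[OF ECY ER] dims)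
  moreover have "N (((A - C * (Y * R)) - E * Q * (Y * R)) - C * (Y * (P * E))) \<le>
      N ((A - C * (Y * R)) - E * Q * (Y * R)) + N (C * (Y * (P * E)))"
    by (intro N_diff[of _ m n] minus_over A CYR ECYR CYER dims)
  moreover have "N ((A - C * (Y * R)) - E * Q * (Y * R)) \<le> N (A - C * (Y * R)) + N (E * Q * (Y * R))"
    by (intro N_diff[of _ m n] minus_over A CYR ECYR dims)
  ultimately have "N (A - At * Q * Y * (P * At)) \<le>
      (tI * tJ) * ((3 + h) * e) + tJ * ((1 + h) * e) + tI * ((1 + h) * e) + h * e"
    unfolding split using 1 2 3 4 by linarith
  also have "\<dots> \<le> (h + (1 + h) * (tI + tJ) + (4 + h) * tI * tJ) * e"
  proof -
    have "0 \<le> tI * tJ * e" using tt e0 by simp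
    then show ?thesis by (simp add: algebra_simps)
  qed
  finally show ?thesis by (simp add: Y_def h_def e_def)
qed

end

context scalar_field
begin

lemma row_sel_over: "row_sel m I \<in> mats_over K (card I) m"
  using real_mem[of 0] real_mem[of 1] by (intro mats_overI) (auto simp: row_sel_def)

end

lemma sv_pos_of_rank: "mat_rank B = k \<Longrightarrow> 1 \<le> k \<Longrightarrow> 0 < sv B (k - 1)"
  using mat_rank_le_iff[of B "k - 1"] sv_nonneg[of B "k - 1"] by linarith

lemma sv_left_factor_pos:
  assumes "0 < sv (X * Y) i" "dim_col X = dim_row Y"
  shows "0 < sv X i"
proof -
  have "sv (X * Y) i \<le> sv Y 0 * sv X i"
    using assms by (intro sv_mult_right op_bounded_sv) auto
  then have "sv X i \<noteq> 0" using assms by auto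
  then show ?thesis using sv_nonneg[of X i] by linarith
qed

lemma max_volume_left_factor:
  assumes W: "W \<in> carrier_mat m k" "mat_adjoint W * W = 1\<^sub>m k" and I: "I \<subseteq> {..<m}"
    and k: "1 \<le> k" and pos: "0 < sv (row_sel m I * W) (k - 1)" and max: "max_volume_rows W I"
  obtains L where "L \<in> carrier_mat m (card I)" "L * (row_sel m I * W) = W"
    "op_bounded L (t_const k m (card I))" "1 \<le> t_const k m (card I)" "k \<le> card I" "card I \<le> m"
proof -
  have B: "row_sel m I * W \<in> carrier_mat (card I) k"
    using submatrix_rows_carrier[OF I W(1)] submatrix_rows[OF I W(1)] by simp
  note low = max_volume_rows_lower_bound[OF W I k, unfolded submatrix_rows[OF I W(1)], OF pos max]
  have t1: "1 \<le> t_const k m (card I)" "k \<le> card I" using low(2,3)[of "0\<^sub>v k"] by auto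
  have pos': "0 < sv (row_sel m I * W) i" if "i < k" for i
    using sv_antimono[of i "k - 1" "row_sel m I * W"] pos that by linarith
  obtain L where "L \<in> carrier_mat m (card I)" "L * (row_sel m I * W) = W"
    "op_bounded L (t_const k m (card I))"
    using left_factor_exists[OF W B pos', of "t_const k m (card I)"] low(1) t1 by force
  moreover have "card I \<le> m" using card_mono[of "{..<m}" I] I by simp
  ultimately show ?thesis using that t1 by blast
qed

theorem corollary5p3:
  fixes K :: "complex set"
    and A E W S V :: "complex mat"
    and m n k :: nat
    and I J :: "nat set"
    and N :: "complex mat \<Rightarrow> real"
    and \<mu> :: real
  assumes K: "K = \<real> \<or> K = UNIV"
    and A: "A \<in> mats_over K m n" and E: "E \<in> mats_over K m n"
    and At: "At = A + E"
    and k: "1 \<le> k" "mat_rank A = k"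
    and svd: "compact_svd K k A W S V"
    and I: "I \<subseteq> {..<m}" and J: "J \<subseteq> {..<n}"
    and C: "C = submatrix A UNIV J" and R: "R = submatrix A I UNIV" and U: "U = submatrix A I J"
    and Ct: "Ct = submatrix At UNIV J" and Rt: "Rt = submatrix At I UNIV"
    and Ut: "Ut = submatrix At I J"
    and ranks: "mat_rank C = k" "mat_rank U = k" "mat_rank R = k"
    and norm: "norm_family K N" "normalized K N" "uniformly_generated K N"
      "unitarily_invariant K N" "submultiplicative K N"
    and \<mu>: "pinv_perturbation_constant K N \<mu>"
    and maxvol: "max_volume_rows W I" "max_volume_rows V J"
    and tI: "tI = t_const k m (card I)" and tJ: "tJ = t_const k n (card J)"
  shows "(\<forall>Ck Rk. truncated_svd K k Ct Ck \<longrightarrow> truncated_svd K k Rt Rk \<longrightarrow>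
            N (A - Ck * pinv Ck * At * pinv Rk * Rk) \<le> (2 * tI + 2 * tJ + 3) * N E) \<and>
         (singular_value A k \<ge> 4 * \<mu> * tI * tJ * N E \<longrightarrow>
            (\<forall>Uk. truncated_svd K k Ut Uk \<longrightarrow>
               N (A - Ct * pinv Uk * Rt) \<le>
                 (1 / (2 * \<mu>) + (1 + 1 / (2 * \<mu>)) * (tI + tJ) + (4 + 1 / (2 * \<mu>)) * tI * tJ) * N E))"
proof -
  interpret sv_norm K N by unfold_locales (use K norm in auto)
  let ?P = "row_sel m I" and ?Q = "mat_adjoint (row_sel n J)"
  have Ac: "A \<in> carrier_mat m n" and Atc: "At \<in> carrier_mat m n"
    using A E by (auto simp: At dest!: mats_overD)
  note svd' = svd[unfolded compact_svd_def carrier_matD[OF Ac]]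
  have W: "W \<in> carrier_mat m k" "mat_adjoint W * W = 1\<^sub>m k"
    and V: "V \<in> carrier_mat n k" "mat_adjoint V * V = 1\<^sub>m k"
    and Aeq: "A = W * S * mat_adjoint V"
    using svd' mats_overD by blast+
  have "S = mat_diag k (\<lambda>i. of_real (sv A i))" using svd' by blast
  then have S: "S \<in> carrier_mat k k" by simp
  have sel: "submatrix B UNIV J = B * ?Q" "submatrix B I UNIV = ?P * B" "submatrix B I J = ?P * B * ?Q"
    if "B \<in> carrier_mat m n" for B
  proof -
    show 1: "submatrix B UNIV J = B * ?Q" by (rule submatrix_cols[OF J that])
    show "submatrix B I UNIV = ?P * B" by (rule submatrix_rows[OF I that])
    have "B * ?Q \<in> carrier_mat m (card J)"
      using that mat_adjoint_carrier[OF row_sel_carrier[OF J]] by simp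
    from submatrix_rows[OF I this] show "submatrix B I J = ?P * B * ?Q"
      using that unfolding submatrix_split[of B I J] 1
      by (simp add: mat_mult_assoc row_sel_dim[OF I] row_sel_dim[OF J])
  qed
  note dims = row_sel_dim[OF I] row_sel_dim[OF J] carrier_matD[OF W(1)] carrier_matD[OF V(1)]
    carrier_matD[OF S]
  have Req: "?P * A = (?P * W) * (S * mat_adjoint V)"
    unfolding Aeq using dims by (simp add: mat_mult_assoc)
  have Ceq: "A * ?Q = (W * S) * mat_adjoint (row_sel n J * V)"
    unfolding Aeq using dims by (simp add: mat_mult_assoc mat_adjoint_mult)
  have "0 < sv (?P * A) (k - 1)"
    using sv_pos_of_rank[OF ranks(3) k(1)] R sel(2)[OF Ac] by simp
  then have "0 < sv (?P * W) (k - 1)"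
    unfolding Req by (rule sv_left_factor_pos) (simp add: dims)
  from max_volume_left_factor[OF W I k(1) this maxvol(1)]
  obtain L where L: "L \<in> carrier_mat m (card I)" "L * (?P * W) = W" "op_bounded L tI"
    and tI1: "1 \<le> tI" and cI: "k \<le> card I" "card I \<le> m"
    unfolding tI by metis
  have "0 < sv (A * ?Q) (k - 1)"
    using sv_pos_of_rank[OF ranks(1) k(1)] C sel(1)[OF Ac] by simp
  then have "0 < sv (mat_adjoint (A * ?Q)) (k - 1)" by (simp add: sv_adjoint)
  also have "mat_adjoint (A * ?Q) = (row_sel n J * V) * mat_adjoint (W * S)"
    unfolding Ceq using dims by (subst mat_adjoint_mult) auto
  finally have "0 < sv (row_sel n J * V) (k - 1)"
    by (rule sv_left_factor_pos) (simp add: dims)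
  from max_volume_left_factor[OF V J k(1) this maxvol(2)]
  obtain M where M: "M \<in> carrier_mat n (card J)" "M * (row_sel n J * V) = V" "op_bounded M tJ"
    and tJ1: "1 \<le> tJ" and cJ: "k \<le> card J" "card J \<le> n"
    unfolding tJ by metis
  have LR: "L * (?P * A) = A"
  proof -
    have "L * (?P * A) = (L * (?P * W)) * (S * mat_adjoint V)"
      unfolding Req using dims L(1) by (simp add: mat_mult_assoc)
    also have "\<dots> = W * S * mat_adjoint V"
      unfolding L(2) using dims by (simp add: mat_mult_assoc)
    finally show ?thesis unfolding Aeq[symmetric] .
  qed
  have CM: "(A * ?Q) * mat_adjoint M = A"
  proof -
    have "(A * ?Q) * mat_adjoint M = (W * S) * mat_adjoint (M * (row_sel n J * V))"
      unfolding Ceq using dims M(1) by (simp add: mat_mult_assoc mat_adjoint_mult)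
    then show ?thesis unfolding M(2) Aeq[symmetric] .
  qed
  have "cur_perturbation K N m n (card I) (card J) k A E ?P ?Q L (mat_adjoint M) tI tJ"
  proof unfold_locales
    show "?P \<in> mats_over K (card I) m" by (rule row_sel_over)
    show "?Q \<in> mats_over K n (card J)" by (rule adjoint_over[OF row_sel_over])
    show "op_bounded ?P 1" by (rule op_bounded_row_sel(1)[OF I])
    show "op_bounded ?Q 1" by (rule op_bounded_row_sel(2)[OF J])
    show "op_bounded (mat_adjoint M) tJ" by (rule op_bounded_adjoint[OF M(3,1)]) (use tJ1 in simp)
    show "mat_adjoint M \<in> carrier_mat (card J) n" using M(1) by (rule mat_adjoint_carrier)
    show "mat_rank A \<le> k" using k(2) by simp
    show "0 < m" "0 < n" "0 < card I" "0 < card J" "0 < k" using k(1) cI cJ by linarith+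
  qed (fact A E L LR CM tI1 tJ1)+
  then interpret cur: cur_perturbation K N m n "card I" "card J" k A E ?P ?Q L "mat_adjoint M" tI tJ .
  have mu1: "1 \<le> \<mu>" using \<mu> by (simp add: pinv_perturbation_constant_def)
  have eqs: "Ct = (A + E) * ?Q" "Rt = ?P * (A + E)" "Ut = ?P * (A + E) * ?Q"
    using sel[OF Atc] unfolding Ct Rt Ut At by blast+
  have sA: "singular_value A k = sv A (k - 1)" using k(1) by simp
  show ?thesis
    using cur.projection_bound cur.cross_bound[OF _ mu1 sv_pos_of_rank[OF k(2,1)]]
    unfolding sA eqs At by blast
qed

end
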